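(* Let $(\mathfrak g,r,Z)$ be a coboundary Lie bialgebra over a field $\mathbb K$ of characteristic $0$, and let $\varphi\in(\mathfrak m_{\mathfrak g^*}^{\widehat\otimes3})^{\mathfrak g}$ be a lift of $Z$. Then there exists $\rho\in\mathfrak m_{\mathfrak g^*}^{\widehat\otimes2}$, the image of which in $\mathfrak g^{\otimes2}$ under the (tensor) square of the projection $\mathfrak m_{\mathfrak g^*}\to\mathfrak m_{\mathfrak g^*}/\mathfrak m_{\mathfrak g^*}^2=\mathfrak g$ equals $r$, and such that the functional cocycle equation $$\rho^{1,2}\star\rho^{12,3}=\rho^{2,3}\star\rho^{1,23}\star\varphi$$ holds. Such a $\rho$ (called a lift of $r$) is unique up to the action of $\mathfrak m_{\mathfrak g^*}^2$ by $\lambda\cdot\rho=\lambda^1\star\lambda^2\star\rho\star(-\lambda)^{12}$.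
   Context: A coboundary Lie bialgebra $(\mathfrak g,r,Z)$ is a Lie bialgebra $\mathfrak g$ with $r\in\wedge^2(\mathfrak g)\subset\mathfrak g^{\otimes2}$ such that the cobracket is $\delta(x)=[x\otimes1+1\otimes x,r]$ for all $x\in\mathfrak g$, where $Z=\mathrm{CYB}(r):=[r^{1,2},r^{1,3}]+[r^{1,2},r^{2,3}]+[r^{1,3},r^{2,3}]\in\wedge^3(\mathfrak g)^{\mathfrak g}$. $\mathcal O_{\mathfrak g^*}=\widehat S(\mathfrak g)$ is the ring of formal functions at $0$ on $\mathfrak g^*$, with maximal ideal $\mathfrak m_{\mathfrak g^*}$ and the linear Poisson bracket extending $\{x,y\}=[x,y]$, $x,y\in\mathfrak g$. $\mathcal O_{(\mathfrak g^* )^k}=\widehat S(\mathfrak g)^{\widehat\otimes k}$ ($\widehat\otimes$ is the completed tensor product) is the corresponding Poisson ring of formal functions on $(\mathfrak g^* )^k$, and $\mathfrak m_{(\mathfrak g^* )^k}$ is its maximal ideal. For $f,g\in\mathfrak m_{(\mathfrak g^* )^k}^2$, $f\star g=f+g+\frac12\{f,g\}+\cdots$ is the (convergent) Baker–Campbell–Hausdorff series for the Poisson bracket; it is a group law on $\mathfrak m_{(\mathfrak g^* )^k}^2$, and $\mathfrak m_{\mathfrak g^*}^{\widehat\otimes k}\subset\mathfrak m_{(\mathfrak g^* )^k}^2$ for $k\ge2$. Coproduct-insertion notation: for $f\in\mathcal O_{\mathfrak g^*}^{\widehat\otimes n}$ and disjoint $P_1,\dots,P_n\subset\{1,\dots,m\}$,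 $f^{P_1,\dots,P_n}\in\mathcal O_{\mathfrak g^*}^{\widehat\otimes m}$ is $f^{P_1,\dots,P_n}(\xi_1,\dots,\xi_m)=f(\sum_{i\in P_1}\xi_i,\dots,\sum_{i\in P_n}\xi_i)$, i.e. one applies iterated cocommutative coproducts $\Delta_0$ (dual to the addition of $\mathfrak g^*$) to the factors; e.g. $\lambda^{12}=\Delta_0(\lambda)$, $\rho^{12,3}=(\Delta_0\otimes\mathrm{id})(\rho)$. A lift of $Z$ is an element $\varphi\in(\mathfrak m_{\mathfrak g^*}^{\widehat\otimes3})^{\mathfrak g}$ (invariants for the diagonal adjoint action) whose image under $\mathfrak m_{\mathfrak g^*}^{\widehat\otimes3}\to(\mathfrak m_{\mathfrak g^*}/\mathfrak m_{\mathfrak g^*}^2)^{\otimes3}=\mathfrak g^{\otimes3}\xrightarrow{\mathrm{Alt}}\wedge^3(\mathfrak g)$ equals $Z$, where $\mathrm{Alt}$ is the total antisymmetrization map, and which satisfies the functional pentagon equation $\varphi^{1,2,34}\star\varphi^{12,3,4}=\varphi^{2,3,4}\star\varphi^{1,23,4}\star\varphi^{1,2,3}$.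
   Formalization: Alt is taken as 1/4 of the signed sum over S_3. With the usual factor 1 or 1/6 the existence claim fails whenever Z ≠ 0 and a lift of Z exists, because the cocycle equation forces the signed sum of the degree-3 part of φ to be 4Z. *)

theory Defs
  imports Complex_Main "HOL-Library.Poly_Mapping" "HOL-Combinatorics.Permutations"
begin

text \<open>
  The Lie algebra is an arbitrary vector space (no finiteness assumption) with a Lie bracket.
  Tensor and symmetric powers are written in coordinates with respect to a basis \<open>B\<close>, which is
  an arbitrary parameter of everything below.

  \<^item> A tensor in the \<open>n\<close>-th tensor power is a finitely supported function on words of length \<open>n\<close>
    over \<open>B\<close>.
  \<^item> The symmetric algebra of the \<open>k\<close>-fold direct sum of the Lie algebra is the polynomial ring in
    the variables \<open>(a, b)\<close>, where \<open>b \<in> B\<close> and \<open>a \<in> {1..k}\<close> numbers the tensor factor.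
  \<^item> Its completion (the product of all symmetric powers) consists of sequences whose \<open>n\<close>-th entry
    is a homogeneous polynomial of degree \<open>n\<close>.  It is the \<open>k\<close>-fold completed tensor power of the
    completed symmetric algebra.
\<close>

type_synonym ('g, 'k) tensor = "'g list \<Rightarrow>\<^sub>0 'k"
type_synonym ('g, 'k) pol = "((nat \<times> 'g) \<Rightarrow>\<^sub>0 nat) \<Rightarrow>\<^sub>0 'k"
type_synonym ('g, 'k) formal = "nat \<Rightarrow> ('g, 'k) pol"


section \<open>Tensors\<close>

definition tscale :: "'k::field_char_0 \<Rightarrow> ('g, 'k) tensor \<Rightarrow> ('g, 'k) tensor" where
  "tscale c t = Poly_Mapping.map ((*) c) t"

definition tpermute :: "(nat \<Rightarrow> nat) \<Rightarrow> ('g, 'k::field_char_0) tensor \<Rightarrow> ('g, 'k) tensor" where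
  "tpermute \<sigma> t =
    (\<Sum>w\<in>Poly_Mapping.keys t. Poly_Mapping.single (permute_list \<sigma> w) (Poly_Mapping.lookup t w))"

text \<open>
  Total antisymmetrization of 3-tensors.  It is proportional to the signed sum over the symmetric group;
  the factor is fixed by the requirement that lifts of \<open>r\<close> can exist.
  Indeed, for \<open>\<rho> = r + \<rho>\<^sub>3 + \<dots>\<close> the part of degree 3 of the cocycle equation is
  \<open>\<phi>\<^sub>3 = d \<rho>\<^sub>3 + (CYB r + [r\<^sup>1\<^sup>2, r\<^sup>2\<^sup>3]) / 2\<close>.  The signed sum over the symmetric group kills \<open>d \<rho>\<^sub>3\<close>,
  maps \<open>CYB r\<close> to \<open>6 CYB r\<close> and \<open>[r\<^sup>1\<^sup>2, r\<^sup>2\<^sup>3]\<close> to \<open>2 CYB r\<close>, hence \<open>\<phi>\<^sub>3\<close> to \<open>4 CYB r\<close>.  So the image of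
  \<open>\<phi>\<close> is \<open>CYB r\<close> precisely for the factor \<open>1/4\<close>, and for no other factor when \<open>CYB r \<noteq> 0\<close>.
\<close>
definition Alt3 :: "('g, 'k::field_char_0) tensor \<Rightarrow> ('g, 'k) tensor" where
  "Alt3 t = tscale (1 / 4) (\<Sum>\<sigma> | \<sigma> permutes {..<3}. tscale (of_int (sign \<sigma>)) (tpermute \<sigma> t))"


section \<open>Polynomials\<close>

definition Const :: "'k::field_char_0 \<Rightarrow> ('g, 'k) pol" where
  "Const c = Poly_Mapping.single 0 c"

definition Var :: "nat \<times> 'g \<Rightarrow> ('g, 'k::field_char_0) pol" where
  "Var v = Poly_Mapping.single (Poly_Mapping.single v 1) 1"

definition vars :: "('g, 'k::field_char_0) pol \<Rightarrow> (nat \<times> 'g) set" where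
  "vars F = (\<Union>m\<in>Poly_Mapping.keys F. Poly_Mapping.keys m)"

definition mdeg :: "((nat \<times> 'g) \<Rightarrow>\<^sub>0 nat) \<Rightarrow> nat" where
  "mdeg m = (\<Sum>v\<in>Poly_Mapping.keys m. Poly_Mapping.lookup m v)"

definition pdiff :: "nat \<times> 'g \<Rightarrow> ('g, 'k::field_char_0) pol \<Rightarrow> ('g, 'k) pol" where
  "pdiff v F = (\<Sum>m\<in>Poly_Mapping.keys F.
     Poly_Mapping.single (m - Poly_Mapping.single v 1)
       (of_nat (Poly_Mapping.lookup m v) * Poly_Mapping.lookup F m))"

definition psubst :: "(nat \<times> 'g \<Rightarrow> ('g, 'k::field_char_0) pol) \<Rightarrow> ('g, 'k) pol \<Rightarrow> ('g, 'k) pol" where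
  "psubst s F = (\<Sum>m\<in>Poly_Mapping.keys F.
     Const (Poly_Mapping.lookup F m) * (\<Prod>v\<in>Poly_Mapping.keys m. s v ^ Poly_Mapping.lookup m v))"


section \<open>Formal functions\<close>

text \<open>\<open>ins [P\<^sub>1, \<dots>, P\<^sub>n] f\<close> is \<open>f\<close> with \<open>P\<^sub>1, \<dots>, P\<^sub>n\<close> as superscripts: the algebra morphism which
  sends \<open>b\<close> in the \<open>i\<close>-th factor to the sum over \<open>a \<in> P\<^sub>i\<close> of \<open>b\<close> in the \<open>a\<close>-th factor.\<close>

definition ins :: "nat set list \<Rightarrow> ('g, 'k::field_char_0) formal \<Rightarrow> ('g, 'k) formal" where
  "ins P f = (\<lambda>n. psubst (\<lambda>(i, b). \<Sum>a\<in>P ! (i - 1). Var (a, b)) (f n))"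

definition neg :: "('g, 'k::field_char_0) formal \<Rightarrow> ('g, 'k) formal" where
  "neg f = (\<lambda>n. - f n)"

text \<open>The map to the \<open>k\<close>-th tensor power of \<open>\<mm>/\<mm>\<^sup>2\<close>: it extracts the coefficients of the monomials
  of degree 1 in each of the \<open>k\<close> factors.\<close>

definition multilinear_part :: "nat \<Rightarrow> ('g, 'k::field_char_0) formal \<Rightarrow> ('g, 'k) tensor" where
  "multilinear_part k f = Poly_Mapping.Abs_poly_mapping (\<lambda>w. if length w = k
     then Poly_Mapping.lookup (f k) (\<Sum>i<k. Poly_Mapping.single (i + 1, w ! i) 1) else 0)"

text \<open>Index set of Dynkin's form of the Baker--Campbell--Hausdorff series in degree \<open>N\<close>:
  the sequences \<open>(r\<^sub>1, s\<^sub>1), \<dots>, (r\<^sub>n, s\<^sub>n)\<close> with all \<open>r\<^sub>i + s\<^sub>i > 0\<close> and total sum \<open>N\<close>.\<close>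

definition dynkin_indices :: "nat \<Rightarrow> (nat \<times> nat) list set" where
  "dynkin_indices N = {ps. (0, 0) \<notin> set ps \<and> (\<Sum>(r, s)\<leftarrow>ps. r + s) = N}"

definition dynkin_coeff :: "nat \<Rightarrow> (nat \<times> nat) list \<Rightarrow> 'k::field_char_0" where
  "dynkin_coeff N ps = (- 1) ^ (length ps - 1)
     / (of_nat (length ps) * of_nat N * (\<Prod>(r, s)\<leftarrow>ps. fact r * fact s))"

definition dynkin_word :: "'a \<Rightarrow> 'a \<Rightarrow> (nat \<times> nat) list \<Rightarrow> 'a list" where
  "dynkin_word x y ps = concat (map (\<lambda>(r, s). replicate r x @ replicate s y) ps)"


section \<open>Lie algebras\<close>

locale lie_algebra_basis = vector_space scale
  for scale :: "'k::field_char_0 \<Rightarrow> 'g::ab_group_add \<Rightarrow> 'g" +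
  fixes br :: "'g \<Rightarrow> 'g \<Rightarrow> 'g" and B :: "'g set"
  assumes br_linear_left: "Vector_Spaces.linear scale scale (\<lambda>x. br x y)"
    and br_linear_right: "Vector_Spaces.linear scale scale (br x)"
    and br_alternating: "br x x = 0"
    and br_jacobi: "br x (br y z) + br y (br z x) + br z (br x y) = 0"
    and basis_independent: "independent B"
    and basis_span: "span B = UNIV"
begin

definition tensor_space :: "nat \<Rightarrow> ('g, 'k) tensor set" where
  "tensor_space n = {t. \<forall>w\<in>Poly_Mapping.keys t. length w = n \<and> set w \<subseteq> B}"

definition wedge :: "nat \<Rightarrow> ('g, 'k) tensor set" where
  "wedge n = {t \<in> tensor_space n. \<forall>\<sigma>. \<sigma> permutes {..<n} \<longrightarrow>
     tpermute \<sigma> t = tscale (of_int (sign \<sigma>)) t}"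

text \<open>\<open>pure [x\<^sub>1, \<dots>, x\<^sub>n]\<close> is the tensor product of arbitrary elements \<open>x\<^sub>1, \<dots>, x\<^sub>n\<close>.\<close>

definition pure :: "'g list \<Rightarrow> ('g, 'k) tensor" where
  "pure xs = (\<Sum>w\<in>listset (map (\<lambda>x. {b. representation B x b \<noteq> 0}) xs).
     Poly_Mapping.single w (\<Prod>i<length xs. representation B (xs ! i) (w ! i)))"

definition tensor_ad :: "'g \<Rightarrow> ('g, 'k) tensor \<Rightarrow> ('g, 'k) tensor" where
  "tensor_ad x t = (\<Sum>w\<in>Poly_Mapping.keys t. \<Sum>i<length w.
     tscale (Poly_Mapping.lookup t w) (pure (w[i := br x (w ! i)])))"

definition CYB :: "('g, 'k) tensor \<Rightarrow> ('g, 'k) tensor" where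
  "CYB r = (\<Sum>u\<in>Poly_Mapping.keys r. \<Sum>v\<in>Poly_Mapping.keys r.
     tscale (Poly_Mapping.lookup r u * Poly_Mapping.lookup r v)
       (pure [br (u ! 0) (v ! 0), u ! 1, v ! 1] +
        pure [u ! 0, br (u ! 1) (v ! 0), v ! 1] +
        pure [u ! 0, v ! 0, br (u ! 1) (v ! 1)]))"

text \<open>\<open>apply_left \<delta>\<close> is \<open>\<delta> \<otimes> id\<close>.\<close>

definition apply_left ::
    "('g \<Rightarrow> ('g, 'k) tensor) \<Rightarrow> ('g, 'k) tensor \<Rightarrow> ('g, 'k) tensor" where
  "apply_left \<delta> t = (\<Sum>w\<in>Poly_Mapping.keys t. \<Sum>u\<in>Poly_Mapping.keys (\<delta> (hd w)).
     Poly_Mapping.single (u @ tl w)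
       (Poly_Mapping.lookup t w * Poly_Mapping.lookup (\<delta> (hd w)) u))"

text \<open>The element \<open>x\<close> of the Lie algebra, placed in the \<open>a\<close>-th factor.\<close>

definition lin :: "nat \<Rightarrow> 'g \<Rightarrow> ('g, 'k) pol" where
  "lin a x = (\<Sum>b | representation B x b \<noteq> 0. Const (representation B x b) * Var (a, b))"

definition \<O> :: "nat \<Rightarrow> ('g, 'k) formal set" where
  "\<O> k = {f. \<forall>n. \<forall>m\<in>Poly_Mapping.keys (f n). mdeg m = n \<and> Poly_Mapping.keys m \<subseteq> {1..k} \<times> B}"

text \<open>The (closed) square of the maximal ideal of \<open>\<O> k\<close>.\<close>

definition max_ideal_sq :: "nat \<Rightarrow> ('g, 'k) formal set" where
  "max_ideal_sq k = {f \<in> \<O> k. f 0 = 0 \<and> f 1 = 0}"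

text \<open>The \<open>k\<close>-fold completed tensor power of the maximal ideal of \<open>\<O> 1\<close>: every monomial involves
  each of the \<open>k\<close> factors.\<close>

definition max_ideal_tensor :: "nat \<Rightarrow> ('g, 'k) formal set" where
  "max_ideal_tensor k = {f \<in> \<O> k. \<forall>n. \<forall>m\<in>Poly_Mapping.keys (f n). \<forall>a\<in>{1..k}.
     \<exists>b. (a, b) \<in> Poly_Mapping.keys m}"

text \<open>Diagonal adjoint action, by derivations.\<close>

definition pol_ad :: "'g \<Rightarrow> ('g, 'k) pol \<Rightarrow> ('g, 'k) pol" where
  "pol_ad x F = (\<Sum>(a, b)\<in>vars F. lin a (br x b) * pdiff (a, b) F)"

definition invariants :: "('g, 'k) formal set" where
  "invariants = {f. \<forall>x n. pol_ad x (f n) = 0}"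

text \<open>The linear Poisson bracket; different factors Poisson commute.\<close>

definition pol_bracket :: "('g, 'k) pol \<Rightarrow> ('g, 'k) pol \<Rightarrow> ('g, 'k) pol" where
  "pol_bracket F G = (\<Sum>(a, b)\<in>vars F. \<Sum>(a', b')\<in>vars G.
     if a = a' then lin a (br b b') * pdiff (a, b) F * pdiff (a', b') G else 0)"

definition bracket :: "('g, 'k) formal \<Rightarrow> ('g, 'k) formal \<Rightarrow> ('g, 'k) formal" where
  "bracket f g = (\<lambda>n. \<Sum>i\<le>n + 1. pol_bracket (f i) (g (n + 1 - i)))"

fun nested_bracket :: "('g, 'k) formal list \<Rightarrow> ('g, 'k) formal" where
  "nested_bracket [] = (\<lambda>n. 0)"
| "nested_bracket [f] = f"
| "nested_bracket (f # g # fs) = bracket f (nested_bracket (g # fs))"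

text \<open>For \<open>f, g \<in> max_ideal_sq k\<close> the \<open>N\<close>-fold nested brackets vanish in degrees \<open>\<le> N\<close>, because the
  bracket lowers the total degree by one.  So the truncation \<open>N \<le> n\<close> omits only zero terms of the
  Baker--Campbell--Hausdorff series.\<close>

definition star :: "('g, 'k) formal \<Rightarrow> ('g, 'k) formal \<Rightarrow> ('g, 'k) formal" (infixl "\<star>" 65) where
  "f \<star> g = (\<lambda>n. \<Sum>N = 1..n. \<Sum>ps\<in>dynkin_indices N.
     Const (dynkin_coeff N ps) * nested_bracket (dynkin_word f g ps) n)"

definition pentagon :: "('g, 'k) formal \<Rightarrow> bool" where
  "pentagon \<phi> \<longleftrightarrow>
     ins [{1}, {2}, {3, 4}] \<phi> \<star> ins [{1, 2}, {3}, {4}] \<phi> =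
     ins [{2}, {3}, {4}] \<phi> \<star> ins [{1}, {2, 3}, {4}] \<phi> \<star> ins [{1}, {2}, {3}] \<phi>"

definition lift_of_Z :: "('g, 'k) tensor \<Rightarrow> ('g, 'k) formal \<Rightarrow> bool" where
  "lift_of_Z Z \<phi> \<longleftrightarrow> \<phi> \<in> max_ideal_tensor 3 \<inter> invariants \<and>
     Alt3 (multilinear_part 3 \<phi>) = Z \<and> pentagon \<phi>"

definition cocycle_equation :: "('g, 'k) formal \<Rightarrow> ('g, 'k) formal \<Rightarrow> bool" where
  "cocycle_equation \<phi> \<rho> \<longleftrightarrow>
     ins [{1}, {2}] \<rho> \<star> ins [{1, 2}, {3}] \<rho> = ins [{2}, {3}] \<rho> \<star> ins [{1}, {2, 3}] \<rho> \<star> \<phi>"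

definition lift_of_r :: "('g, 'k) tensor \<Rightarrow> ('g, 'k) formal \<Rightarrow> ('g, 'k) formal \<Rightarrow> bool" where
  "lift_of_r r \<phi> \<rho> \<longleftrightarrow> \<rho> \<in> max_ideal_tensor 2 \<and>
     multilinear_part 2 \<rho> = r \<and> cocycle_equation \<phi> \<rho>"

definition gauge :: "('g, 'k) formal \<Rightarrow> ('g, 'k) formal \<Rightarrow> ('g, 'k) formal" where
  "gauge l \<rho> = ins [{1}] l \<star> ins [{2}] l \<star> \<rho> \<star> ins [{1, 2}] (neg l)"

end


section \<open>Lie bialgebras\<close>

locale lie_bialgebra = lie_algebra_basis scale br B
  for scale :: "'k::field_char_0 \<Rightarrow> 'g::ab_group_add \<Rightarrow> 'g" and br B +
  fixes \<delta> :: "'g \<Rightarrow> ('g, 'k) tensor"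
  assumes cobracket_linear: "Vector_Spaces.linear scale tscale \<delta>"
    and cobracket_wedge: "\<delta> x \<in> wedge 2"
    and cobracket_jacobi: "apply_left \<delta> (\<delta> x)
          + tpermute (\<lambda>i. (i + 1) mod 3) (apply_left \<delta> (\<delta> x))
          + tpermute (\<lambda>i. (i + 2) mod 3) (apply_left \<delta> (\<delta> x)) = 0"
    and cobracket_cocycle: "\<delta> (br x y) = tensor_ad x (\<delta> y) - tensor_ad y (\<delta> x)"

locale coboundary_lie_bialgebra = lie_bialgebra scale br B \<delta>
  for scale :: "'k::field_char_0 \<Rightarrow> 'g::ab_group_add \<Rightarrow> 'g" and br B \<delta> +
  fixes r Z :: "('g, 'k) tensor"
  assumes r_wedge: "r \<in> wedge 2"
    and coboundary: "\<delta> x = tensor_ad x r"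
    and Z_CYB: "Z = CYB r"
    and Z_wedge: "Z \<in> wedge 3"
    and Z_invariant: "tensor_ad x Z = 0"

end

theory Submission
  imports Defs "HOL-Computational_Algebra.Formal_Power_Series" "HOL-Library.Function_Algebras"
    "HOL-Library.Product_Plus"
begin

text \<open>
  A lift is built degree by degree.  Suppose that \<open>\<rho>\<close> solves the cocycle equation below degree \<open>n\<close>, and let \<open>\<psi>\<close>
  be the error in degree \<open>n\<close>.  Components of top degree enter star products additively (\<open>star_top\<close>), so that
  adding \<open>\<sigma>\<close> in degree \<open>n\<close> changes the error by the co-Hochschild differential of \<open>\<sigma>\<close>.  The pentagon equation
  makes \<open>\<psi>\<close> a cocycle (\<open>obstruction_cocycle\<close>).  The cohomology of polynomial cochains on a vector space is the
  exterior algebra, where three-cochains have polynomial degree three; hence \<open>\<psi>\<close> is a coboundary for \<open>n > 3\<close>,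
  and for \<open>n = 3\<close> if its antisymmetric part vanishes (\<open>cohomology_3\<close>).  The antisymmetric part of the error
  compares the antisymmetric part of \<open>\<phi>\<close> with a multiple of \<open>CYB r\<close>, and the assumption that \<open>\<phi>\<close> is a lift
  says that they agree (\<open>obstruction_degree_3\<close>).

  Uniqueness uses two-cochains in the same way.  Gauge transformations preserve the cocycle equation, because
  \<open>\<phi>\<close> is invariant (\<open>gauge_cocycle\<close>).  In the lowest degree where two lifts of \<open>r\<close> differ, which is at least three,
  the difference is a cocycle, hence a coboundary (\<open>cohomology_2\<close>), and a gauge transformation removes it.

  Both cohomology theorems reduce to the Poincare lemma: a cochain that vanishes together with its last
  argument is determined by its derivatives in that argument, and the cocycle equation expresses these by their
  values at zero.

  These arguments take place in the group of formal functions of order at least two, so that Dynkin's series has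
  to be shown to be a group law.  The idea is to represent \<open>f\<close> by \<open>exp (ad f)\<close>.  In order to make this faithful, the
  Euler derivation \<open>E\<close> is added to the Lie algebra: the operator \<open>exp (ad f)\<close> maps \<open>E\<close> to \<open>E\<close> minus the logarithmic
  derivative of \<open>exp f\<close>, which determines \<open>f\<close> (\<open>ext_Exp_inj\<close>).  Associativity then follows from
  \<open>exp (ad (f \<star> g)) = exp (ad f) exp (ad g)\<close> (\<open>ext_Exp_bch\<close>).  With a formal parameter \<open>s\<close>, there is a series \<open>z\<close> in \<open>s\<close>
  with \<open>exp (ad z) = exp (s ad x) exp (s ad y)\<close>, since a differential equation in \<open>s\<close> prescribes its logarithmic
  derivative; expanding the logarithm of the right-hand side shows that \<open>z\<close> is Dynkin's series (\<open>Exp_dyn\<close>).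
\<close>

abbreviation lookup :: "('a \<Rightarrow>\<^sub>0 'b::zero) \<Rightarrow> 'a \<Rightarrow> 'b" where "lookup \<equiv> Poly_Mapping.lookup"
abbreviation keys :: "('a \<Rightarrow>\<^sub>0 'b::zero) \<Rightarrow> 'a set" where "keys \<equiv> Poly_Mapping.keys"
abbreviation single :: "'a \<Rightarrow> 'b::zero \<Rightarrow> 'a \<Rightarrow>\<^sub>0 'b" where "single \<equiv> Poly_Mapping.single"

section \<open>Power series in an operator on sequences\<close>

lemma sum_fun_apply: "(\<Sum>i\<in>A. F i) x = (\<Sum>i\<in>A. F i x)"
  for F :: "'i \<Rightarrow> 'a \<Rightarrow> 'b::comm_monoid_add"
  by (induction A rule: infinite_finite_induct) auto

lemma sum_additive:
  fixes h :: "'a::comm_monoid_add \<Rightarrow> 'b::comm_monoid_add"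
  assumes "\<And>x y. h (x + y) = h x + h y" and "h 0 = 0"
  shows "h (\<Sum>i\<in>A. F i) = (\<Sum>i\<in>A. h (F i))"
  by (induction A rule: infinite_finite_induct) (auto simp: assms)

lemma sum_triangle_bounded:
  fixes F :: "nat \<Rightarrow> nat \<Rightarrow> 'a::comm_monoid_add"
  assumes "\<And>i j. n < i + j \<Longrightarrow> F i j = 0"
  shows "(\<Sum>i\<le>n. \<Sum>j\<le>n. F i j) = (\<Sum>m\<le>n. \<Sum>i\<le>m. F i (m - i))"
proof -
  have "F i j = 0" if "i \<le> n" "\<not> j \<le> n - i" for i j using that by (intro assms) auto
  then have "(\<Sum>i\<le>n. \<Sum>j\<le>n. F i j) = (\<Sum>i\<le>n. \<Sum>j\<le>n - i. F i j)"
    by (intro sum.cong[OF refl] sum.mono_neutral_right) auto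
  also have "\<dots> = sum (\<lambda>(i, j). F i j) {(i, j). i + j \<le> n}"
    by (subst sum.Sigma) (auto intro!: sum.cong)
  also have "\<dots> = (\<Sum>m\<le>n. \<Sum>i\<le>m. F i (m - i))"
    by (simp add: sum.triangle_reindex_eq)
  finally show ?thesis .
qed

lemma sum_antidiagonal_assoc:
  fixes F :: "nat \<Rightarrow> nat \<Rightarrow> nat \<Rightarrow> 'a::comm_monoid_add"
  shows "(\<Sum>i\<le>n. \<Sum>j\<le>n - i. F i j (n - i - j)) = (\<Sum>m\<le>n. \<Sum>i\<le>m. F i (m - i) (n - m))"
proof -
  have "(\<Sum>i\<le>n. \<Sum>j\<le>n - i. F i j (n - i - j)) = sum (\<lambda>(i, j). F i j (n - i - j)) {(i, j). i + j \<le> n}"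
    by (subst sum.Sigma) (auto intro!: sum.cong)
  also have "\<dots> = (\<Sum>m\<le>n. \<Sum>i\<le>m. F i (m - i) (n - i - (m - i)))"
    by (rule sum.triangle_reindex_eq)
  also have "\<dots> = (\<Sum>m\<le>n. \<Sum>i\<le>m. F i (m - i) (n - m))"
    by (intro sum.cong) auto
  finally show ?thesis .
qed

locale sequence_space = vector_space scale
  for scale :: "'a::field_char_0 \<Rightarrow> 'b::ab_group_add \<Rightarrow> 'b"
begin

definition sscale :: "'a \<Rightarrow> (nat \<Rightarrow> 'b) \<Rightarrow> nat \<Rightarrow> 'b" where
  "sscale c f = (\<lambda>n. scale c (f n))"

lemma sscale_apply [simp]: "sscale c f n = scale c (f n)"
  by (simp add: sscale_def)

text \<open>Such an operator is topologically nilpotent: a component of a power series in it is a finite sum, so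
  that power series can be evaluated at it without limits.\<close>

definition raising :: "((nat \<Rightarrow> 'b) \<Rightarrow> nat \<Rightarrow> 'b) \<Rightarrow> bool" where
  "raising T \<longleftrightarrow> (\<forall>f g. T (f + g) = T f + T g) \<and> (\<forall>c f. T (sscale c f) = sscale c (T f)) \<and>
     (\<forall>f n. (\<forall>i<n. f i = 0) \<longrightarrow> (\<forall>i\<le>n. T f i = 0))"

definition pser :: "'a fps \<Rightarrow> ((nat \<Rightarrow> 'b) \<Rightarrow> nat \<Rightarrow> 'b) \<Rightarrow> (nat \<Rightarrow> 'b) \<Rightarrow> nat \<Rightarrow> 'b" where
  "pser c T f = (\<lambda>n. \<Sum>k\<le>n. scale (fps_nth c k) ((T ^^ k) f n))"

lemma pow_add: "raising T \<Longrightarrow> (T ^^ k) (f + g) = (T ^^ k) f + (T ^^ k) g"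
  by (induction k) (auto simp: raising_def)

lemma pow_scale: "raising T \<Longrightarrow> (T ^^ k) (sscale c f) = sscale c ((T ^^ k) f)"
  by (induction k) (auto simp: raising_def)

lemma pow_zero: "raising T \<Longrightarrow> (T ^^ k) 0 = 0"
  using pow_add[of T k 0 0] by simp

lemma pow_diff: "raising T \<Longrightarrow> (T ^^ k) (f - g) = (T ^^ k) f - (T ^^ k) g"
  using pow_add[of T k "f - g" g] by (simp add: algebra_simps)

lemma pow_sum: "raising T \<Longrightarrow> (T ^^ k) (\<Sum>i\<in>A. F i) = (\<Sum>i\<in>A. (T ^^ k) (F i))"
  by (rule sum_additive[where h = "T ^^ k"]) (auto simp: pow_add pow_zero)

lemma pow_order: "raising T \<Longrightarrow> \<forall>i<n. f i = 0 \<Longrightarrow> i < n + k \<Longrightarrow> (T ^^ k) f i = 0"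
proof (induction k arbitrary: i)
  case (Suc k)
  then have "\<forall>i<n + k. (T ^^ k) f i = 0" by auto
  then have "\<forall>i\<le>n + k. T ((T ^^ k) f) i = 0" using Suc.prems unfolding raising_def by blast
  then show ?case using Suc.prems by simp
qed simp

lemma pow_vanish: "raising T \<Longrightarrow> n < k \<Longrightarrow> (T ^^ k) f n = 0"
  using pow_order[of T 0 f n k] by simp

lemma pow_agree: "raising T \<Longrightarrow> \<forall>i<n. f i = g i \<Longrightarrow> i < n + k \<Longrightarrow> (T ^^ k) f i = (T ^^ k) g i"
  using pow_order[of T n "f - g" i k] by (simp add: pow_diff)

lemma pser_trunc:
  "raising T \<Longrightarrow> n \<le> K \<Longrightarrow> pser c T f n = (\<Sum>k\<le>K. scale (fps_nth c k) ((T ^^ k) f n))"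
  unfolding pser_def by (rule sum.mono_neutral_left) (auto simp: pow_vanish)

lemma pser_eq_sum:
  assumes "raising T" "n \<le> K"
  shows "pser c T f n = (\<Sum>k\<le>K. sscale (fps_nth c k) ((T ^^ k) f)) n"
  using assms by (simp add: pser_trunc sum_fun_apply)

lemma pser_mult:
  assumes T: "raising T"
  shows "pser (c * d) T f = pser c T (pser d T f)"
proof
  fix n
  have "pser c T (pser d T f) n = (\<Sum>k\<le>n. scale (fps_nth c k) ((T ^^ k) (pser d T f) n))"
    by (simp add: pser_def)
  also have "\<dots> = (\<Sum>k\<le>n. scale (fps_nth c k) ((T ^^ k) (\<Sum>j\<le>n. sscale (fps_nth d j) ((T ^^ j) f)) n))"
  proof (intro sum.cong refl arg_cong2[where f = scale])
    fix k
    show "(T ^^ k) (pser d T f) n = (T ^^ k) (\<Sum>j\<le>n. sscale (fps_nth d j) ((T ^^ j) f)) n"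
      by (rule pow_agree[OF T, of "Suc n"]) (auto simp: pser_eq_sum[OF T, of _ n])
  qed
  also have "\<dots> = (\<Sum>k\<le>n. \<Sum>j\<le>n. scale (fps_nth c k * fps_nth d j) ((T ^^ (k + j)) f n))"
    by (simp add: pow_sum[OF T] sum_fun_apply pow_scale[OF T] scale_sum_right funpow_add)
  also have "\<dots> = (\<Sum>m\<le>n. \<Sum>k\<le>m. scale (fps_nth c k * fps_nth d (m - k)) ((T ^^ (k + (m - k))) f n))"
    by (rule sum_triangle_bounded) (auto simp: pow_vanish[OF T])
  also have "\<dots> = (\<Sum>m\<le>n. scale (fps_nth (c * d) m) ((T ^^ m) f n))"
    by (auto simp: fps_mult_nth scale_sum_left atLeast0AtMost intro!: sum.cong)
  finally show "pser (c * d) T f n = pser c T (pser d T f) n" by (simp add: pser_def)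
qed

lemma pser_diff_fps: "pser (c - d) T f = pser c T f - pser d T f"
  by (auto simp: pser_def fun_eq_iff scale_left_diff_distrib sum_subtractf)

lemma pser_one [simp]: "pser 1 T f = f"
proof
  fix n
  have "pser 1 T f n = (\<Sum>k\<in>{0}. scale (fps_nth 1 k) ((T ^^ k) f n))"
    unfolding pser_def by (rule sum.mono_neutral_right) auto
  then show "pser 1 T f n = f n" by simp
qed

lemma pser_add: "raising T \<Longrightarrow> pser c T (f + g) = pser c T f + pser c T g"
  by (auto simp: pser_def fun_eq_iff pow_add scale_right_distrib sum.distrib)

lemma pser_scale: "raising T \<Longrightarrow> pser c T (sscale a f) = sscale a (pser c T f)"
  by (auto simp: pser_def fun_eq_iff pow_scale scale_sum_right mult.commute)

lemma pser_order:
  assumes "raising T" "\<forall>i<n. f i = 0" "i < n" shows "pser c T f i = 0"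
  unfolding pser_def using pow_order[OF assms(1,2)] assms(3) by auto

lemma pser_lowest:
  assumes T: "raising T" and f: "\<forall>i<n. f i = 0" shows "pser c T f n = scale (fps_nth c 0) (f n)"
proof -
  have "pser c T f n = (\<Sum>k\<in>{0}. scale (fps_nth c k) ((T ^^ k) f n))"
    unfolding pser_def by (rule sum.mono_neutral_right) (use pow_order[OF T f] in auto)
  then show ?thesis by simp
qed

lemma pser_diff: "raising T \<Longrightarrow> pser c T (f - g) = pser c T f - pser c T g"
  using pser_add[of T c "f - g" g] by (simp add: algebra_simps)

lemma pser_agree: "raising T \<Longrightarrow> \<forall>i<n. f i = g i \<Longrightarrow> i < n \<Longrightarrow> pser c T f i = pser c T g i"
  using pser_order[of T n "f - g" i c] by (simp add: pser_diff)

lemma pser_pow: "raising T \<Longrightarrow> (pser d T ^^ k) f = pser (d ^ k) T f"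
  by (induction k) (auto simp: pser_mult)

lemma pser_compose:
  assumes T: "raising T" and d: "fps_nth d 0 = 0"
  shows "pser (c oo d) T f = pser c (pser d T) f"
proof
  fix n
  have "pser c (pser d T) f n = (\<Sum>i\<le>n. \<Sum>m\<le>n. scale (fps_nth c i * fps_nth (d ^ i) m) ((T ^^ m) f n))"
    by (simp add: pser_def[of c] pser_pow[OF T] pser_def[of "d ^ _"] scale_sum_right)
  also have "\<dots> = (\<Sum>m\<le>n. \<Sum>i\<le>n. scale (fps_nth c i * fps_nth (d ^ i) m) ((T ^^ m) f n))"
    by (rule sum.swap)
  also have "\<dots> = (\<Sum>m\<le>n. \<Sum>i\<le>m. scale (fps_nth c i * fps_nth (d ^ i) m) ((T ^^ m) f n))"
  proof (rule sum.cong[OF refl], rule sum.mono_neutral_right)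
    fix m assume "m \<in> {..n}"
    show "\<forall>i\<in>{..n} - {..m}. scale (fps_nth c i * fps_nth (d ^ i) m) ((T ^^ m) f n) = 0"
      using d by (auto simp: startsby_zero_power_prefix)
  qed auto
  also have "\<dots> = pser (c oo d) T f n"
    by (auto simp: pser_def fps_compose_nth scale_sum_left atLeast0AtMost intro!: sum.cong)
  finally show "pser (c oo d) T f n = pser c (pser d T) f n" ..
qed

end

section \<open>Exponentials of adjoint operators on formal power series in a Lie algebra\<close>

text \<open>Besides \<open>\<gg>\<close> itself, the instances below are the polynomials with the Poisson bracket, the power series
  over such a Lie algebra, and the extension of the latter by the Euler derivation.\<close>

locale lie_alg = sequence_space scale
  for scale :: "'k::field_char_0 \<Rightarrow> 'l::ab_group_add \<Rightarrow> 'l" +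
  fixes br :: "'l \<Rightarrow> 'l \<Rightarrow> 'l"
  assumes br_add_left: "br (x + y) z = br x z + br y z"
    and br_add_right: "br x (y + z) = br x y + br x z"
    and br_scale_left: "br (scale c x) y = scale c (br x y)"
    and br_scale_right: "br x (scale c y) = scale c (br x y)"
    and br_self: "br x x = 0"
    and jacobi: "br x (br y z) + br y (br z x) + br z (br x y) = 0"
begin

lemma br_zero_left [simp]: "br 0 y = 0" using br_add_left[of 0 0 y] by simp
lemma br_zero_right [simp]: "br x 0 = 0" using br_add_right[of x 0 0] by simp

lemma br_sum_left: "br (\<Sum>i\<in>A. F i) y = (\<Sum>i\<in>A. br (F i) y)"
  by (rule sum_additive[where h = "\<lambda>x. br x y"]) (auto simp: br_add_left)

lemma br_sum_right: "br x (\<Sum>i\<in>A. F i) = (\<Sum>i\<in>A. br x (F i))"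
  by (rule sum_additive[where h = "br x"]) (auto simp: br_add_right)

lemma br_antisym: "br x y = - br y x"
proof -
  have "0 = br (x + y) (x + y)" by (simp add: br_self)
  also have "\<dots> = br x y + br y x"
    unfolding br_add_left br_add_right by (simp add: br_self)
  finally show ?thesis by (simp add: eq_neg_iff_add_eq_0)
qed

lemma br_minus_right: "br x (- y) = - br x y"
  using br_add_right[of x y "- y"] by (simp add: eq_neg_iff_add_eq_0 add.commute)

lemma br_derivation: "br x (br y z) = br (br x y) z + br y (br x z)"
  using jacobi[of x y z] br_antisym[of z "br x y"] br_antisym[of z x] br_minus_right[of y "br x z"]
  by (simp add: algebra_simps)

text \<open>A sequence stands for a formal power series with coefficients in the Lie algebra; this is their bracket.\<close>

definition sbr :: "(nat \<Rightarrow> 'l) \<Rightarrow> (nat \<Rightarrow> 'l) \<Rightarrow> nat \<Rightarrow> 'l" where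
  "sbr f g = (\<lambda>n. \<Sum>i\<le>n. br (f i) (g (n - i)))"

lemma sbr_add_left: "sbr (f + g) h = sbr f h + sbr g h"
  by (auto simp: sbr_def fun_eq_iff br_add_left sum.distrib)

lemma sbr_add_right: "sbr f (g + h) = sbr f g + sbr f h"
  by (auto simp: sbr_def fun_eq_iff br_add_right sum.distrib)

lemma sbr_scale_left: "sbr (sscale c f) g = sscale c (sbr f g)"
  by (auto simp: sbr_def fun_eq_iff br_scale_left scale_sum_right)

lemma sbr_scale_right: "sbr f (sscale c g) = sscale c (sbr f g)"
  by (auto simp: sbr_def fun_eq_iff br_scale_right scale_sum_right)

lemma sbr_antisym: "sbr f g = - sbr g f"
proof
  fix n
  have "sbr f g n = (\<Sum>i\<le>n. br (f (n - i)) (g (n - (n - i))))"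
    unfolding sbr_def by (rule sum.nat_diff_reindex[symmetric, of _ "Suc n", simplified lessThan_Suc_atMost, simplified])
  also have "\<dots> = (\<Sum>i\<le>n. - br (g i) (f (n - i)))"
    by (intro sum.cong) (auto simp: br_antisym[of "f _"])
  finally show "sbr f g n = (- sbr g f) n" by (simp add: sbr_def sum_negf)
qed

lemma sbr_self: "sbr f f = 0"
proof
  fix n
  have "scale 2 (sbr f f n) = sbr f f n + sbr f f n"
    using scale_left_distrib[of 1 1 "sbr f f n"] by simp
  also have "\<dots> = 0" using fun_cong[OF sbr_antisym[of f f], of n] by (simp add: eq_neg_iff_add_eq_0)
  finally show "sbr f f n = 0 n" by simp
qed

lemma sbr_zero_left [simp]: "sbr 0 f = 0" by (auto simp: sbr_def)
lemma sbr_zero_right [simp]: "sbr f 0 = 0" by (auto simp: sbr_def)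

lemma sbr_sum_left: "sbr (\<Sum>i\<in>A. F i) h = (\<Sum>i\<in>A. sbr (F i) h)"
  by (rule sum_additive[where h = "\<lambda>x. sbr x h"]) (auto simp: sbr_add_left)

lemma sbr_sum_right: "sbr h (\<Sum>i\<in>A. F i) = (\<Sum>i\<in>A. sbr h (F i))"
  by (rule sum_additive[where h = "sbr h"]) (auto simp: sbr_add_right)

lemma sbr_sbr:
  "sbr f (sbr g h) n = (\<Sum>i\<le>n. \<Sum>j\<le>n - i. br (f i) (br (g j) (h (n - i - j))))"
  by (simp add: sbr_def br_sum_right)

lemma sbr_derivation: "sbr f (sbr g h) = sbr (sbr f g) h + sbr g (sbr f h)"
proof
  fix n
  have "sbr f (sbr g h) n = (\<Sum>i\<le>n. \<Sum>j\<le>n - i. br (br (f i) (g j)) (h (n - i - j)))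
      + (\<Sum>i\<le>n. \<Sum>j\<le>n - i. br (g j) (br (f i) (h (n - i - j))))"
    unfolding sbr_sbr by (subst br_derivation) (simp add: sum.distrib)
  also have "(\<Sum>i\<le>n. \<Sum>j\<le>n - i. br (br (f i) (g j)) (h (n - i - j))) = sbr (sbr f g) h n"
    by (subst sum_antidiagonal_assoc) (simp add: sbr_def br_sum_left)
  also have "(\<Sum>i\<le>n. \<Sum>j\<le>n - i. br (g j) (br (f i) (h (n - i - j))))
      = (\<Sum>m\<le>n. \<Sum>i\<le>m. br (g (m - i)) (br (f i) (h (n - m))))"
    by (rule sum_antidiagonal_assoc)
  also have "\<dots> = (\<Sum>m\<le>n. \<Sum>j\<le>m. br (g j) (br (f (m - j)) (h (n - m))))"
  proof (rule sum.cong[OF refl])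
    fix m
    show "(\<Sum>i\<le>m. br (g (m - i)) (br (f i) (h (n - m)))) = (\<Sum>j\<le>m. br (g j) (br (f (m - j)) (h (n - m))))"
      by (rule sum.reindex_bij_witness[of _ "\<lambda>i. m - i" "\<lambda>i. m - i"]) auto
  qed
  also have "\<dots> = (\<Sum>j\<le>n. \<Sum>i\<le>n - j. br (g j) (br (f i) (h (n - j - i))))"
    by (rule sum_antidiagonal_assoc[symmetric])
  also have "\<dots> = sbr g (sbr f h) n"
    by (simp add: sbr_sbr)
  finally show "sbr f (sbr g h) n = (sbr (sbr f g) h + sbr g (sbr f h)) n" by simp
qed

lemma sbr_order:
  assumes "u 0 = 0" "\<forall>i<n. f i = 0" "i \<le> n" shows "sbr u f i = 0"
proof -
  have "br (u j) (f (i - j)) = 0" if "j \<le> i" for j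
    using assms that by (cases "j = 0") auto
  then show ?thesis by (simp add: sbr_def)
qed

lemma raising_sbr: "u 0 = 0 \<Longrightarrow> raising (sbr u)"
  unfolding raising_def using sbr_order by (auto simp: sbr_add_right sbr_scale_right)

definition Exp :: "(nat \<Rightarrow> 'l) \<Rightarrow> (nat \<Rightarrow> 'l) \<Rightarrow> nat \<Rightarrow> 'l" where
  "Exp u = pser (fps_exp 1) (sbr u)"

lemma Exp_apply: "Exp u f n = (\<Sum>k\<le>n. scale (1 / fact k) ((sbr u ^^ k) f n))"
  by (simp add: Exp_def pser_def)

lemma divided_Leibniz:
  "sscale (1 / fact k) ((sbr u ^^ k) (sbr f g))
    = (\<Sum>i\<le>k. sbr (sscale (1 / fact i) ((sbr u ^^ i) f)) (sscale (1 / fact (k - i)) ((sbr u ^^ (k - i)) g)))"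
proof -
  have "(sbr u ^^ k) (sbr f g) = (\<Sum>i\<le>k. sscale (of_nat (k choose i)) (sbr ((sbr u ^^ i) f) ((sbr u ^^ (k - i)) g)))"
    (is "_ = ?S k")
  proof (induction k)
    case (Suc k)
    let ?t = "\<lambda>i j. sbr ((sbr u ^^ i) f) ((sbr u ^^ j) g)"
    have step: "sbr u (?t i j) = ?t (Suc i) j + ?t i (Suc j)" for i j
      by (simp add: sbr_derivation[of u])
    have "(sbr u ^^ Suc k) (sbr f g) = sbr u (?S k)" using Suc by simp
    also have "\<dots> = (\<Sum>i\<le>k. sscale (of_nat (k choose i)) (?t (Suc i) (k - i)))
        + (\<Sum>i\<le>k. sscale (of_nat (k choose i)) (?t i (Suc (k - i))))"
      by (subst sbr_sum_right)
        (auto simp: sbr_add_right sbr_scale_right step fun_eq_iff scale_right_distrib sum.distrib sum_fun_apply)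
    also have "(\<Sum>i\<le>k. sscale (of_nat (k choose i)) (?t i (Suc (k - i))))
        = (\<Sum>i\<le>Suc k. sscale (of_nat (k choose i)) (?t i (Suc k - i)))"
      by (simp add: Suc_diff_le fun_eq_iff sum_fun_apply)
    also have "\<dots> = sscale (of_nat (k choose 0)) (?t 0 (Suc k)) + (\<Sum>i\<le>k. sscale (of_nat (k choose Suc i)) (?t (Suc i) (k - i)))"
      by (subst sum.atMost_Suc_shift) simp
    also have "(\<Sum>i\<le>k. sscale (of_nat (k choose i)) (?t (Suc i) (k - i))) + \<dots>
        = sscale (of_nat (Suc k choose 0)) (?t 0 (Suc k)) + (\<Sum>i\<le>k. sscale (of_nat (Suc k choose Suc i)) (?t (Suc i) (k - i)))"
      by (auto simp: fun_eq_iff sum_fun_apply sum.distrib scale_left_distrib algebra_simps)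
    also have "\<dots> = ?S (Suc k)"
      by (subst sum.atMost_Suc_shift) simp
    finally show ?case .
  qed (auto simp: fun_eq_iff)
  then have "sscale (1 / fact k) ((sbr u ^^ k) (sbr f g))
      = (\<Sum>i\<le>k. sscale (1 / fact k * of_nat (k choose i)) (sbr ((sbr u ^^ i) f) ((sbr u ^^ (k - i)) g)))"
    by (auto simp: fun_eq_iff sum_fun_apply scale_sum_right)
  also have "\<dots> = (\<Sum>i\<le>k. sbr (sscale (1 / fact i) ((sbr u ^^ i) f)) (sscale (1 / fact (k - i)) ((sbr u ^^ (k - i)) g)))"
  proof (rule sum.cong[OF refl])
    fix i assume "i \<in> {..k}"
    then have c: "1 / fact k * of_nat (k choose i) = (1 / fact (k - i) * (1 / fact i) :: 'k)"
      by (simp add: binomial_fact)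
    show "sscale (1 / fact k * of_nat (k choose i)) (sbr ((sbr u ^^ i) f) ((sbr u ^^ (k - i)) g))
      = sbr (sscale (1 / fact i) ((sbr u ^^ i) f)) (sscale (1 / fact (k - i)) ((sbr u ^^ (k - i)) g))"
      unfolding c by (auto simp: sbr_scale_left sbr_scale_right fun_eq_iff)
  qed
  finally show ?thesis .
qed

lemma sbr_agree:
  "\<forall>i\<le>n. f i = f' i \<Longrightarrow> \<forall>i\<le>n. g i = g' i \<Longrightarrow> sbr f g n = sbr f' g' n"
  by (simp add: sbr_def)

text \<open>Summing the divided Leibniz rule over \<open>k\<close> multiplies out the two exponentials, as in the proof
  that the exponential series turns sums into products.\<close>

lemma Exp_sbr:
  assumes u: "u 0 = 0"
  shows "Exp u (sbr f g) = sbr (Exp u f) (Exp u g)"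
proof
  fix n
  note R = raising_sbr[of u, OF u]
  define a where "a i = sscale (1 / fact i) ((sbr u ^^ i) f)" for i
  define b where "b i = sscale (1 / fact i) ((sbr u ^^ i) g)" for i
  have a0: "a i m = 0" if "m < i" for i m using that by (simp add: a_def pow_vanish[OF R])
  have b0: "b i m = 0" if "m < i" for i m using that by (simp add: b_def pow_vanish[OF R])
  have ab0: "sbr (a i) (b j) n = 0" if "n < i + j" for i j
    unfolding sbr_def
  proof (rule sum.neutral, rule ballI)
    fix m assume "m \<in> {..n}"
    then show "br (a i m) (b j (n - m)) = 0" using that a0[of m i] b0[of "n - m" j]
      by (cases "m < i") auto
  qed
  have "sbr (Exp u f) (Exp u g) n = sbr (\<Sum>i\<le>n. a i) (\<Sum>j\<le>n. b j) n"
    by (rule sbr_agree) (auto simp: Exp_def a_def b_def pser_eq_sum[OF R, of _ n])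
  also have "\<dots> = (\<Sum>i\<le>n. \<Sum>j\<le>n. sbr (a i) (b j) n)"
    by (simp only: sbr_sum_left) (simp only: sbr_sum_right sum_fun_apply)
  also have "\<dots> = (\<Sum>m\<le>n. \<Sum>i\<le>m. sbr (a i) (b (m - i)) n)"
    by (rule sum_triangle_bounded) (rule ab0)
  also have "\<dots> = (\<Sum>m\<le>n. sscale (1 / fact m) ((sbr u ^^ m) (sbr f g)) n)"
    unfolding divided_Leibniz a_def b_def by (simp add: sum_fun_apply)
  also have "\<dots> = Exp u (sbr f g) n" by (simp add: Exp_apply)
  finally show "Exp u (sbr f g) n = sbr (Exp u f) (Exp u g) n" ..
qed

definition euler :: "(nat \<Rightarrow> 'l) \<Rightarrow> nat \<Rightarrow> 'l" where
  "euler f = (\<lambda>n. scale (of_nat n) (f n))"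

definition exp_quotient :: "'k fps" where
  "exp_quotient = Abs_fps (\<lambda>n. 1 / fact (Suc n))"

text \<open>\<open>logder u\<close> is the right logarithmic derivative \<open>euler (exp u) exp (- u)\<close>, expressed without an
  enveloping algebra as \<open>(exp t - 1) / t\<close> at \<open>t = ad u\<close>, applied to \<open>euler u\<close>.\<close>

definition logder :: "(nat \<Rightarrow> 'l) \<Rightarrow> nat \<Rightarrow> 'l" where
  "logder u = pser exp_quotient (sbr u) (euler u)"

lemma euler_0 [simp]: "euler f 0 = 0" by (simp add: euler_def)

lemma euler_add: "euler (f + g) = euler f + euler g"
  by (auto simp: euler_def fun_eq_iff scale_right_distrib)

lemma euler_sscale: "euler (sscale c f) = sscale c (euler f)"
  by (auto simp: euler_def fun_eq_iff mult.commute)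

lemma euler_sbr: "euler (sbr f g) = sbr (euler f) g + sbr f (euler g)"
proof
  fix n
  have "euler (sbr f g) n = (\<Sum>i\<le>n. scale (of_nat i + of_nat (n - i)) (br (f i) (g (n - i))))"
    unfolding euler_def sbr_def scale_sum_right
    by (intro sum.cong refl arg_cong2[where f = scale]) (simp flip: of_nat_add)
  also have "\<dots> = (sbr (euler f) g + sbr f (euler g)) n"
    unfolding euler_def sbr_def scale_left_distrib sum.distrib br_scale_left br_scale_right by simp
  finally show "euler (sbr f g) n = (sbr (euler f) g + sbr f (euler g)) n" .
qed

text \<open>Moving the derivation past a power of \<open>ad u\<close> creates \<open>ad (euler u)\<close> in each of the \<open>n\<close> places;
  moving this commutator to the left by the Leibniz rule gives the binomial coefficients, by Pascal's rule.\<close>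

lemma divided_euler_pow:
  "sscale (1 / fact n) (euler ((sbr u ^^ n) f)) = sscale (1 / fact n) ((sbr u ^^ n) (euler f))
    + (\<Sum>j<n. sbr (sscale (1 / fact (Suc j)) ((sbr u ^^ j) (euler u)))
         (sscale (1 / fact (n - 1 - j)) ((sbr u ^^ (n - 1 - j)) f)))"
proof -
  let ?t = "\<lambda>i j. sbr ((sbr u ^^ i) (euler u)) ((sbr u ^^ j) f)"
  have "euler ((sbr u ^^ n) f) = (sbr u ^^ n) (euler f)
      + (\<Sum>j<n. sscale (of_nat (n choose Suc j)) (?t j (n - 1 - j)))"
  proof (induction n)
    case (Suc n)
    let ?S = "\<Sum>j<n. sscale (of_nat (n choose Suc j)) (?t j (n - 1 - j))"
    have shift: "a = p - t + q \<Longrightarrow> a + t = p + q" for a p t q :: "nat \<Rightarrow> 'l" by simp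
    have step: "sbr u (?t i j) = ?t (Suc i) j + ?t i (Suc j)" for i j
      by (simp add: sbr_derivation[of u])
    have "sbr u ?S = (\<Sum>j<n. sscale (of_nat (n choose Suc j)) (?t (Suc j) (n - 1 - j)))
        + (\<Sum>j<n. sscale (of_nat (n choose Suc j)) (?t j (Suc (n - 1 - j))))"
      by (subst sbr_sum_right)
        (auto simp: sbr_add_right sbr_scale_right step fun_eq_iff scale_right_distrib sum.distrib sum_fun_apply)
    also have "(\<Sum>j<n. sscale (of_nat (n choose Suc j)) (?t j (Suc (n - 1 - j))))
        = (\<Sum>j<Suc n. sscale (of_nat (n choose Suc j)) (?t j (n - j)))"
      by (auto simp: fun_eq_iff sum_fun_apply Suc_diff_Suc intro!: sum.cong)
    also have "(\<Sum>j<n. sscale (of_nat (n choose Suc j)) (?t (Suc j) (n - 1 - j)))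
        = (\<Sum>j<Suc n. sscale (of_nat (n choose j)) (?t j (n - j))) - ?t 0 n"
      by (subst sum.lessThan_Suc_shift) (auto simp: fun_eq_iff sum_fun_apply)
    finally have "sbr u ?S + ?t 0 n = (\<Sum>j<Suc n. sscale (of_nat (n choose j)) (?t j (n - j)))
        + (\<Sum>j<Suc n. sscale (of_nat (n choose Suc j)) (?t j (n - j)))"
      by (rule shift)
    also have "\<dots> = (\<Sum>j<Suc n. sscale (of_nat (Suc n choose Suc j)) (?t j (n - j)))"
      by (auto simp: fun_eq_iff sum_fun_apply scale_left_distrib simp flip: sum.distrib simp del: sum.lessThan_Suc)
    finally have S: "sbr u ?S + ?t 0 n = (\<Sum>j<Suc n. sscale (of_nat (Suc n choose Suc j)) (?t j (n - j)))" .
    have "euler ((sbr u ^^ Suc n) f) = ?t 0 n + sbr u (euler ((sbr u ^^ n) f))"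
      by (simp add: euler_sbr)
    also have "\<dots> = (sbr u ^^ Suc n) (euler f) + (sbr u ?S + ?t 0 n)"
      by (simp only: Suc sbr_add_right funpow.simps o_apply add_ac)
    finally show ?case by (simp only: S diff_Suc_1)
  qed simp
  then have "sscale (1 / fact n) (euler ((sbr u ^^ n) f)) = sscale (1 / fact n) ((sbr u ^^ n) (euler f))
      + (\<Sum>j<n. sscale (1 / fact n * of_nat (n choose Suc j)) (?t j (n - 1 - j)))"
    by (auto simp: fun_eq_iff sum_fun_apply scale_sum_right scale_right_distrib)
  also have "(\<Sum>j<n. sscale (1 / fact n * of_nat (n choose Suc j)) (?t j (n - 1 - j)))
      = (\<Sum>j<n. sbr (sscale (1 / fact (Suc j)) ((sbr u ^^ j) (euler u)))
         (sscale (1 / fact (n - 1 - j)) ((sbr u ^^ (n - 1 - j)) f)))"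
  proof (rule sum.cong[OF refl])
    fix j assume "j \<in> {..<n}"
    then have c: "1 / fact n * of_nat (n choose Suc j) = (1 / fact (n - 1 - j) * (1 / fact (Suc j)) :: 'k)"
      by (simp add: binomial_fact del: fact_Suc)
    show "sscale (1 / fact n * of_nat (n choose Suc j)) (?t j (n - 1 - j))
      = sbr (sscale (1 / fact (Suc j)) ((sbr u ^^ j) (euler u)))
         (sscale (1 / fact (n - 1 - j)) ((sbr u ^^ (n - 1 - j)) f))"
      unfolding c by (auto simp: sbr_scale_left sbr_scale_right fun_eq_iff simp del: fact_Suc)
  qed
  finally show ?thesis .
qed

text \<open>Duhamel's formula for the derivative of an exponential.\<close>

lemma euler_Exp:
  assumes u: "u 0 = 0"
  shows "euler (Exp u f) = Exp u (euler f) + sbr (logder u) (Exp u f)"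
proof
  fix n
  note R = raising_sbr[of u, OF u]
  define a where "a i = sscale (1 / fact (Suc i)) ((sbr u ^^ i) (euler u))" for i
  define b where "b i = sscale (1 / fact i) ((sbr u ^^ i) f)" for i
  have a0: "a i m = 0" if "m \<le> i" for i m
    unfolding a_def using that pow_order[OF R, of 1 "euler u" m i] by simp
  have b0: "b i m = 0" if "m < i" for i m using that by (simp add: b_def pow_vanish[OF R])
  have ab0: "sbr (a i) (b j) n = 0" if "n < Suc (i + j)" for i j
    unfolding sbr_def
  proof (rule sum.neutral, rule ballI)
    fix m assume "m \<in> {..n}"
    then show "br (a i m) (b j (n - m)) = 0" using that a0[of m i] b0[of "n - m" j]
      by (cases "m \<le> i") auto
  qed
  have "sbr (logder u) (Exp u f) n = sbr (\<Sum>i\<le>n. a i) (\<Sum>j\<le>n. b j) n"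
    by (rule sbr_agree) (auto simp: Exp_def logder_def exp_quotient_def a_def b_def pser_eq_sum[OF R, of _ n] simp del: fact_Suc)
  also have "\<dots> = (\<Sum>i\<le>n. \<Sum>j\<le>n. sbr (a i) (b j) n)"
    by (simp only: sbr_sum_left) (simp only: sbr_sum_right sum_fun_apply)
  also have "\<dots> = (\<Sum>m\<le>n. \<Sum>i\<le>m. sbr (a i) (b (m - i)) n)"
    by (rule sum_triangle_bounded) (simp add: ab0)
  also have "\<dots> = (\<Sum>m<n. \<Sum>i\<le>m. sbr (a i) (b (m - i)) n)"
    by (rule sum.mono_neutral_right) (auto simp: ab0)
  also have "\<dots> = (\<Sum>m<n. \<Sum>i<Suc m. sbr (a i) (b (Suc m - 1 - i)) n)"
    by (simp add: lessThan_Suc_atMost)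
  also have "\<dots> = (\<Sum>m\<le>n. \<Sum>i<m. sbr (a i) (b (m - 1 - i)) n)"
    by (simp add: sum.atMost_shift)
  finally have log: "sbr (logder u) (Exp u f) n = (\<Sum>m\<le>n. \<Sum>i<m. sbr (a i) (b (m - 1 - i)) n)" .
  have "euler (Exp u f) n = (\<Sum>m\<le>n. sscale (1 / fact m) (euler ((sbr u ^^ m) f)) n)"
    by (auto simp: Exp_apply euler_def scale_sum_right mult.commute intro!: sum.cong)
  also have "\<dots> = Exp u (euler f) n + (\<Sum>m\<le>n. \<Sum>i<m. sbr (a i) (b (m - 1 - i)) n)"
    by (subst divided_euler_pow) (simp add: sum.distrib sum_fun_apply a_def b_def Exp_apply)
  finally show "euler (Exp u f) n = (Exp u (euler f) + sbr (logder u) (Exp u f)) n"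
    by (simp add: log)
qed

lemma logder_0 [simp]: "u 0 = 0 \<Longrightarrow> logder u 0 = 0"
  unfolding logder_def using pser_order[OF raising_sbr, of u 1 "euler u" 0] by simp

end

section \<open>Dynkin's form of the Baker--Campbell--Hausdorff series\<close>

text \<open>Recursion on the degree.  It is used for series with a given logarithmic derivative, for lifts, and for
  gauge transformations: in each case the condition in degree \<open>n\<close> sees only the components up to \<open>n\<close>, and the \<open>n\<close>-th component can be
  chosen freely.\<close>

lemma exists_sequence:
  fixes P :: "nat \<Rightarrow> (nat \<Rightarrow> 'a) \<Rightarrow> bool"
  assumes loc: "\<And>n f g. \<forall>i\<le>n. f i = g i \<Longrightarrow> P n f = P n g"
    and ext: "\<And>n f. \<forall>m<n. P m f \<Longrightarrow> \<exists>a. P n (f(n := a))"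
  shows "\<exists>f. \<forall>n. P n f"
proof -
  define Q where "Q f n r = P n ((\<lambda>i. if i < n then f i else undefined)(n := r))" for f :: "nat \<Rightarrow> 'a" and n r
  have Q: "Q f n (f n) = P n f" for f n
    unfolding Q_def by (rule loc) auto
  have "\<exists>f. \<forall>n. Q f n (f n)"
  proof (rule dependent_wellorder_choice)
    fix r and f g :: "nat \<Rightarrow> 'a" and n :: nat assume "\<And>m. m < n \<Longrightarrow> f m = g m"
    then have "(\<lambda>i. if i < n then f i else undefined) = (\<lambda>i. if i < n then g i else undefined)" by auto
    then show "Q f n r = Q g n r" by (simp add: Q_def)
  next
    fix n :: nat and f :: "nat \<Rightarrow> 'a" assume *: "\<And>m. m < n \<Longrightarrow> Q f m (f m)"
    have "\<forall>m<n. P m (\<lambda>i. if i < n then f i else undefined)"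
    proof (intro allI impI)
      fix m assume m: "m < n"
      then have "P m f" using * Q by blast
      then show "P m (\<lambda>i. if i < n then f i else undefined)"
        using m by (subst loc[of m _ f]) auto
    qed
    then show "\<exists>r. Q f n r" unfolding Q_def by (rule ext)
  qed
  then show ?thesis using Q by auto
qed

lemma length_dynkin_indices: "ps \<in> dynkin_indices N \<Longrightarrow> length ps \<le> N"
proof -
  have "(0, 0) \<notin> set ps \<Longrightarrow> length ps \<le> (\<Sum>(r, s)\<leftarrow>ps. r + s)"
    by (induction ps) auto
  then show "ps \<in> dynkin_indices N \<Longrightarrow> length ps \<le> N" by (auto simp: dynkin_indices_def)
qed

lemma finite_dynkin_indices: "finite (dynkin_indices N)"
proof (rule finite_subset)
  have "set ps \<subseteq> {..N} \<times> {..N}" if "ps \<in> dynkin_indices N" for ps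
  proof -
    have "r + s \<le> (\<Sum>(r, s)\<leftarrow>ps. r + s)" if "(r, s) \<in> set ps" for r s
      using that by (induction ps) auto
    then show ?thesis using that by (force simp: dynkin_indices_def)
  qed
  then show "dynkin_indices N \<subseteq> {ps. set ps \<subseteq> {..N} \<times> {..N} \<and> length ps \<le> N}"
    using length_dynkin_indices by blast
  show "finite {ps. set ps \<subseteq> {..N} \<times> {..N} \<and> length ps \<le> N}"
    by (rule finite_lists_length_le) simp
qed

text \<open>The power series \<open>log (1 + p) / p\<close>.\<close>

definition log_quotient :: "'k::field_char_0 fps" where
  "log_quotient = Abs_fps (\<lambda>n. (- 1) ^ n / of_nat (Suc n))"

text \<open>At \<open>p = exp t - 1\<close> the two series are \<open>t / p\<close> and \<open>p / t\<close>; multiplying by \<open>t\<close> avoids the division.\<close>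

lemma log_exp_quotients:
  "(log_quotient oo (fps_exp 1 - 1)) * Abs_fps (\<lambda>n. 1 / fact (Suc n)) = (1 :: 'k::field_char_0 fps)"
proof -
  let ?p = "fps_exp 1 - 1 :: 'k fps" and ?q = "Abs_fps (\<lambda>n. 1 / fact (Suc n)) :: 'k fps"
  have X: "fps_X * ?q = ?p"
    by (rule fps_ext) (simp del: fact_Suc)
  have L: "fps_X * log_quotient = (fps_ln 1 :: 'k fps)"
    by (rule fps_ext) (auto simp: log_quotient_def fps_ln_nth simp del: of_nat_Suc)
  have p0: "fps_nth ?p 0 = 0" "fps_nth ?p 1 \<noteq> 0" by auto
  have "fps_X * ((log_quotient oo ?p) * ?q) = ?p * (log_quotient oo ?p)"
    using X by (simp add: mult_ac)
  also have "\<dots> = (fps_X * log_quotient) oo ?p"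
    by (simp add: fps_compose_mult_distrib p0)
  also have "\<dots> = fps_inv ?p oo ?p"
    unfolding L by (simp add: fps_ln_fps_exp_inv)
  also have "\<dots> = fps_X * 1"
    by (simp add: fps_inv p0)
  finally show ?thesis by simp
qed

context lie_alg
begin

definition at_deg :: "nat \<Rightarrow> 'l \<Rightarrow> nat \<Rightarrow> 'l" where
  "at_deg d a = (\<lambda>n. if n = d then a else 0)"

lemma at_deg_apply: "at_deg d a n = (if n = d then a else 0)"
  by (simp add: at_deg_def)

lemma euler_at_deg: "euler (at_deg d a) = sscale (of_nat d) (at_deg d a)"
  by (auto simp: euler_def at_deg_apply fun_eq_iff)

text \<open>Homogeneous sequences are the eigenvectors of the Euler derivation, which makes differential equations
  along it solvable by recursion; this lemma extends the result to all sequences.\<close>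

lemma eq_if_eq_at_deg:
  fixes T S :: "(nat \<Rightarrow> 'l) \<Rightarrow> nat \<Rightarrow> 'l"
  assumes T: "\<And>f g. T (f + g) = T f + T g" and S: "\<And>f g. S (f + g) = S f + S g"
    and locT: "\<And>f g n. \<forall>i\<le>n. f i = g i \<Longrightarrow> T f n = T g n"
    and locS: "\<And>f g n. \<forall>i\<le>n. f i = g i \<Longrightarrow> S f n = S g n"
    and eq: "\<And>d a. T (at_deg d a) = S (at_deg d a)"
  shows "T f = S f"
proof
  fix n
  have T0: "T 0 = 0" using T[of 0 0] by simp
  have S0: "S 0 = 0" using S[of 0 0] by simp
  have f: "\<forall>i\<le>n. f i = (\<Sum>d\<le>n. at_deg d (f d)) i"
  proof (intro allI impI)
    fix i assume "i \<le> n"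
    have "(\<Sum>d\<le>n. at_deg d (f d)) i = (\<Sum>d\<in>{..n}. if i = d then f d else 0)"
      by (simp add: sum_fun_apply at_deg_apply)
    then show "f i = (\<Sum>d\<le>n. at_deg d (f d)) i" using \<open>i \<le> n\<close> by simp
  qed
  have "T f n = T (\<Sum>d\<le>n. at_deg d (f d)) n" by (rule locT[OF f])
  also have "\<dots> = S (\<Sum>d\<le>n. at_deg d (f d)) n"
    by (simp add: sum_additive[where h = T] sum_additive[where h = S] T S T0 S0 eq)
  also have "\<dots> = S f n" by (rule locS[OF f, symmetric])
  finally show "T f n = S f n" .
qed

lemma Exp_add: "u 0 = 0 \<Longrightarrow> Exp u (f + g) = Exp u f + Exp u g"
  unfolding Exp_def by (rule pser_add) (rule raising_sbr)

lemma Exp_sscale: "u 0 = 0 \<Longrightarrow> Exp u (sscale c f) = sscale c (Exp u f)"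
  unfolding Exp_def by (rule pser_scale) (rule raising_sbr)

lemma Exp_agree: "u 0 = 0 \<Longrightarrow> \<forall>i\<le>n. f i = g i \<Longrightarrow> Exp u f n = Exp u g n"
  unfolding Exp_def by (rule pser_agree[of "sbr u" "Suc n"]) (auto simp: raising_sbr)

lemma Exp_order: "u 0 = 0 \<Longrightarrow> \<forall>i<n. f i = 0 \<Longrightarrow> i < n \<Longrightarrow> Exp u f i = 0"
  unfolding Exp_def by (rule pser_order[of "sbr u" n]) (auto simp: raising_sbr)

lemma Exp_lowest: "u 0 = 0 \<Longrightarrow> \<forall>i<n. f i = 0 \<Longrightarrow> Exp u f n = f n"
  unfolding Exp_def by (subst pser_lowest[of "sbr u" n]) (auto simp: raising_sbr)

text \<open>On a sequence of degree \<open>d\<close> both sides \<open>F\<close> satisfy \<open>euler F = d F + [logder w, F]\<close> and have the same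
  component of degree \<open>d\<close>.  In degree \<open>n > d\<close> this expresses \<open>(n - d) F\<^sub>n\<close> by lower components.\<close>

lemma Exp_eq_Exp_Exp:
  assumes u: "u 0 = 0" and v: "v 0 = 0" and w: "w 0 = 0"
    and eq: "logder w = logder u + Exp u (logder v)"
  shows "Exp w f = Exp u (Exp v f)"
proof (rule eq_if_eq_at_deg[of "Exp w" "\<lambda>f. Exp u (Exp v f)"])
  fix d a
  let ?f = "at_deg d a"
  let ?U = "\<lambda>f. Exp u (Exp v f)"
  define W where "W = Exp w ?f - ?U ?f"
  have "euler (?U ?f) = ?U (euler ?f) + (Exp u (sbr (logder v) (Exp v ?f)) + sbr (logder u) (?U ?f))"
    by (simp only: euler_Exp[of u, OF u] euler_Exp[of v, OF v] Exp_add[of u, OF u] add_ac)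
  also have "Exp u (sbr (logder v) (Exp v ?f)) + sbr (logder u) (?U ?f) = sbr (logder w) (?U ?f)"
    by (simp only: eq Exp_sbr[of u, OF u] sbr_add_left add_ac)
  finally have 1: "euler (?U ?f) = sscale (of_nat d) (?U ?f) + sbr (logder w) (?U ?f)"
    by (simp only: euler_at_deg Exp_sscale[of u, OF u] Exp_sscale[of v, OF v])
  have 2: "euler (Exp w ?f) = sscale (of_nat d) (Exp w ?f) + sbr (logder w) (Exp w ?f)"
    by (simp only: euler_Exp[of w, OF w] euler_at_deg Exp_sscale[of w, OF w])
  have W: "W + ?U ?f = Exp w ?f" by (simp add: W_def)
  have "euler W + euler (?U ?f) = sscale (of_nat d) (W + ?U ?f) + (sbr (logder w) W + sbr (logder w) (?U ?f))"
    by (simp only: euler_add[symmetric] sbr_add_right[symmetric] W 2)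
  then have 3: "euler W = sscale (of_nat d) W + sbr (logder w) W"
    unfolding 1 fun_eq_iff by (simp add: scale_right_distrib algebra_simps)
  have low: "\<forall>i<d. ?f i = 0" by (simp add: at_deg_apply)
  have lowv: "\<forall>i<d. Exp v ?f i = 0" using Exp_order[of v, OF v low] by blast
  have "W n = 0" for n
  proof (induction n rule: less_induct)
    case (less n)
    consider "n < d" | "n = d" | "n > d" by linarith
    then show ?case
    proof cases
      case 1
      then show ?thesis using Exp_order[of w, OF w low] Exp_order[of u, OF u lowv] by (simp add: W_def)
    next
      case 2
      then show ?thesis
        using Exp_lowest[of w, OF w low] Exp_lowest[of u, OF u lowv] Exp_lowest[of v, OF v low] by (simp add: W_def)
    next
      case 3
      have "sbr (logder w) W n = 0"
        using less by (intro sbr_order[of _ n]) (auto simp: w)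
      then have "scale (of_nat n) (W n) = scale (of_nat d) (W n)"
        using fun_cong[OF \<open>euler W = _\<close>, of n] by (simp add: euler_def)
      then show ?thesis using 3 by simp
    qed
  qed
  then have "W = 0" by auto
  then show "Exp w ?f = ?U ?f" by (simp add: W_def)
qed (use u v w in \<open>auto simp: Exp_add intro!: Exp_agree\<close>)

lemma pow_sbr_cong:
  "\<forall>i\<le>n. u i = u' i \<Longrightarrow> \<forall>i\<le>n. f i = f' i \<Longrightarrow> i \<le> n \<Longrightarrow> (sbr u ^^ k) f i = (sbr u' ^^ k) f' i"
  by (induction k arbitrary: i) (auto intro!: sbr_agree)

lemma sbr_agree_strict:
  assumes "u 0 = 0" "u' 0 = 0" "g 0 = 0" "g' 0 = 0" "\<forall>i<n. u i = u' i" "\<forall>i<n. g i = g' i"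
  shows "sbr u g n = sbr u' g' n"
proof -
  have "br (u i) (g (n - i)) = br (u' i) (g' (n - i))" if "i \<le> n" for i
  proof (cases "i = 0 \<or> i = n")
    case False
    with that have "i < n" "n - i < n" by auto
    then show ?thesis using assms by simp
  qed (use assms in auto)
  then show ?thesis by (simp add: sbr_def)
qed

text \<open>The linear term \<open>euler u\<close> of \<open>logder u\<close> is the only one that sees the top component, since in the
  others it would be bracketed with a constant term.  Hence \<open>logder\<close> is triangular, and bijective.\<close>

lemma logder_top:
  assumes u: "u 0 = 0" and u': "u' 0 = 0" and eq: "\<forall>i<n. u i = u' i"
  shows "logder u n - scale (of_nat n) (u n) = logder u' n - scale (of_nat n) (u' n)"
proof -
  have *: "logder v n - scale (of_nat n) (v n)
      = (\<Sum>k<n. scale (fps_nth exp_quotient (Suc k)) (sbr v ((sbr v ^^ k) (euler v)) n))" for v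
    unfolding logder_def pser_def by (simp add: sum.atMost_shift exp_quotient_def euler_def)
  have pow0: "(sbr v ^^ k) (euler v) 0 = 0" if "v 0 = 0" for v k
    using pow_order[of "sbr v" 1 "euler v" 0 k] raising_sbr[of v, OF that] by simp
  have "sbr u ((sbr u ^^ k) (euler u)) n = sbr u' ((sbr u' ^^ k) (euler u')) n" for k
  proof (rule sbr_agree_strict)
    show "\<forall>i<n. (sbr u ^^ k) (euler u) i = (sbr u' ^^ k) (euler u') i"
      using eq by (intro allI impI pow_sbr_cong[of "n - 1"]) (auto simp: euler_def)
  qed (use u u' eq pow0 in auto)
  then show ?thesis by (simp add: *)
qed

lemma logder_surj:
  assumes M: "M 0 = 0"
  obtains z where "z 0 = 0" "logder z = M"
proof -
  define P where "P n z \<longleftrightarrow> (if n = 0 then z 0 = 0 else logder z n = M n)" for n z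
  have "\<exists>z. \<forall>n. P n z"
  proof (rule exists_sequence)
    fix n and f g :: "nat \<Rightarrow> 'l" assume eq: "\<forall>i\<le>n. f i = g i"
    have "(sbr f ^^ k) (euler f) n = (sbr g ^^ k) (euler g) n" for k
      using eq by (intro pow_sbr_cong[of n]) (auto simp: euler_def)
    then show "P n f = P n g" using eq by (simp add: P_def logder_def pser_def)
  next
    fix n and z :: "nat \<Rightarrow> 'l" assume z: "\<forall>m<n. P m z"
    show "\<exists>a. P n (z(n := a))"
    proof (cases "n = 0")
      case False
      with z have z0: "z 0 = 0" by (auto simp: P_def)
      define a where "a = scale (1 / of_nat n) (M n - (logder z n - scale (of_nat n) (z n)))"
      have "logder (z(n := a)) n - scale (of_nat n) a = logder z n - scale (of_nat n) (z n)"
        using logder_top[of "z(n := a)" z n] False z0 by simp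
      moreover have "scale (of_nat n) a = M n - (logder z n - scale (of_nat n) (z n))"
        using False by (simp add: a_def)
      ultimately show ?thesis using False by (intro exI[of _ a]) (simp add: P_def algebra_simps)
    qed (auto simp: P_def)
  qed
  then obtain z where "\<forall>n. P n z" ..
  then have z: "z 0 = 0" "logder z n = M n" for n
    using M logder_0[of z] by (auto simp: P_def split: if_splits)
  show thesis by (rule that[of z]) (auto simp: z)
qed

lemma logder_inj:
  assumes "u 0 = 0" "v 0 = 0" "logder u = logder v"
  shows "u = v"
proof
  fix n show "u n = v n"
  proof (induction n rule: less_induct)
    case (less n)
    then have "scale (of_nat n) (u n) = scale (of_nat n) (v n)"
      using logder_top[of u v n] assms by simp
    then show ?case using assms(1,2) by (cases "n = 0") auto
  qed
qed

text \<open>The series \<open>log (1 + p) / p\<close> at \<open>p = exp (ad u) - 1\<close> inverts the operator in the definition of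
  \<open>logder\<close>.  It recovers \<open>u\<close> itself, and not only \<open>ad u\<close>, from data that are known for a product of
  exponentials.\<close>

lemma euler_eq_log_series:
  assumes u: "u 0 = 0"
  shows "euler u = pser log_quotient (\<lambda>f. Exp u f - f) (logder u)"
proof -
  note R = raising_sbr[of u, OF u]
  have p: "pser (fps_exp 1 - 1) (sbr u) = (\<lambda>f. Exp u f - f)"
    by (auto simp: pser_diff_fps Exp_def)
  have "euler u = pser ((log_quotient oo (fps_exp 1 - 1)) * exp_quotient) (sbr u) (euler u)"
    unfolding exp_quotient_def log_exp_quotients by simp
  also have "\<dots> = pser (log_quotient oo (fps_exp 1 - 1)) (sbr u) (logder u)"
    by (simp add: pser_mult[OF R] logder_def)
  also have "\<dots> = pser log_quotient (\<lambda>f. Exp u f - f) (logder u)"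
    by (subst pser_compose[OF R]) (auto simp: p)
  finally show ?thesis .
qed

fun nest :: "'l list \<Rightarrow> 'l" where
  "nest [] = 0"
| "nest [f] = f"
| "nest (f # g # fs) = br f (nest (g # fs))"

lemma nest_Cons: "w \<noteq> [] \<Longrightarrow> nest (a # w) = br a (nest w)"
  by (cases w) auto

lemma nest_replicate_append: "w \<noteq> [] \<Longrightarrow> nest (replicate r x @ w) = (br x ^^ r) (nest w)"
  by (induction r) (auto simp: nest_Cons)

text \<open>The part of degree \<open>N\<close> of Dynkin's series.\<close>

definition dyn :: "'l \<Rightarrow> 'l \<Rightarrow> nat \<Rightarrow> 'l" where
  "dyn x y N = (\<Sum>ps\<in>dynkin_indices N. scale (dynkin_coeff N ps) (nest (dynkin_word x y ps)))"

lemma sbr_at_deg_1: "sbr (at_deg (Suc 0) x) f n = (if n = 0 then 0 else br x (f (n - 1)))"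
proof -
  have "sbr (at_deg (Suc 0) x) f n = (\<Sum>i\<in>{..n}. if i = 1 then br x (f (n - 1)) else 0)"
    unfolding sbr_def by (rule sum.cong) (auto simp: at_deg_apply)
  then show ?thesis by (cases n) auto
qed

lemma pow_sbr_at_deg_1: "(sbr (at_deg (Suc 0) x) ^^ r) f n = (if r \<le> n then (br x ^^ r) (f (n - r)) else 0)"
  by (induction r arbitrary: n) (auto simp: sbr_at_deg_1 Suc_le_eq)

lemma Exp_at_deg_1: "Exp (at_deg (Suc 0) x) f n = (\<Sum>r\<le>n. scale (1 / fact r) ((br x ^^ r) (f (n - r))))"
  by (simp add: Exp_apply pow_sbr_at_deg_1)

lemma at_deg_1_0 [simp]: "at_deg (Suc 0) x 0 = 0"
  by (auto simp: at_deg_apply)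

lemma logder_at_deg_1: "logder (at_deg (Suc 0) x) = at_deg (Suc 0) x"
proof
  fix n
  have "(sbr (at_deg (Suc 0) x) ^^ k) (at_deg (Suc 0) x) n = (if k = 0 then at_deg (Suc 0) x n else 0)" for k
  proof (induction k arbitrary: n)
    case (Suc k)
    then show ?case
      by (simp only: funpow.simps o_apply sbr_at_deg_1) (simp add: at_deg_apply br_self)
  qed simp
  then have "logder (at_deg (Suc 0) x) n = (\<Sum>k\<in>{..n}. if k = 0 then at_deg (Suc 0) x n else 0)"
    unfolding logder_def pser_def euler_at_deg
    by (intro sum.cong) (auto simp: exp_quotient_def pow_scale[OF raising_sbr])
  then show "logder (at_deg (Suc 0) x) n = at_deg (Suc 0) x n" by simp
qed

lemma pow_br_add: "(br x ^^ k) (a + b) = (br x ^^ k) a + (br x ^^ k) b"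
  by (induction k) (auto simp: br_add_right)

lemma pow_br_zero [simp]: "(br x ^^ k) 0 = 0"
  by (induction k) auto

lemma pow_br_scale: "(br x ^^ k) (scale c a) = scale c ((br x ^^ k) a)"
  by (induction k) (auto simp: br_scale_right)

lemma pow_br_sum: "(br x ^^ k) (\<Sum>i\<in>A. F i) = (\<Sum>i\<in>A. (br x ^^ k) (F i))"
  by (rule sum_additive[where h = "br x ^^ k"]) (auto simp: pow_br_add)

definition dynkin_part :: "nat \<Rightarrow> nat \<Rightarrow> (nat \<times> nat) list set" where
  "dynkin_part N j = {ps \<in> dynkin_indices N. length ps = j}"

definition block_coeff :: "(nat \<times> nat) list \<Rightarrow> 'k" where
  "block_coeff ps = 1 / (\<Prod>(r, s)\<leftarrow>ps. fact r * fact s)"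

text \<open>Each of the \<open>j\<close> factors \<open>exp (ad x) exp (ad y) - 1\<close> contributes a block \<open>(r, s)\<close>.  The last block comes from
  \<open>M = x + exp (ad x) y\<close>: a nested bracket that ends in two equal letters vanishes, so that the last block is
  \<open>(1, 0)\<close> or \<open>(r, 1)\<close>, and these blocks sum up to \<open>M\<close>.\<close>

lemma block_expansion:
  fixes x y
  defines "V \<equiv> \<lambda>f. Exp (at_deg (Suc 0) x) (Exp (at_deg (Suc 0) y) f) - f"
    and "M \<equiv> at_deg (Suc 0) x + Exp (at_deg (Suc 0) x) (at_deg (Suc 0) y)"
  shows "(V ^^ j) M N = (\<Sum>ps\<in>dynkin_part N (Suc j). scale (block_coeff ps) (nest (dynkin_word x y ps)))"
proof (induction j arbitrary: N)
  case 0
  have part: "(\<Sum>ps\<in>dynkin_part N (Suc 0). F ps) = (if N = 0 then 0 else (\<Sum>r\<le>N. F [(r, N - r)]))"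
    for F :: "_ \<Rightarrow> 'l"
  proof (cases "N = 0")
    case True
    then have "dynkin_part N (Suc 0) = {}"
      by (auto simp: dynkin_part_def dynkin_indices_def length_Suc_conv)
    with True show ?thesis by simp
  next
    case False
    have "(\<Sum>r\<le>N. F [(r, N - r)]) = (\<Sum>ps\<in>dynkin_part N (Suc 0). F ps)"
      by (rule sum.reindex_bij_witness[of _ "\<lambda>ps. fst (hd ps)" "\<lambda>r. [(r, N - r)]"])
        (use False in \<open>auto simp: dynkin_part_def dynkin_indices_def length_Suc_conv\<close>)
    with False show ?thesis by simp
  qed
  have nestx: "nest (replicate k z) = (if k = 1 then z else 0)" for k z
  proof (cases k)
    case (Suc l)
    have "nest (replicate l z @ [z]) = (br z ^^ l) z" by (subst nest_replicate_append) auto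
    also have "\<dots> = (if l = 0 then z else 0)" by (cases l) (auto simp: funpow_swap1 br_self)
    finally show ?thesis using Suc by (simp add: replicate_append_same)
  qed simp
  show ?case
  proof (cases N)
    case 0
    then show ?thesis unfolding part by (simp add: M_def Exp_at_deg_1 at_deg_apply)
  next
    case (Suc n)
    have nxy: "nest (replicate r x @ replicate s y) = (if s = 0 then (if r = 1 then x else 0)
        else if s = 1 then (br x ^^ r) y else 0)" for r s
    proof (cases "s = 0")
      case False
      then show ?thesis by (subst nest_replicate_append) (auto simp: nestx)
    qed (simp add: nestx)
    have "(\<Sum>ps\<in>dynkin_part N (Suc 0). scale (block_coeff ps) (nest (dynkin_word x y ps)))
      = (\<Sum>r\<le>n. scale (1 / (fact r * fact (Suc n - r))) (if Suc n - r = 1 then (br x ^^ r) y else 0))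
        + scale (1 / fact N) (if n = 0 then x else 0)"
      unfolding part by (simp add: Suc dynkin_word_def nxy block_coeff_def Suc_diff_le del: fact_Suc)
    also have "(\<Sum>r\<le>n. scale (1 / (fact r * fact (Suc n - r))) (if Suc n - r = 1 then (br x ^^ r) y else 0))
      = (\<Sum>r\<in>{..n}. if r = n then scale (1 / fact n) ((br x ^^ n) y) else 0)"
      by (intro sum.cong) (auto simp: Suc_diff_le)
    also have "scale (1 / fact N) (if n = 0 then x else 0) = at_deg (Suc 0) x N"
      using Suc by (auto simp: at_deg_apply)
    finally have 1: "(\<Sum>ps\<in>dynkin_part N (Suc 0). scale (block_coeff ps) (nest (dynkin_word x y ps)))
      = scale (1 / fact n) ((br x ^^ n) y) + at_deg (Suc 0) x N" by simp
    have "Exp (at_deg (Suc 0) x) (at_deg (Suc 0) y) N = (\<Sum>r\<in>{..Suc n}. if r = n then scale (1 / fact n) ((br x ^^ n) y) else 0)"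
      unfolding Exp_at_deg_1 Suc by (intro sum.cong) (auto simp: at_deg_apply)
    then show ?thesis using 1 by (simp add: M_def add.commute)
  qed
next
  case (Suc j)
  define Q where "Q = {(r, s). r + s \<le> N} - {(0, 0 :: nat)}"
  have finQ: "finite {(r, s). r + s \<le> N}"
    by (rule finite_subset[of _ "{..N} \<times> {..N}"]) auto
  have V: "V f N = (\<Sum>(r, s)\<in>Q. scale (1 / (fact r * fact s)) ((br x ^^ r) ((br y ^^ s) (f (N - r - s)))))" for f
  proof -
    have "Exp (at_deg (Suc 0) x) (Exp (at_deg (Suc 0) y) f) N
      = (\<Sum>r\<le>N. \<Sum>s\<le>N - r. scale (1 / (fact r * fact s)) ((br x ^^ r) ((br y ^^ s) (f (N - r - s)))))"
      by (simp add: Exp_at_deg_1 pow_br_sum pow_br_scale scale_sum_right)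
    also have "\<dots> = (\<Sum>(r, s)\<in>{(r, s). r + s \<le> N}. scale (1 / (fact r * fact s)) ((br x ^^ r) ((br y ^^ s) (f (N - r - s)))))"
      by (subst sum.Sigma) (auto intro!: sum.cong)
    also have "\<dots> = f N + (\<Sum>(r, s)\<in>Q. scale (1 / (fact r * fact s)) ((br x ^^ r) ((br y ^^ s) (f (N - r - s)))))"
      unfolding Q_def by (subst sum.remove[OF finQ, of "(0, 0)"]) auto
    finally show ?thesis by (simp add: V_def)
  qed
  let ?F = "\<lambda>ps. scale (block_coeff ps) (nest (dynkin_word x y ps))"
  have "(V ^^ Suc j) M N = (\<Sum>(r, s)\<in>Q. scale (1 / (fact r * fact s)) ((br x ^^ r) ((br y ^^ s)
      (\<Sum>ps\<in>dynkin_part (N - r - s) (Suc j). ?F ps))))"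
    by (simp add: V Suc)
  also have "\<dots> = (\<Sum>(r, s)\<in>Q. \<Sum>ps\<in>dynkin_part (N - r - s) (Suc j). ?F ((r, s) # ps))"
  proof (intro sum.cong refl, clarify)
    fix r s
    have "scale (1 / (fact r * fact s)) ((br x ^^ r) ((br y ^^ s) (?F ps))) = ?F ((r, s) # ps)"
      if "ps \<in> dynkin_part (N - r - s) (Suc j)" for ps
    proof -
      have "dynkin_word x y ps \<noteq> []"
        using that by (auto simp: dynkin_word_def dynkin_part_def dynkin_indices_def length_Suc_conv)
      then have "nest (dynkin_word x y ((r, s) # ps)) = (br x ^^ r) ((br y ^^ s) (nest (dynkin_word x y ps)))"
        by (simp add: dynkin_word_def nest_replicate_append)
      then show ?thesis by (simp add: pow_br_scale block_coeff_def mult_ac)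
    qed
    then show "scale (1 / (fact r * fact s)) ((br x ^^ r) ((br y ^^ s)
      (\<Sum>ps\<in>dynkin_part (N - r - s) (Suc j). ?F ps))) = (\<Sum>ps\<in>dynkin_part (N - r - s) (Suc j). ?F ((r, s) # ps))"
      by (simp add: pow_br_sum scale_sum_right)
  qed
  also have "\<dots> = (\<Sum>(p, ps)\<in>Sigma Q (\<lambda>(r, s). dynkin_part (N - r - s) (Suc j)). ?F (p # ps))"
    using finQ finite_dynkin_indices
    by (subst sum.Sigma[symmetric]) (auto simp: Q_def dynkin_part_def split_beta intro!: sum.cong)
  also have "\<dots> = (\<Sum>ps\<in>dynkin_part N (Suc (Suc j)). ?F ps)"
    by (rule sum.reindex_bij_witness[of _ "\<lambda>ps. (hd ps, tl ps)" "\<lambda>(p, ps). p # ps"])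
      (auto simp: dynkin_part_def dynkin_indices_def Q_def length_Suc_conv)
  finally show ?case .
qed

text \<open>Let \<open>z\<close> be the series with the logarithmic derivative of the product of \<open>exp (s x)\<close> and \<open>exp (s y)\<close>, where
  \<open>s\<close> is the parameter of the power series.  Expanding \<open>euler z\<close> by the logarithm gives Dynkin's sum, and the
  Euler derivation multiplies its part of degree \<open>N\<close> by \<open>N\<close>; this is the factor \<open>1 / N\<close> of Dynkin's
  coefficients.\<close>

theorem Exp_dyn:
  "dyn x y 0 = 0" "Exp (dyn x y) f = Exp (at_deg (Suc 0) x) (Exp (at_deg (Suc 0) y) f)"
proof -
  define M where "M = at_deg (Suc 0) x + Exp (at_deg (Suc 0) x) (at_deg (Suc 0) y)"
  define V where "V = (\<lambda>f. Exp (at_deg (Suc 0) x) (Exp (at_deg (Suc 0) y) f) - f)"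
  have "M 0 = 0" by (simp add: M_def Exp_at_deg_1)
  then obtain z where z: "z 0 = 0" "logder z = M" by (rule logder_surj)
  have E: "Exp z f = Exp (at_deg (Suc 0) x) (Exp (at_deg (Suc 0) y) f)" for f
    by (rule Exp_eq_Exp_Exp) (auto simp: z M_def logder_at_deg_1)
  \<comment> \<open>In degree zero both sides vanish, but division by the degree is meaningless there; the case is settled by
    the only index, the empty list.\<close>
  have "z N = dyn x y N" for N
  proof (cases "N = 0")
    case True
    then have "dynkin_indices N = {[]}"
      using length_dynkin_indices[of _ N] by (auto simp: dynkin_indices_def)
    then show ?thesis using z True by (simp add: dyn_def dynkin_word_def)
  next
    case False
    let ?G = "\<lambda>ps. nest (dynkin_word x y ps)"
    have "scale (of_nat N) (z N) = pser log_quotient V M N"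
      using fun_cong[OF euler_eq_log_series[of z], of N] z E by (simp add: V_def euler_def)
    also have "\<dots> = (\<Sum>j\<le>N. \<Sum>ps\<in>dynkin_part N (Suc j). scale (of_nat N * dynkin_coeff N ps) (?G ps))"
      unfolding pser_def V_def M_def block_expansion scale_sum_right
      using False by (intro sum.cong refl) (simp add: log_quotient_def block_coeff_def dynkin_coeff_def dynkin_part_def)
    also have "\<dots> = (\<Sum>j\<le>N. \<Sum>ps\<in>{ps \<in> dynkin_indices N. length ps - 1 = j}. scale (of_nat N * dynkin_coeff N ps) (?G ps))"
    proof (rule sum.cong[OF refl])
      fix j
      have "ps \<noteq> []" if "ps \<in> dynkin_indices N" for ps
        using that False by (auto simp: dynkin_indices_def)
      then have "dynkin_part N (Suc j) = {ps \<in> dynkin_indices N. length ps - 1 = j}"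
        by (force simp: dynkin_part_def Suc_le_eq)
      then show "(\<Sum>ps\<in>dynkin_part N (Suc j). scale (of_nat N * dynkin_coeff N ps) (?G ps))
        = (\<Sum>ps\<in>{ps \<in> dynkin_indices N. length ps - 1 = j}. scale (of_nat N * dynkin_coeff N ps) (?G ps))" by simp
    qed
    also have "\<dots> = (\<Sum>ps\<in>dynkin_indices N. scale (of_nat N * dynkin_coeff N ps) (?G ps))"
      using length_dynkin_indices by (intro sum.group) (force simp: finite_dynkin_indices)+
    also have "\<dots> = scale (of_nat N) (dyn x y N)"
      by (simp add: dyn_def scale_sum_right)
    finally show ?thesis using False by simp
  qed
  then have "z = dyn x y" by auto
  then show "dyn x y 0 = 0" "Exp (dyn x y) f = Exp (at_deg (Suc 0) x) (Exp (at_deg (Suc 0) y) f)"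
    using z E by auto
qed

end

section \<open>The group law of formal power series without constant term in a Lie algebra\<close>

lemma dynkin_indices_1: "dynkin_indices (Suc 0) = {[(1, 0)], [(0, 1)]}"
proof
  show "dynkin_indices (Suc 0) \<subseteq> {[(1, 0)], [(0, 1)]}"
  proof
    fix ps assume ps: "ps \<in> dynkin_indices (Suc 0)"
    then obtain r s where "ps = [(r, s)]"
    proof -
      have "length ps \<le> 1" using length_dynkin_indices[OF ps] by simp
      then show thesis using ps that by (cases ps) (auto simp: dynkin_indices_def)
    qed
    then show "ps \<in> {[(1, 0)], [(0, 1)]}" using ps by (auto simp: dynkin_indices_def)
  qed
qed (auto simp: dynkin_indices_def)

lemma length_dynkin_word: "ps \<in> dynkin_indices N \<Longrightarrow> length (dynkin_word x y ps) = N"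
proof -
  have "length (dynkin_word x y ps) = (\<Sum>(r, s)\<leftarrow>ps. r + s)"
    by (induction ps) (auto simp: dynkin_word_def)
  then show "ps \<in> dynkin_indices N \<Longrightarrow> length (dynkin_word x y ps) = N" by (simp add: dynkin_indices_def)
qed

lemma set_dynkin_word: "set (dynkin_word x y ps) \<subseteq> {x, y}"
proof (induction ps)
  case (Cons p ps)
  obtain r s where p: "p = (r, s)" by (cases p)
  have 1: "set (replicate r x) \<subseteq> {x, y}" "set (replicate s y) \<subseteq> {x, y}" by (auto dest: in_set_replicate[THEN iffD1])
  have 2: "set (dynkin_word x y (p # ps)) = set (replicate r x) \<union> set (replicate s y) \<union> set (dynkin_word x y ps)"
    by (simp only: dynkin_word_def p list.map concat.simps prod.case set_append)
  show ?case unfolding 2 using 1 Cons by (intro Un_least)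
qed (simp add: dynkin_word_def)

lemma map_dynkin_word: "map h (dynkin_word x y ps) = dynkin_word (h x) (h y) ps"
  by (induction ps) (simp_all add: dynkin_word_def split_beta)

context lie_alg
begin

lemma lie_alg_sequences: "lie_alg sscale sbr"
proof unfold_locales
  show "sbr f (sbr g h) + sbr g (sbr h f) + sbr h (sbr f g) = 0" for f g h
  proof -
    have 1: "sbr h f = - sbr f h" "sbr h (sbr f g) = - sbr (sbr f g) h" by (rule sbr_antisym)+
    have "sbr g (- sbr f h) = - sbr g (sbr f h)"
      using sbr_add_right[of g "sbr f h" "- sbr f h"] by (simp add: eq_neg_iff_add_eq_0 add.commute)
    then show ?thesis unfolding 1 sbr_derivation[of f g h] by simp
  qed
qed (auto simp: sbr_add_left sbr_add_right sbr_scale_left sbr_scale_right sbr_self fun_eq_iff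
    scale_right_distrib scale_left_distrib)

abbreviation snest :: "(nat \<Rightarrow> 'l) list \<Rightarrow> nat \<Rightarrow> 'l" where
  "snest \<equiv> lie_alg.nest sbr"

lemmas snest_simps = lie_alg.nest.simps[OF lie_alg_sequences]
lemmas snest_Cons = lie_alg.nest_Cons[OF lie_alg_sequences]

definition bch :: "(nat \<Rightarrow> 'l) \<Rightarrow> (nat \<Rightarrow> 'l) \<Rightarrow> nat \<Rightarrow> 'l" where
  "bch f g = (\<lambda>n. \<Sum>N = 1..n. \<Sum>ps\<in>dynkin_indices N.
     scale (dynkin_coeff N ps) (snest (dynkin_word f g ps) n))"

lemma snest_order: "\<forall>f\<in>set fs. f 0 = 0 \<Longrightarrow> n < length fs \<Longrightarrow> snest fs n = 0"
proof (induction fs arbitrary: n)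
  case (Cons f fs)
  show ?case
  proof (cases "fs = []")
    case False
    have "sbr f (snest fs) n = 0"
      using Cons by (intro sbr_order[of f "length fs"]) auto
    then show ?thesis using False by (simp add: snest_Cons)
  qed (use Cons in \<open>simp add: snest_simps\<close>)
qed (simp add: snest_simps)

text \<open>The adjoint action of a Lie algebra of power series has a kernel, so that associativity cannot be read
  off from it.  In the extension by the Euler derivation \<open>E\<close> the bracket with \<open>E\<close> detects every series
  without constant term.  A pair \<open>(f, a)\<close> stands for \<open>f + a E\<close>.\<close>

definition ext_scale :: "'k \<Rightarrow> (nat \<Rightarrow> 'l) \<times> 'k \<Rightarrow> (nat \<Rightarrow> 'l) \<times> 'k" where
  "ext_scale c x = (sscale c (fst x), c * snd x)"

definition ext_br :: "(nat \<Rightarrow> 'l) \<times> 'k \<Rightarrow> (nat \<Rightarrow> 'l) \<times> 'k \<Rightarrow> (nat \<Rightarrow> 'l) \<times> 'k" where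
  "ext_br x y = (sbr (fst x) (fst y) + sscale (snd x) (euler (fst y)) - sscale (snd y) (euler (fst x)), 0)"

lemma euler_diff: "euler (f - g) = euler f - euler g"
  by (auto simp: euler_def fun_eq_iff scale_right_diff_distrib)

lemma sbr_diff_right: "sbr h (f - g) = sbr h f - sbr h g"
  using sbr_add_right[of h "f - g" g] by (simp add: algebra_simps)

lemma lie_alg_ext: "lie_alg ext_scale ext_br"
proof unfold_locales
  fix x y z :: "(nat \<Rightarrow> 'l) \<times> 'k"
  obtain f a g b h c where xyz: "x = (f, a)" "y = (g, b)" "z = (h, c)" by (cases x, cases y, cases z)
  interpret S: lie_alg sscale sbr by (rule lie_alg_sequences)
  have j: "sbr f (sbr g h) n + sbr g (sbr h f) n + sbr h (sbr f g) n = 0" for n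
    using fun_cong[OF S.jacobi[of f g h], of n] by simp
  have anti: "sbr (euler g) h n = - sbr h (euler g) n" "sbr (euler h) f n = - sbr f (euler h) n"
    "sbr (euler f) g n = - sbr g (euler f) n" for n
    by (simp_all only: S.br_antisym[of "euler _"] uminus_apply)
  have "fst (ext_br x (ext_br y z) + ext_br y (ext_br z x) + ext_br z (ext_br x y)) n = 0" for n
  proof -
    have "fst (ext_br x (ext_br y z) + ext_br y (ext_br z x) + ext_br z (ext_br x y)) n
      = sbr f (sbr g h) n + sbr g (sbr h f) n + sbr h (sbr f g) n"
      unfolding xyz ext_br_def fst_conv snd_conv
      by (simp add: sbr_add_right sbr_scale_right sbr_diff_right euler_add euler_sscale euler_sbr euler_diff
        anti scale_right_distrib scale_right_diff_distrib algebra_simps)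
    with j show ?thesis by simp
  qed
  then show "ext_br x (ext_br y z) + ext_br y (ext_br z x) + ext_br z (ext_br x y) = 0"
    by (simp add: prod_eq_iff fun_eq_iff ext_br_def)
next
qed (auto simp: ext_scale_def ext_br_def prod_eq_iff fun_eq_iff scale_right_distrib scale_left_distrib
    sbr_add_left sbr_add_right sbr_scale_left sbr_scale_right sbr_self euler_add euler_sscale
    algebra_simps)

text \<open>Series in a parameter whose \<open>N\<close>-th coefficient has order at least \<open>N\<close> can be evaluated at the value
  one of the parameter.\<close>

definition filtered :: "(nat \<Rightarrow> (nat \<Rightarrow> 'l) \<times> 'k) \<Rightarrow> bool" where
  "filtered F \<longleftrightarrow> (\<forall>N n. n < N \<longrightarrow> fst (F N) n = 0) \<and> (\<forall>N>0. snd (F N) = 0)"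

definition specialize :: "(nat \<Rightarrow> (nat \<Rightarrow> 'l) \<times> 'k) \<Rightarrow> (nat \<Rightarrow> 'l) \<times> 'k" where
  "specialize F = ((\<lambda>n. \<Sum>N\<le>n. fst (F N) n), snd (F 0))"

lemma fst_specialize: "fst (specialize F) n = (\<Sum>N\<le>n. fst (F N) n)"
  by (simp add: specialize_def)

lemma ext_br_pair: "ext_br (f, 0) (g, 0) = (sbr f g, 0)"
  by (auto simp: ext_br_def fun_eq_iff)

lemma ext_br_agree:
  assumes "\<forall>m\<le>n. fst x m = fst x' m" "snd x = snd x'" "\<forall>m\<le>n. fst y m = fst y' m" "snd y = snd y'"
  shows "fst (ext_br x y) n = fst (ext_br x' y') n"
  using assms sbr_agree[of n "fst x" "fst x'" "fst y" "fst y'"] by (simp add: ext_br_def euler_def)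

lemma snd_ext_br [simp]: "snd (ext_br x y) = 0"
  by (simp add: ext_br_def)

lemma specialize_sum:
  assumes "filtered F" shows "\<forall>m\<le>n. fst (specialize F) m = fst (\<Sum>i\<le>n. F i) m" "snd (specialize F) = snd (\<Sum>i\<le>n. F i)"
proof -
  show "\<forall>m\<le>n. fst (specialize F) m = fst (\<Sum>i\<le>n. F i) m"
    using assms
    by (auto simp: specialize_def fst_sum sum_fun_apply filtered_def not_le intro!: sum.mono_neutral_left)
      (metis not_le)
  have "(\<Sum>i\<le>n. snd (F i)) = (\<Sum>i\<in>{0}. snd (F i))"
    using assms by (intro sum.mono_neutral_right) (auto simp: filtered_def)
  then show "snd (specialize F) = snd (\<Sum>i\<le>n. F i)" by (simp add: specialize_def snd_sum)
qed

text \<open>The filtration leaves only finitely many terms in each component, so that the double sums can be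
  rearranged as if \<open>u\<close> and \<open>F\<close> were finite.\<close>

lemma specialize_sbr:
  assumes u: "filtered u" and F: "filtered F"
  shows "filtered (lie_alg.sbr ext_br u F)" "specialize (lie_alg.sbr ext_br u F) = ext_br (specialize u) (specialize F)"
proof -
  interpret X: lie_alg ext_scale ext_br by (rule lie_alg_ext)
  have G0: "fst (ext_br (u i) (F j)) n = 0" if "n < i + j" for i j n
  proof -
    have "br (fst (u i) m) (fst (F j) (n - m)) = 0" if "m \<le> n" for m
      using \<open>n < i + j\<close> that u F by (cases "m < i") (auto simp: filtered_def)
    then have "sbr (fst (u i)) (fst (F j)) n = 0" by (simp add: sbr_def)
    moreover have "snd (u i) = 0 \<or> fst (F j) n = 0"
      using that u F by (cases "i = 0") (auto simp: filtered_def)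
    moreover have "snd (F j) = 0 \<or> fst (u i) n = 0"
      using that u F by (cases "j = 0") (auto simp: filtered_def)
    ultimately show ?thesis by (auto simp: ext_br_def euler_def)
  qed
  show "filtered (X.sbr u F)"
    by (auto simp: filtered_def X.sbr_def fst_sum snd_sum sum_fun_apply G0 intro!: sum.neutral)
  have "fst (specialize (X.sbr u F)) n = fst (ext_br (specialize u) (specialize F)) n" for n
  proof -
    have "fst (specialize (X.sbr u F)) n = (\<Sum>N\<le>n. \<Sum>i\<le>N. fst (ext_br (u i) (F (N - i))) n)"
      by (simp add: specialize_def X.sbr_def fst_sum sum_fun_apply)
    also have "\<dots> = (\<Sum>i\<le>n. \<Sum>j\<le>n. fst (ext_br (u i) (F j)) n)"
      by (rule sum_triangle_bounded[symmetric]) (rule G0)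
    also have "\<dots> = fst (ext_br (\<Sum>i\<le>n. u i) (\<Sum>j\<le>n. F j)) n"
      by (simp only: X.br_sum_left) (simp only: X.br_sum_right fst_sum sum_fun_apply)
    also have "\<dots> = fst (ext_br (specialize u) (specialize F)) n"
      by (rule ext_br_agree) (use specialize_sum[OF u, of n] specialize_sum[OF F, of n] in auto)
    finally show ?thesis .
  qed
  then show "specialize (X.sbr u F) = ext_br (specialize u) (specialize F)"
    by (auto simp: prod_eq_iff fun_eq_iff) (simp add: specialize_def X.sbr_def)
qed

definition ext_Exp :: "(nat \<Rightarrow> 'l) \<Rightarrow> (nat \<Rightarrow> 'l) \<times> 'k \<Rightarrow> (nat \<Rightarrow> 'l) \<times> 'k" where
  "ext_Exp u v = ((\<lambda>n. \<Sum>k\<le>n. scale (1 / fact k) (fst ((ext_br (u, 0) ^^ k) v) n)), snd v)"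

lemma fst_ext_scale [simp]: "fst (ext_scale c x) n = scale c (fst x n)"
  and snd_ext_scale [simp]: "snd (ext_scale c x) = c * snd x"
  by (simp_all add: ext_scale_def)

lemma specialize_Exp:
  assumes z: "filtered z" "z 0 = 0" and F: "filtered F"
  shows "filtered (lie_alg.Exp ext_scale ext_br z F)"
    "specialize (lie_alg.Exp ext_scale ext_br z F) = ext_Exp (fst (specialize z)) (specialize F)"
proof -
  interpret X: lie_alg ext_scale ext_br by (rule lie_alg_ext)
  have Z: "specialize z = (fst (specialize z), 0)" using z by (simp add: prod_eq_iff specialize_def)
  have P: "filtered ((X.sbr z ^^ k) F) \<and> specialize ((X.sbr z ^^ k) F) = (ext_br (specialize z) ^^ k) (specialize F)" for k
    by (induction k) (auto simp: F specialize_sbr z)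
  show "filtered (X.Exp z F)"
    using P by (auto simp: filtered_def X.Exp_apply fst_sum snd_sum sum_fun_apply intro!: sum.neutral)
  have "fst (specialize (X.Exp z F)) n = fst (ext_Exp (fst (specialize z)) (specialize F)) n" for n
  proof -
    have "fst (specialize (X.Exp z F)) n = (\<Sum>N\<le>n. \<Sum>k\<le>N. scale (1 / fact k) (fst ((X.sbr z ^^ k) F N) n))"
      by (simp add: specialize_def X.Exp_apply fst_sum sum_fun_apply)
    also have "\<dots> = (\<Sum>N\<le>n. \<Sum>k\<le>n. scale (1 / fact k) (fst ((X.sbr z ^^ k) F N) n))"
      by (intro sum.cong refl sum.mono_neutral_left)
        (auto simp: X.pow_vanish[OF X.raising_sbr[of z, OF z(2)]])
    also have "\<dots> = (\<Sum>k\<le>n. \<Sum>N\<le>n. scale (1 / fact k) (fst ((X.sbr z ^^ k) F N) n))"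
      by (rule sum.swap)
    also have "\<dots> = (\<Sum>k\<le>n. scale (1 / fact k) (fst ((ext_br (fst (specialize z), 0) ^^ k) (specialize F)) n))"
      unfolding Z[symmetric] conjunct2[OF P, symmetric] by (simp add: fst_specialize scale_sum_right)
    finally show ?thesis by (simp add: ext_Exp_def)
  qed
  moreover have "snd (specialize (X.Exp z F)) = snd (specialize F)"
    by (simp add: specialize_def X.Exp_apply)
  ultimately show "specialize (X.Exp z F) = ext_Exp (fst (specialize z)) (specialize F)"
    by (auto simp: prod_eq_iff fun_eq_iff ext_Exp_def)
qed

text \<open>Dynkin's formula for \<open>s f\<close> and \<open>s g\<close> in the extended algebra, evaluated at \<open>s = 1\<close>.  The evaluation exists
  because \<open>f\<close> and \<open>g\<close> have no constant term.\<close>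

theorem ext_Exp_bch:
  assumes f: "f 0 = 0" and g: "g 0 = 0"
  shows "ext_Exp (bch f g) v = ext_Exp f (ext_Exp g v)"
proof -
  interpret X: lie_alg ext_scale ext_br by (rule lie_alg_ext)
  have nest: "X.nest (map (\<lambda>h. (h, 0)) hs) = (snest hs, 0)" for hs
  proof (induction hs)
    case (Cons h hs)
    then show ?case
      by (cases "hs = []") (auto simp: snest_simps snest_Cons X.nest_Cons ext_br_pair)
  qed (simp add: snest_simps zero_prod_def zero_fun_def)
  define z where "z = X.dyn (f, 0) (g, 0)"
  have zN: "fst (z N) n = (\<Sum>ps\<in>dynkin_indices N. scale (dynkin_coeff N ps) (snest (dynkin_word f g ps) n))"
    "snd (z N) = 0" for N n
    by (simp_all add: z_def X.dyn_def fst_sum snd_sum sum_fun_apply nest flip: map_dynkin_word[where h = "\<lambda>h. (h, 0)"])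
  have z0: "z 0 = 0" unfolding z_def by (rule X.Exp_dyn)
  have order: "snest (dynkin_word f g ps) n = 0" if "ps \<in> dynkin_indices N" "n < N" for ps n N
    using that set_dynkin_word[of f g ps] f g by (intro snest_order) (auto simp: length_dynkin_word)
  then have filz: "filtered z" by (auto simp: filtered_def zN intro!: sum.neutral)
  have "fst (specialize z) n = bch f g n" for n
  proof -
    have "fst (specialize z) n = (\<Sum>N\<in>{..n} - {0}. fst (z N) n)"
      unfolding specialize_def fst_conv by (rule sum.mono_neutral_right) (auto simp: z0)
    also have "{..n} - {0} = {1..n}" by auto
    finally show ?thesis by (simp add: bch_def zN)
  qed
  then have specz: "fst (specialize z) = bch f g" by auto
  have deg1: "filtered (X.at_deg (Suc 0) (h, 0))" "fst (specialize (X.at_deg (Suc 0) (h, 0))) = h" if "h 0 = 0" for h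
  proof -
    show "filtered (X.at_deg (Suc 0) (h, 0))"
      using that by (auto simp: filtered_def X.at_deg_apply)
    have "fst (specialize (X.at_deg (Suc 0) (h, 0))) n = h n" for n
    proof -
      have "fst (specialize (X.at_deg (Suc 0) (h, 0))) n = (\<Sum>N\<le>n. if N = Suc 0 then h n else 0)"
        unfolding specialize_def fst_conv by (intro sum.cong) (auto simp: X.at_deg_apply)
      then show ?thesis using that by (cases n) auto
    qed
    then show "fst (specialize (X.at_deg (Suc 0) (h, 0))) = h" by auto
  qed
  define F where "F = X.at_deg 0 v"
  have F: "filtered F" by (auto simp: F_def filtered_def X.at_deg_apply)
  have specF: "specialize F = v"
  proof -
    have "fst (specialize F) n = fst v n" for n
    proof -
      have "fst (specialize F) n = (\<Sum>N\<le>n. if N = 0 then fst v n else 0)"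
        unfolding specialize_def F_def fst_conv by (intro sum.cong) (auto simp: X.at_deg_apply)
      then show ?thesis by simp
    qed
    then show ?thesis by (auto simp: prod_eq_iff fun_eq_iff) (simp add: specialize_def F_def X.at_deg_apply)
  qed
  let ?f = "X.at_deg (Suc 0) (f, 0)" and ?g = "X.at_deg (Suc 0) (g, 0)"
  note Ef = specialize_Exp[OF deg1(1)[of f, OF f]] and Eg = specialize_Exp[OF deg1(1)[of g, OF g]]
  have "ext_Exp (bch f g) v = specialize (X.Exp z F)"
    by (subst specialize_Exp(2)[OF filz z0 F]) (simp add: specz specF)
  also have "X.Exp z F = X.Exp ?f (X.Exp ?g F)"
    unfolding z_def by (rule X.Exp_dyn)
  also have "specialize (X.Exp ?f (X.Exp ?g F)) = ext_Exp f (ext_Exp g v)"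
    by (simp add: Ef Eg F deg1 f g specF)
  finally show ?thesis .
qed

text \<open>The pair \<open>(0, 1)\<close> is the Euler derivation \<open>E\<close>, and \<open>exp (ad u) E = E - logder u\<close>.\<close>

lemma ext_Exp_euler:
  assumes u: "u 0 = 0"
  shows "fst (ext_Exp u (0, 1)) n = - logder u n"
proof -
  note R = raising_sbr[of u, OF u]
  have pow: "(ext_br (u, 0) ^^ Suc k) (0, 1) = (- (sbr u ^^ k) (euler u), 0)" for k
  proof (induction k)
    case (Suc k)
    have "sbr u (- h) = - sbr u h" for h
      using sbr_add_right[of u h "- h"] by (simp add: eq_neg_iff_add_eq_0 add.commute)
    moreover have "(ext_br (u, 0) ^^ Suc (Suc k)) (0, 1) = ext_br (u, 0) ((ext_br (u, 0) ^^ Suc k) (0, 1))"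
      by simp
    ultimately show ?case unfolding Suc ext_br_pair by (simp only: funpow.simps o_apply)
  qed (auto simp: ext_br_def fun_eq_iff euler_def sbr_def)
  have top: "(sbr u ^^ n) (euler u) n = 0"
    using pow_order[OF R, of 1 "euler u" n n] by simp
  have "fst (ext_Exp u (0, 1)) n = (\<Sum>k<n. scale (1 / fact (Suc k)) (fst ((ext_br (u, 0) ^^ Suc k) (0, 1)) n))"
    unfolding ext_Exp_def by (simp add: sum.atMost_shift del: funpow.simps fact_Suc)
  also have "\<dots> = - (\<Sum>k<n. scale (1 / fact (Suc k)) ((sbr u ^^ k) (euler u) n))"
    unfolding pow by (simp add: sum_negf del: fact_Suc)
  also have "(\<Sum>k<n. scale (1 / fact (Suc k)) ((sbr u ^^ k) (euler u) n))
      = (\<Sum>k\<le>n. scale (1 / fact (Suc k)) ((sbr u ^^ k) (euler u) n))"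
    using top by (simp add: lessThan_Suc_atMost[symmetric] del: fact_Suc)
  finally show ?thesis by (simp only: logder_def pser_def exp_quotient_def fps_nth_Abs_fps)
qed

lemma ext_Exp_inj:
  assumes "u 0 = 0" "v 0 = 0" and eq: "\<And>x. ext_Exp u x = ext_Exp v x"
  shows "u = v"
proof (rule logder_inj)
  show "logder u = logder v"
    using ext_Exp_euler[of u, OF assms(1)] ext_Exp_euler[of v, OF assms(2)] eq
    by (metis ext neg_equal_iff_equal)
qed (fact assms)+

lemma bch_0 [simp]: "bch f g 0 = 0"
  by (simp add: bch_def)

text \<open>Composition of operators is associative and the representation is faithful.\<close>

theorem bch_assoc:
  assumes "f 0 = 0" "g 0 = 0" "h 0 = 0"
  shows "bch (bch f g) h = bch f (bch g h)"
  by (rule ext_Exp_inj) (simp_all add: ext_Exp_bch assms)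

lemma bch_linear_part:
  "bch f g n = (if n = 0 then 0 else f n + g n + (\<Sum>N = 2..n. \<Sum>ps\<in>dynkin_indices N.
     scale (dynkin_coeff N ps) (snest (dynkin_word f g ps) n)))"
proof (cases "n = 0")
  case False
  then have "{1..n} = insert 1 {2..n}" by auto
  with False show ?thesis
    by (simp add: bch_def dynkin_indices_1 dynkin_coeff_def dynkin_word_def snest_simps)
qed simp

lemma bch_commuting:
  assumes f: "f 0 = 0" and g: "g 0 = 0" and fg: "sbr f g = 0"
  shows "bch f g = f + g"
proof -
  have gf: "sbr g f = 0" using sbr_antisym[of g f] fg by simp
  have nest0: "snest hs = 0" if "set hs \<subseteq> {f, g}" "2 \<le> length hs" for hs
    using that
  proof (induction hs rule: lie_alg.nest.induct[OF lie_alg_sequences])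
    case (3 a b hs)
    then show ?case
      by (cases hs) (auto simp: snest_simps sbr_self fg gf simp del: zero_fun_apply)
  qed auto
  have "snest (dynkin_word f g ps) = 0" if "ps \<in> dynkin_indices N" "2 \<le> N" for ps N
    using that set_dynkin_word[of f g ps] by (intro nest0) (auto simp: length_dynkin_word)
  then have "bch f g n = (f + g) n" for n
    using f g by (simp add: bch_linear_part)
  then show ?thesis by auto
qed

text \<open>Brackets of at least two series without constant term see only lower components.\<close>

lemma bch_top:
  assumes "f 0 = 0" "g 0 = 0" "f' 0 = 0" "g' 0 = 0" and eq: "\<forall>i<n. f i = f' i" "\<forall>i<n. g i = g' i"
  shows "bch f g n - f n - g n = bch f' g' n - f' n - g' n"
proof -
  have nest: "(\<forall>i<n. snest (map (case_bool f g) bs) i = snest (map (case_bool f' g') bs) i) \<and>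
      (2 \<le> length bs \<longrightarrow> snest (map (case_bool f g) bs) n = snest (map (case_bool f' g') bs) n)" for bs
  proof (induction bs)
    case (Cons b bs)
    show ?case
    proof (cases "bs = []")
      case False
      have 0: "snest (map (case_bool f g) bs) 0 = 0" "snest (map (case_bool f' g') bs) 0 = 0"
        using False assms by (auto intro!: snest_order split: bool.split)
      have b: "case_bool f g b 0 = 0" "case_bool f' g' b 0 = 0" "\<forall>i<n. case_bool f g b i = case_bool f' g' b i"
        using assms by (auto split: bool.split)
      have "sbr (case_bool f g b) (snest (map (case_bool f g) bs)) i
        = sbr (case_bool f' g' b) (snest (map (case_bool f' g') bs)) i" if "i \<le> n" for i
        using Cons b that by (intro sbr_agree_strict 0) auto
      then show ?thesis using False by (simp add: snest_Cons)
    qed (use eq in \<open>auto simp: snest_simps split: bool.split\<close>)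
  qed (simp add: snest_simps)
  have "snest (dynkin_word f g ps) n = snest (dynkin_word f' g' ps) n"
    if "ps \<in> dynkin_indices N" "2 \<le> N" for ps N
    using nest[of "dynkin_word True False ps"] that
    by (simp add: map_dynkin_word length_dynkin_word)
  then have "(\<Sum>N = 2..n. \<Sum>ps\<in>dynkin_indices N. scale (dynkin_coeff N ps) (snest (dynkin_word f g ps) n))
    = (\<Sum>N = 2..n. \<Sum>ps\<in>dynkin_indices N. scale (dynkin_coeff N ps) (snest (dynkin_word f' g' ps) n))"
    by (intro sum.cong) auto
  then show ?thesis using assms by (simp add: bch_linear_part)
qed

end

section \<open>Polynomials: substitution and partial derivatives\<close>

lemma poly_mapping_eq_sum:
  fixes F :: "'a \<Rightarrow>\<^sub>0 'b::comm_monoid_add"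
  shows "F = (\<Sum>m\<in>keys F. single m (lookup F m))"
proof (rule poly_mapping_eqI)
  fix k
  have "lookup (\<Sum>m\<in>keys F. single m (lookup F m)) k
    = (\<Sum>m\<in>keys F. if m = k then lookup F k else 0)"
    unfolding lookup_sum by (rule sum.cong) (auto simp: lookup_single)
  then show "lookup F k
    = lookup (\<Sum>m\<in>keys F. single m (lookup F m)) k"
    by (simp add: in_keys_iff)
qed

lemma poly_mapping_single_induct [case_names single add]:
  fixes F :: "'a \<Rightarrow>\<^sub>0 'b::comm_monoid_add"
  assumes "\<And>m c. P (single m c)" and "\<And>F G. P F \<Longrightarrow> P G \<Longrightarrow> P (F + G)"
  shows "P F"
proof -
  have "P 0" using assms(1)[of undefined 0] by simp
  then have "P (\<Sum>m\<in>A. single m (lookup F m))" for A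
    by (induction A rule: infinite_finite_induct) (auto intro: assms)
  then show ?thesis using poly_mapping_eq_sum[of F] by metis
qed

lemma Const_0 [simp]: "Const 0 = 0" by (simp add: Const_def)
lemma Const_1 [simp]: "Const 1 = 1" by (simp add: Const_def)
lemma Const_add: "Const (a + b) = Const a + Const b" by (simp add: Const_def single_add)
lemma Const_mult: "Const (a * b) = Const a * Const b" by (simp add: Const_def mult_single)
lemma Const_minus: "Const (- a) = - Const a" by (simp add: Const_def single_uminus)
lemma Const_numeral: "Const (numeral n) = numeral n" by (simp add: Const_def)
lemma Const_of_nat: "Const (of_nat n) = of_nat n" by (simp add: Const_def)

lemma Const_mult_single: "Const c * single m d = single m (c * d)"
  by (simp add: Const_def mult_single)

lemma Const_mult_eq_0: "Const c * F = 0 \<Longrightarrow> c \<noteq> 0 \<Longrightarrow> F = 0"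
proof -
  assume "Const c * F = 0" "c \<noteq> 0"
  then have "Const (inverse c * c) * F = 0" unfolding Const_mult mult.assoc by simp
  then show "F = 0" using \<open>c \<noteq> 0\<close> by simp
qed

definition monom_value :: "(nat \<times> 'g \<Rightarrow> ('g, 'k::field_char_0) pol) \<Rightarrow> (nat \<times> 'g \<Rightarrow>\<^sub>0 nat) \<Rightarrow> ('g, 'k) pol" where
  "monom_value s m = (\<Prod>v\<in>keys m. s v ^ lookup m v)"

lemma monom_value_superset:
  "finite A \<Longrightarrow> keys m \<subseteq> A \<Longrightarrow> monom_value s m = (\<Prod>v\<in>A. s v ^ lookup m v)"
  unfolding monom_value_def by (rule prod.mono_neutral_left) (auto simp: in_keys_iff)

lemma monom_value_add: "monom_value s (m + m') = monom_value s m * monom_value s m'"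
proof -
  let ?A = "keys m \<union> keys m'"
  have "monom_value s (m + m') = (\<Prod>v\<in>?A. s v ^ lookup (m + m') v)"
    by (rule monom_value_superset) (use keys_add[of m m'] in auto)
  also have "\<dots> = monom_value s m * monom_value s m'"
    using monom_value_superset[of ?A m s] monom_value_superset[of ?A m' s]
    by (simp add: lookup_add power_add prod.distrib)
  finally show ?thesis .
qed

lemma psubst_add: "psubst s (F + G) = psubst s F + psubst s G"
  unfolding psubst_def
  by (rule setsum_keys_plus_distrib[where f = "\<lambda>m c. Const c * (\<Prod>v\<in>keys m. s v ^ lookup m v)"])
    (auto simp: Const_add algebra_simps)

lemma psubst_0 [simp]: "psubst s 0 = 0" by (simp add: psubst_def)

lemma psubst_single: "psubst s (single m c) = Const c * monom_value s m"
  by (cases "c = 0") (auto simp: psubst_def monom_value_def)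

lemma psubst_mult: "psubst s (F * G) = psubst s F * psubst s G"
proof (induction F rule: poly_mapping_single_induct)
  case (single m c)
  show ?case
    by (induction G rule: poly_mapping_single_induct)
      (auto simp: mult_single psubst_single monom_value_add Const_mult psubst_add algebra_simps)
qed (auto simp: psubst_add algebra_simps)

lemma psubst_Const [simp]: "psubst s (Const c) = Const c"
  using psubst_single[of s 0 c] by (simp add: monom_value_def flip: Const_def)

lemma psubst_1 [simp]: "psubst s 1 = 1"
  using psubst_Const[of s 1] by simp

lemma psubst_Var [simp]: "psubst s (Var v) = s v"
  by (simp add: Var_def psubst_single monom_value_def)

lemma psubst_minus: "psubst s (- F) = - psubst s F"
  using psubst_add[of s F "- F"] by (simp add: eq_neg_iff_add_eq_0 add.commute)

lemma psubst_diff: "psubst s (F - G) = psubst s F - psubst s G"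
  using psubst_add[of s F "- G"] by (simp add: psubst_minus)

lemma psubst_sum: "psubst s (\<Sum>i\<in>A. F i) = (\<Sum>i\<in>A. psubst s (F i))"
  by (rule sum_additive) (auto simp: psubst_add)

lemma Var_power: "Var v ^ n = single (single v n) 1"
  by (induction n) (auto simp: Var_def mult_single simp flip: single_add)

lemma monom_value_Var: "monom_value Var m = single m 1"
proof -
  have "(\<Prod>v\<in>A. Var v ^ lookup m v)
      = single (\<Sum>v\<in>A. single v (lookup m v)) 1" for A
    by (induction A rule: infinite_finite_induct) (auto simp: Var_power mult_single)
  from this[of "keys m"] show ?thesis
    unfolding monom_value_def poly_mapping_eq_sum[of m, symmetric] .
qed

lemma single_eq_Const_Var: "single m c = Const c * (\<Prod>v\<in>keys m. Var v ^ lookup m v)"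
  by (simp add: Const_mult_single monom_value_Var flip: monom_value_def)

lemma pol_induct [case_names Const Var add mult]:
  fixes P :: "('g, 'k::field_char_0) pol \<Rightarrow> bool"
  assumes C: "\<And>c. P (Const c)" and V: "\<And>v. P (Var v)"
    and A: "\<And>F G. P F \<Longrightarrow> P G \<Longrightarrow> P (F + G)" and M: "\<And>F G. P F \<Longrightarrow> P G \<Longrightarrow> P (F * G)"
  shows "P F"
proof (induction F rule: poly_mapping_single_induct)
  case (single m c)
  have 1: "P 1" using C[of 1] by simp
  then have "P (Var v ^ n)" for v n by (induction n) (auto intro: V M)
  then have "P (\<Prod>v\<in>A. Var v ^ lookup m v)" for A
    by (induction A rule: infinite_finite_induct) (auto intro: 1 M)
  then show ?case unfolding single_eq_Const_Var by (intro M C)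
qed (rule A)

lemma psubst_psubst: "psubst s (psubst t F) = psubst (\<lambda>v. psubst s (t v)) F"
  by (induction F rule: pol_induct) (auto simp: psubst_add psubst_mult)

lemma psubst_Var_id [simp]: "psubst Var F = F"
  by (induction F rule: pol_induct) (auto simp: psubst_add psubst_mult)

lemma psubst_cong: "(\<And>v. v \<in> vars F \<Longrightarrow> s v = t v) \<Longrightarrow> psubst s F = psubst t F"
  unfolding psubst_def
  by (intro sum.cong refl arg_cong2[where f = times] prod.cong arg_cong2[where f = power]) (auto simp: vars_def)

lemma pdiff_add: "pdiff v (F + G) = pdiff v F + pdiff v G"
  unfolding pdiff_def
  by (rule setsum_keys_plus_distrib[where f = "\<lambda>m c. single (m - single v 1) (of_nat (lookup m v) * c)"])
    (auto simp: algebra_simps single_add)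

lemma pdiff_0 [simp]: "pdiff v 0 = 0" by (simp add: pdiff_def)

lemma pdiff_single:
  "pdiff v (single m c) = single (m - single v 1) (of_nat (lookup m v) * c)"
  by (cases "c = 0") (auto simp: pdiff_def)

lemma monom_split: "lookup m v \<noteq> 0 \<Longrightarrow> m = (m - single v 1) + single v (1 :: nat)"
  by (rule poly_mapping_eqI) (auto simp: lookup_add lookup_minus lookup_single when_def)

lemma Var_mult_pdiff_single: "Var v * pdiff v (single m a) = single m (of_nat (lookup m v) * a)"
proof (cases "lookup m v = 0")
  case False
  then have "single v 1 + (m - single v 1) = m" using monom_split[of m v] by (simp add: add.commute)
  then show ?thesis by (simp add: pdiff_single Var_def mult_single)
qed (simp add: pdiff_single)

lemma pdiff_mult: "pdiff v (F * G) = pdiff v F * G + F * pdiff v G"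
proof (induction F rule: poly_mapping_single_induct)
  case (single m c)
  show ?case
  proof (induction G rule: poly_mapping_single_induct)
    case (single m' c')
    have 1: "m + m' - single v 1 = (m - single v 1) + m'" if "lookup m v > 0"
      by (rule poly_mapping_eqI) (use that in \<open>auto simp: lookup_add lookup_minus lookup_single when_def\<close>)
    have 2: "m + m' - single v 1 = m + (m' - single v 1)" if "lookup m' v > 0"
      by (rule poly_mapping_eqI) (use that in \<open>auto simp: lookup_add lookup_minus lookup_single when_def\<close>)
    have "single (m + m' - single v 1) (of_nat (lookup m v) * c * c')
      = single ((m - single v 1) + m') (of_nat (lookup m v) * c * c')"
      using 1 by (cases "lookup m v = 0") auto
    moreover have "single (m + m' - single v 1) (of_nat (lookup m' v) * c * c')
      = single (m + (m' - single v 1)) (of_nat (lookup m' v) * c * c')"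
      using 2 by (cases "lookup m' v = 0") auto
    ultimately show ?case
      by (simp add: mult_single pdiff_single lookup_add algebra_simps single_add)
  qed (auto simp: pdiff_add algebra_simps)
qed (auto simp: pdiff_add algebra_simps)

lemma pdiff_Const [simp]: "pdiff v (Const c) = 0"
  by (simp add: Const_def pdiff_single)

lemma pdiff_1 [simp]: "pdiff v 1 = 0"
  using pdiff_Const[of v 1] by simp

lemma pdiff_Var: "pdiff v (Var w) = (if v = w then 1 else 0)"
  by (auto simp: Var_def pdiff_single lookup_single when_def)

lemma pdiff_minus: "pdiff v (- F) = - pdiff v F"
  using pdiff_add[of v F "- F"] by (simp add: eq_neg_iff_add_eq_0 add.commute)

lemma pdiff_diff: "pdiff v (F - G) = pdiff v F - pdiff v G"
  using pdiff_add[of v F "- G"] by (simp add: pdiff_minus)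

lemma pdiff_sum: "pdiff v (\<Sum>i\<in>A. F i) = (\<Sum>i\<in>A. pdiff v (F i))"
  by (rule sum_additive) (auto simp: pdiff_add)

lemma pdiff_Const_mult: "pdiff v (Const c * F) = Const c * pdiff v F"
  by (simp add: pdiff_mult)

lemma pdiff_commute: "pdiff v (pdiff w F) = pdiff w (pdiff v F)"
  by (induction F rule: pol_induct) (auto simp: pdiff_add pdiff_mult pdiff_Var algebra_simps)

lemma pdiff_not_vars: "v \<notin> vars F \<Longrightarrow> pdiff v F = 0"
  unfolding pdiff_def vars_def by (rule sum.neutral) (auto simp: in_keys_iff)

lemma finite_vars [simp]: "finite (vars F)" by (simp add: vars_def)

lemma vars_add: "vars (F + G) \<subseteq> vars F \<union> vars G"
  using keys_add[of F G] by (auto simp: vars_def)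

lemma vars_mult: "vars (F * G) \<subseteq> vars F \<union> vars G"
proof -
  have "keys m \<subseteq> vars F \<union> vars G" if "m \<in> keys (F * G)" for m
  proof -
    obtain a b where "m = a + b" "a \<in> keys F" "b \<in> keys G"
      using keys_mult[of F G] \<open>m \<in> _\<close> by auto
    then show ?thesis using keys_add[of a b] by (auto simp: vars_def)
  qed
  then show ?thesis by (auto simp: vars_def[of "F * G"])
qed

section \<open>Homogeneous polynomials\<close>

lemma mdeg_add: "mdeg (m + m') = mdeg m + mdeg m'"
  unfolding mdeg_def by (rule setsum_keys_plus_distrib[where f = "\<lambda>v c. c"]) auto

lemma mdeg_single [simp]: "mdeg (single v n) = n"
  by (simp add: mdeg_def)

lemma mdeg_0 [simp]: "mdeg 0 = 0"
  by (simp add: mdeg_def)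

definition homog :: "(nat \<times> 'g) set \<Rightarrow> nat \<Rightarrow> ('g, 'k::field_char_0) pol \<Rightarrow> bool" where
  "homog V n F \<longleftrightarrow> (\<forall>m\<in>keys F. mdeg m = n \<and> keys m \<subseteq> V)"

lemma homog_0 [simp]: "homog V n 0" by (simp add: homog_def)

lemma homog_add: "homog V n F \<Longrightarrow> homog V n G \<Longrightarrow> homog V n (F + G)"
  using keys_add[of F G] by (auto simp: homog_def)

lemma homog_minus: "homog V n F \<Longrightarrow> homog V n (- F)"
  by (simp add: homog_def)

lemma homog_diff: "homog V n F \<Longrightarrow> homog V n G \<Longrightarrow> homog V n (F - G)"
  using homog_add[of V n F "- G"] by (simp add: homog_minus)

lemma homog_sum: "(\<And>i. i \<in> A \<Longrightarrow> homog V n (F i)) \<Longrightarrow> homog V n (\<Sum>i\<in>A. F i)"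
  by (induction A rule: infinite_finite_induct) (auto intro: homog_add)

lemma homog_mult: "homog V n F \<Longrightarrow> homog V n' G \<Longrightarrow> homog V (n + n') (F * G)"
  unfolding homog_def
proof
  fix m assume FG: "\<forall>m\<in>keys F. mdeg m = n \<and> keys m \<subseteq> V"
    "\<forall>m\<in>keys G. mdeg m = n' \<and> keys m \<subseteq> V" and "m \<in> keys (F * G)"
  then obtain a b where "m = a + b" "a \<in> keys F" "b \<in> keys G"
    using keys_mult[of F G] by auto
  then show "mdeg m = n + n' \<and> keys m \<subseteq> V"
    using FG keys_add[of a b] by (simp add: mdeg_add) blast
qed

lemma homog_Const: "homog V 0 (Const c)"
  by (auto simp: homog_def Const_def)

lemma homog_1: "homog V 0 1"
  using homog_Const[of V 1] by simp

lemma homog_Var: "v \<in> V \<Longrightarrow> homog V (Suc 0) (Var v)"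
  by (auto simp: homog_def Var_def)

lemma homog_Const_mult: "homog V n F \<Longrightarrow> homog V n (Const c * F)"
  using homog_mult[OF homog_Const] by fastforce

lemma homog_mono: "homog V n F \<Longrightarrow> V \<subseteq> W \<Longrightarrow> homog W n F"
  by (auto simp: homog_def)

lemma homog_power: "homog V n F \<Longrightarrow> homog V (k * n) (F ^ k)"
  by (induction k) (auto intro: homog_mult homog_1)

lemma homog_prod: "(\<And>i. i \<in> A \<Longrightarrow> homog V (d i) (F i)) \<Longrightarrow> homog V (\<Sum>i\<in>A. d i) (\<Prod>i\<in>A. F i)"
  by (induction A rule: infinite_finite_induct) (auto intro: homog_mult homog_1)

lemma homog_vars: "homog V n F \<Longrightarrow> vars F \<subseteq> V"
  by (auto simp: homog_def vars_def)

lemma homog_psubst: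
  assumes F: "homog V n F" and s: "\<And>v. v \<in> V \<Longrightarrow> homog W 1 (s v)"
  shows "homog W n (psubst s F)"
  unfolding psubst_def
proof (intro homog_sum homog_Const_mult)
  fix m assume "m \<in> keys F"
  then have m: "mdeg m = n" "keys m \<subseteq> V" using F by (auto simp: homog_def)
  have "homog W (\<Sum>v\<in>keys m. lookup m v * 1) (\<Prod>v\<in>keys m. s v ^ lookup m v)"
    using m s by (intro homog_prod homog_power) auto
  then show "homog W n (\<Prod>v\<in>keys m. s v ^ lookup m v)"
    using m by (simp add: mdeg_def)
qed

lemma homog_pdiff: "homog V n F \<Longrightarrow> homog V (n - 1) (pdiff v F)"
  unfolding pdiff_def
proof (intro homog_sum)
  fix m assume F: "homog V n F" "m \<in> keys F"
  show "homog V (n - 1) (single (m - single v 1) (of_nat (lookup m v) * lookup F m))"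
  proof (cases "lookup m v = 0")
    case False
    then have "m = (m - single v 1) + single v 1" by (rule monom_split)
    then have "mdeg m = mdeg (m - single v 1) + 1" by (metis mdeg_add mdeg_single)
    moreover have "keys (m - single v 1) \<subseteq> keys m"
      by (auto simp: in_keys_iff lookup_minus)
    ultimately show ?thesis using F by (fastforce simp: homog_def)
  qed simp
qed

lemma homog_0_Const: "homog V 0 F \<Longrightarrow> F = Const (lookup F 0)"
proof (rule poly_mapping_eqI)
  fix m assume F: "homog V 0 F"
  have "m = 0" if "m \<in> keys F"
  proof (rule poly_mapping_eqI)
    fix v
    have "(\<Sum>v\<in>keys m. lookup m v) = 0"
      using F that by (auto simp: homog_def mdeg_def)
    then show "lookup m v = lookup 0 v"
      by (metis finite_keys in_keys_iff lookup_zero sum_eq_0_iff)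
  qed
  then show "lookup F m = lookup (Const (lookup F 0)) m"
    by (cases "m = 0") (auto simp: Const_def lookup_single in_keys_iff)
qed

text \<open>Euler's identity.\<close>

lemma euler_identity:
  assumes F: "homog V n F" and V: "finite V"
  shows "(\<Sum>v\<in>V. Var v * pdiff v F) = of_nat n * F"
proof -
  have single: "(\<Sum>v\<in>V. Var v * pdiff v (single m c)) = of_nat (mdeg m) * single m c"
    if m: "keys m \<subseteq> V" for m and c :: 'b
  proof -
    have "(\<Sum>v\<in>V. Var v * pdiff v (single m c)) = (\<Sum>v\<in>V. of_nat (lookup m v) * single m c)"
      by (simp add: Var_mult_pdiff_single mult_single flip: single_of_nat)
    also have "\<dots> = of_nat (\<Sum>v\<in>V. lookup m v) * single m c"
      by (simp add: sum_distrib_right)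
    also have "(\<Sum>v\<in>V. lookup m v) = mdeg m"
      unfolding mdeg_def by (rule sum.mono_neutral_right) (use m V in \<open>auto simp: in_keys_iff\<close>)
    finally show ?thesis .
  qed
  have "(\<Sum>v\<in>V. Var v * pdiff v F)
      = (\<Sum>v\<in>V. Var v * pdiff v (\<Sum>m\<in>keys F. single m (lookup F m)))"
    by (simp flip: poly_mapping_eq_sum)
  also have "\<dots> = (\<Sum>m\<in>keys F. \<Sum>v\<in>V. Var v * pdiff v (single m (lookup F m)))"
    unfolding pdiff_sum sum_distrib_left by (rule sum.swap)
  also have "\<dots> = (\<Sum>m\<in>keys F. of_nat n * single m (lookup F m))"
    using F by (intro sum.cong refl) (auto simp: single homog_def)
  also have "\<dots> = of_nat n * F"
    by (simp flip: poly_mapping_eq_sum sum_distrib_left)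
  finally show ?thesis .
qed

section \<open>Coproduct insertions\<close>

text \<open>The map \<open>ins\<close> on polynomials, with the superscripts indexed by all natural numbers, so that the
  laws below hold without conditions on the variables that occur.\<close>

definition isub :: "(nat \<Rightarrow> nat set) \<Rightarrow> ('g, 'k::field_char_0) pol \<Rightarrow> ('g, 'k) pol" where
  "isub S = psubst (\<lambda>(i, b). \<Sum>a\<in>S i. Var (a, b))"

lemma isub_Var: "isub S (Var (i, b)) = (\<Sum>a\<in>S i. Var (a, b))"
  by (simp add: isub_def)

lemmas isub_hom = psubst_add[of "\<lambda>(i, b). \<Sum>a\<in>S i. Var (a, b)" for S, folded isub_def]
  psubst_mult[of "\<lambda>(i, b). \<Sum>a\<in>S i. Var (a, b)" for S, folded isub_def]
  psubst_minus[of "\<lambda>(i, b). \<Sum>a\<in>S i. Var (a, b)" for S, folded isub_def]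
  psubst_diff[of "\<lambda>(i, b). \<Sum>a\<in>S i. Var (a, b)" for S, folded isub_def]
  psubst_sum[of "\<lambda>(i, b). \<Sum>a\<in>S i. Var (a, b)" for S, folded isub_def]

lemma isub_0 [simp]: "isub S 0 = 0" and isub_1 [simp]: "isub S 1 = 1"
  and isub_Const [simp]: "isub S (Const c) = Const c"
  by (simp_all add: isub_def)

definition disjoint_sets :: "(nat \<Rightarrow> nat set) \<Rightarrow> bool" where
  "disjoint_sets S \<longleftrightarrow> (\<forall>i. finite (S i)) \<and> (\<forall>i j. i \<noteq> j \<longrightarrow> S i \<inter> S j = {})"

lemma isub_isub:
  assumes "disjoint_sets S" "disjoint_sets T"
  shows "isub S (isub T F) = isub (\<lambda>i. \<Union>a\<in>T i. S a) F"
proof -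
  have "(\<Sum>a\<in>T i. \<Sum>a'\<in>S a. Var (a', b)) = (\<Sum>a'\<in>(\<Union>a\<in>T i. S a). Var (a', b) :: ('a, 'b) pol)" for i b
    using assms by (subst sum.UNION_disjoint) (auto simp: disjoint_sets_def)
  then show ?thesis
    unfolding isub_def psubst_psubst by (intro psubst_cong) (auto simp: psubst_sum split: prod.splits)
qed

lemma pdiff_isub:
  assumes "disjoint_sets S" "a \<in> S i"
  shows "pdiff (a, b) (isub S F) = isub S (pdiff (i, b) F)"
proof (induction F rule: pol_induct)
  case (Var v)
  obtain j c where v: "v = (j, c)" by (cases v)
  have "pdiff (a, b) (isub S (Var v)) = (\<Sum>a'\<in>S j. if a' = a then (if b = c then 1 else 0) else 0)"
    unfolding v isub_Var pdiff_sum by (intro sum.cong) (auto simp: pdiff_Var)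
  also have "\<dots> = (if a \<in> S j \<and> b = c then 1 else 0)"
    using assms by (auto simp: disjoint_sets_def)
  also have "\<dots> = isub S (pdiff (i, b) (Var v))"
    using assms by (auto simp: v pdiff_Var disjoint_sets_def)
  finally show ?case .
qed (auto simp: pdiff_add pdiff_mult isub_hom)

lemma pdiff_isub_0:
  assumes "\<And>i. a \<notin> S i"
  shows "pdiff (a, b) (isub S F) = 0"
proof (induction F rule: pol_induct)
  case (Var v)
  obtain j c where v: "v = (j, c)" by (cases v)
  show ?case unfolding v isub_Var pdiff_sum using assms by (intro sum.neutral) (auto simp: pdiff_Var)
qed (auto simp: pdiff_add pdiff_mult isub_hom)

lemma homog_isub:
  assumes "homog (K \<times> B) n F" "\<And>i. i \<in> K \<Longrightarrow> S i \<subseteq> L"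
  shows "homog (L \<times> B) n (isub S F)"
  unfolding isub_def using assms(1)
  by (rule homog_psubst) (use assms(2) in \<open>auto intro!: homog_sum homog_Var\<close>)

lemma isub_id: "vars F \<subseteq> K \<times> UNIV \<Longrightarrow> (\<And>i. i \<in> K \<Longrightarrow> S i = {i}) \<Longrightarrow> isub S F = F"
  unfolding isub_def by (subst psubst_cong[of F _ Var]) auto

section \<open>The linear Poisson bracket\<close>

context lie_algebra_basis
begin

lemma br_add_l: "br (x + y) z = br x z + br y z"
  using br_linear_left[of z] by (simp add: Vector_Spaces.linear_iff)

lemma br_add_r: "br x (y + z) = br x y + br x z"
  using br_linear_right[of x] by (simp add: Vector_Spaces.linear_iff)

lemma br_scale_l: "br (scale c x) z = scale c (br x z)"
  using br_linear_left[of z] by (simp add: Vector_Spaces.linear_iff)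

lemma br_scale_r: "br x (scale c z) = scale c (br x z)"
  using br_linear_right[of x] by (simp add: Vector_Spaces.linear_iff)

lemma lie_alg_g: "lie_alg scale br"
proof unfold_locales
qed (rule br_add_l br_add_r br_scale_l br_scale_r br_alternating br_jacobi)+

lemma lin_superset:
  assumes "finite A" "{b. representation B x b \<noteq> 0} \<subseteq> A"
  shows "lin a x = (\<Sum>b\<in>A. Const (representation B x b) * Var (a, b))"
  unfolding lin_def by (rule sum.mono_neutral_left) (use assms in auto)

lemma lin_add: "lin a (x + y) = lin a x + lin a y"
proof -
  let ?A = "{b. representation B x b \<noteq> 0} \<union> {b. representation B y b \<noteq> 0}"
  have "representation B (x + y) = (\<lambda>b. representation B x b + representation B y b)"
    by (rule representation_add[OF basis_independent]) (auto simp: basis_span)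
  then have rep: "representation B (x + y) b = representation B x b + representation B y b" for b
    by (simp only:)
  have "lin a (x + y) = (\<Sum>b\<in>?A. Const (representation B (x + y) b) * Var (a, b))"
    by (rule lin_superset) (auto simp: finite_representation rep)
  also have "\<dots> = (\<Sum>b\<in>?A. Const (representation B x b) * Var (a, b)) + (\<Sum>b\<in>?A. Const (representation B y b) * Var (a, b))"
    by (simp add: rep Const_add algebra_simps sum.distrib)
  also have "\<dots> = lin a x + lin a y"
    by (intro arg_cong2[where f = plus] lin_superset[symmetric]) (auto simp: finite_representation)
  finally show ?thesis .
qed

lemma lin_scale: "lin a (scale c x) = Const c * lin a x"
proof -
  have rep: "representation B (scale c x) b = c * representation B x b" for b
    using representation_scale[OF basis_independent, of x c] basis_span by simp
  have "lin a (scale c x) = (\<Sum>b | representation B x b \<noteq> 0. Const (representation B (scale c x) b) * Var (a, b))"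
    by (rule lin_superset) (auto simp: finite_representation rep)
  then show ?thesis by (simp add: rep lin_def Const_mult sum_distrib_left mult.assoc)
qed

lemma lin_0 [simp]: "lin a 0 = 0"
  using lin_add[of a 0 0] by simp

lemma lin_minus: "lin a (- x) = - lin a x"
  using lin_add[of a x "- x"] by (simp add: eq_neg_iff_add_eq_0 add.commute)

lemma lin_basis: "b \<in> B \<Longrightarrow> lin a b = Var (a, b)"
  by (simp add: lin_def representation_basis[OF basis_independent])

lemma representation_support_B: "representation B x b \<noteq> 0 \<Longrightarrow> b \<in> B"
  by (rule representation_ne_zero)

lemma sum_representation: "(\<Sum>b | representation B x b \<noteq> 0. scale (representation B x b) b) = x"
  using sum_nonzero_representation_eq[OF basis_independent, of x] basis_span by simp

lemma lin_cong_linear: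
  assumes "\<And>x y. h (x + y) = h x + h y" "\<And>c x. h (scale c x) = Const c * h x"
  shows "h x = (\<Sum>b | representation B x b \<noteq> 0. Const (representation B x b) * h b)"
proof -
  have "h 0 = 0" using assms(1)[of 0 0] by simp
  then have "h (\<Sum>b | representation B x b \<noteq> 0. scale (representation B x b) b)
    = (\<Sum>b | representation B x b \<noteq> 0. h (scale (representation B x b) b))"
    using assms by (intro sum_additive) auto
  then show ?thesis by (simp add: sum_representation assms)
qed

lemma homog_lin: "homog ({a} \<times> B) (Suc 0) (lin a x)"
  unfolding lin_def by (intro homog_sum homog_Const_mult homog_Var) (auto intro: representation_support_B)

text \<open>The Poisson bracket of two variables.\<close>

definition structure_fun :: "nat \<times> 'g \<Rightarrow> nat \<times> 'g \<Rightarrow> ('g, 'k) pol" where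
  "structure_fun u v = (if fst u = fst v then lin (fst u) (br (snd u) (snd v)) else 0)"

lemma pol_bracket_superset:
  assumes "finite V" "vars F \<subseteq> V" "finite W" "vars G \<subseteq> W"
  shows "pol_bracket F G = (\<Sum>u\<in>V. \<Sum>v\<in>W. structure_fun u v * pdiff u F * pdiff v G)"
proof -
  have "pol_bracket F G = (\<Sum>u\<in>vars F. \<Sum>v\<in>vars G. structure_fun u v * pdiff u F * pdiff v G)"
    unfolding pol_bracket_def by (auto intro!: sum.cong simp: structure_fun_def)
  also have "\<dots> = (\<Sum>u\<in>vars F. \<Sum>v\<in>W. structure_fun u v * pdiff u F * pdiff v G)"
    using assms by (intro sum.cong refl sum.mono_neutral_left) (auto simp: pdiff_not_vars)
  also have "\<dots> = (\<Sum>u\<in>V. \<Sum>v\<in>W. structure_fun u v * pdiff u F * pdiff v G)"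
    using assms by (intro sum.mono_neutral_left) (auto simp: pdiff_not_vars intro!: sum.neutral)
  finally show ?thesis .
qed

lemma structure_fun_antisym: "structure_fun u v = - structure_fun v u"
  using lie_alg.br_antisym[OF lie_alg_g, of "snd u" "snd v"] by (auto simp: structure_fun_def lin_minus)

lemma pol_bracket_antisym: "pol_bracket F G = - pol_bracket G F"
proof -
  have "pol_bracket F G = (\<Sum>u\<in>vars F. \<Sum>v\<in>vars G. structure_fun u v * pdiff u F * pdiff v G)"
    by (rule pol_bracket_superset) auto
  also have "\<dots> = (\<Sum>v\<in>vars G. \<Sum>u\<in>vars F. - (structure_fun v u * pdiff v G * pdiff u F))"
  proof (subst sum.swap, intro sum.cong refl)
    fix u v
    show "structure_fun u v * pdiff u F * pdiff v G = - (structure_fun v u * pdiff v G * pdiff u F)"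
      using structure_fun_antisym[of u v] by (simp add: mult_ac)
  qed
  also have "\<dots> = - pol_bracket G F"
    by (subst pol_bracket_superset[of "vars G" G "vars F" F]) (auto simp: sum_negf)
  finally show ?thesis .
qed

lemma pol_bracket_add_right: "pol_bracket F (G + H) = pol_bracket F G + pol_bracket F H"
  using vars_add[of G H]
  by (simp add: pol_bracket_superset[of "vars F" F "vars G \<union> vars H"] pdiff_add algebra_simps sum.distrib)

lemma pol_bracket_mult_right: "pol_bracket F (G * H) = pol_bracket F G * H + G * pol_bracket F H"
  using vars_mult[of G H]
  by (simp add: pol_bracket_superset[of "vars F" F "vars G \<union> vars H"] pdiff_mult algebra_simps sum.distrib
      sum_distrib_left sum_distrib_right)

lemma pol_bracket_add_left: "pol_bracket (F + G) H = pol_bracket F H + pol_bracket G H"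
  using pol_bracket_add_right[of H F G] by (simp add: pol_bracket_antisym[of _ H])

lemma pol_bracket_mult_left: "pol_bracket (F * G) H = pol_bracket F H * G + F * pol_bracket G H"
  using pol_bracket_mult_right[of H F G] by (simp add: pol_bracket_antisym[of _ H])

lemma vars_Const [simp]: "vars (Const c) = {}"
  by (auto simp: vars_def Const_def split: if_splits)

lemma vars_Var: "vars (Var v) = {v}"
  by (auto simp: vars_def Var_def)

lemma pol_bracket_Const_right [simp]: "pol_bracket F (Const c) = 0"
  by (simp add: pol_bracket_def)

lemma pol_bracket_Const_left [simp]: "pol_bracket (Const c) F = 0"
  by (simp add: pol_bracket_def)

lemma pol_bracket_0 [simp]: "pol_bracket F 0 = 0" "pol_bracket 0 F = 0"
  using pol_bracket_Const_right[of F 0] pol_bracket_Const_left[of 0 F] by simp_all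

lemma pol_bracket_minus: "pol_bracket F (- G) = - pol_bracket F G" "pol_bracket (- F) G = - pol_bracket F G"
  using pol_bracket_add_right[of F G "- G"] pol_bracket_add_left[of F "- F" G]
  by (simp_all add: eq_neg_iff_add_eq_0 add.commute)

lemma pol_bracket_diff: "pol_bracket F (G - H) = pol_bracket F G - pol_bracket F H"
  "pol_bracket (F - G) H = pol_bracket F H - pol_bracket G H"
  using pol_bracket_add_right[of F G "- H"] pol_bracket_add_left[of F "- G" H] by (simp_all add: pol_bracket_minus)

lemma pol_bracket_sum_right: "pol_bracket F (\<Sum>i\<in>A. G i) = (\<Sum>i\<in>A. pol_bracket F (G i))"
  by (rule sum_additive) (auto simp: pol_bracket_add_right)

lemma pol_bracket_sum_left: "pol_bracket (\<Sum>i\<in>A. G i) F = (\<Sum>i\<in>A. pol_bracket (G i) F)"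
  by (rule sum_additive[where h = "\<lambda>x. pol_bracket x F"]) (auto simp: pol_bracket_add_left)

lemma pol_bracket_scale: "pol_bracket F (Const c * G) = Const c * pol_bracket F G"
  "pol_bracket (Const c * F) G = Const c * pol_bracket F G"
  by (simp_all add: pol_bracket_mult_right pol_bracket_mult_left)

lemma pol_bracket_Var: "pol_bracket (Var u) (Var v) = structure_fun u v"
  by (subst pol_bracket_superset[of "{u}" _ "{v}"]) (auto simp: vars_Var pdiff_Var)

lemma pol_bracket_Var_lin: "pol_bracket (Var (a, b)) (lin a' x) = (if a = a' then lin a (br b x) else 0)"
proof -
  have "pol_bracket (Var (a, b)) (lin a' x)
    = (\<Sum>c | representation B x c \<noteq> 0. Const (representation B x c) * (if a = a' then lin a (br b c) else 0))"
    by (simp add: lin_def[of a'] pol_bracket_sum_right pol_bracket_scale pol_bracket_Var structure_fun_def cong: if_cong)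
  moreover have "lin a (br b x) = (\<Sum>c | representation B x c \<noteq> 0. Const (representation B x c) * lin a (br b c))"
    by (rule lin_cong_linear) (auto simp: br_add_r br_scale_r lin_add lin_scale)
  ultimately show ?thesis by (cases "a = a'") simp_all
qed

text \<open>The Jacobiator is a derivation in its last argument and invariant under cyclic permutations, hence
  determined by its values on variables.\<close>

lemma pol_bracket_jacobi:
  "pol_bracket F (pol_bracket G H) + pol_bracket G (pol_bracket H F) + pol_bracket H (pol_bracket F G) = 0"
proof -
  define J where "J F G H = pol_bracket F (pol_bracket G H) + pol_bracket G (pol_bracket H F)
    + pol_bracket H (pol_bracket F G)" for F G H
  have cyc: "J F G H = J G H F" for F G H by (simp add: J_def algebra_simps)
  have add: "J F G (H + H') = J F G H + J F G H'" for F G H H'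
    by (simp add: J_def pol_bracket_add_left pol_bracket_add_right algebra_simps)
  have mult: "J F G (H * H') = J F G H * H' + H * J F G H'" for F G H H'
  proof -
    have a: "pol_bracket H F = - pol_bracket F H" "pol_bracket H' F = - pol_bracket F H'"
      "pol_bracket H (pol_bracket F G) = - pol_bracket (pol_bracket F G) H"
      "pol_bracket H' (pol_bracket F G) = - pol_bracket (pol_bracket F G) H'"
      by (rule pol_bracket_antisym)+
    show ?thesis unfolding J_def
      by (simp add: pol_bracket_mult_left pol_bracket_mult_right pol_bracket_add_right pol_bracket_add_left
          pol_bracket_diff a pol_bracket_minus algebra_simps)
  qed
  have C: "J F G (Const c) = 0" for F G c by (simp add: J_def)
  have V: "J (Var u) (Var v) (Var w) = 0" for u v w
  proof -
    obtain a x b y c z where uvw: "u = (a, x)" "v = (b, y)" "w = (c, z)" by (cases u, cases v, cases w)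
    show ?thesis
      using br_jacobi[of x y z] unfolding uvw J_def pol_bracket_Var structure_fun_def
      by (auto simp: pol_bracket_Var_lin simp flip: lin_add)
  qed
  have 1: "J (Var u) (Var v) H = 0" for u v H
    by (induction H rule: pol_induct) (auto simp: add mult C V)
  have 2: "J H (Var u) G = 0" for u G H
    by (induction G rule: pol_induct) (simp_all only: add mult C mult_zero_left mult_zero_right add_0, simp only: cyc[of H] 1)
  have "J G H F = 0"
    by (induction F rule: pol_induct) (simp_all only: add mult C mult_zero_left mult_zero_right add_0, simp only: cyc[of G] 2)
  then show ?thesis by (simp add: J_def algebra_simps)
qed

end

section \<open>The star product of formal functions\<close>

lemma sum_atMost_Suc_drop_ends:
  fixes F :: "nat \<Rightarrow> 'a::comm_monoid_add"
  assumes "F 0 = 0" "F (Suc (Suc n)) = 0"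
  shows "(\<Sum>i\<le>Suc (Suc n). F i) = (\<Sum>i\<le>n. F (Suc i))"
  using assms by (subst sum.atMost_Suc_shift) simp

lemma dynkin_indices_2:
  "dynkin_indices 2 = {[(1, 1)], [(2, 0)], [(0, 2)], [(1, 0), (1, 0)], [(1, 0), (0, 1)], [(0, 1), (1, 0)], [(0, 1), (0, 1)]}"
    (is "_ = ?R")
proof
  show "dynkin_indices 2 \<subseteq> ?R"
  proof
    fix ps assume ps: "ps \<in> dynkin_indices 2"
    have "length ps \<le> 2" by (rule length_dynkin_indices[OF ps])
    then consider "ps = []" | p where "ps = [p]" | p q where "ps = [p, q]"
      by (cases ps; cases "tl ps"; auto)
    then show "ps \<in> ?R"
    proof cases
      case (2 p)
      obtain r s where "p = (r, s)" by (cases p)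
      with 2 ps have "r + s = 2" by (simp add: dynkin_indices_def)
      then have "r = 0 \<and> s = 2 \<or> r = 1 \<and> s = 1 \<or> r = 2 \<and> s = 0" by arith
      then show ?thesis using 2 \<open>p = _\<close> by auto
    next
      case (3 p q)
      obtain r s r' s' where pq: "p = (r, s)" "q = (r', s')" by (cases p, cases q)
      have "r + s \<noteq> 0" "r' + s' \<noteq> 0" "r + s + (r' + s') = 2"
        using 3 ps by (auto simp: dynkin_indices_def pq)
      then have "r + s = 1" "r' + s' = 1" by arith+
      then have "(r = 0 \<and> s = 1 \<or> r = 1 \<and> s = 0) \<and> (r' = 0 \<and> s' = 1 \<or> r' = 1 \<and> s' = 0)" by arith
      then show ?thesis using 3 pq by auto
    qed (use ps in \<open>simp add: dynkin_indices_def\<close>)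
  qed
qed (auto simp: dynkin_indices_def)

lemma (in lie_alg) bch_degree_2:
  assumes "f 0 = 0" "g 0 = 0"
  shows "bch f g 2 = f 2 + g 2 + scale (1 / 2) (br (f 1) (g 1))"
proof -
  have s: "sbr a b 2 = br (a 1) (b 1)" if "a 0 = 0" "b 0 = 0" for a b
    using that by (simp add: sbr_def numeral_2_eq_2)
  have two: "replicate 2 x = [x, x]" for x :: 'x by (simp add: numeral_2_eq_2)
  have h: "scale (1 / 2) x - scale (1 / 4) x + scale (1 / 4) x = scale (1 / 2) x" for x by simp
  have "bch f g 2 = f 2 + g 2 + (\<Sum>ps\<in>dynkin_indices 2. scale (dynkin_coeff 2 ps) (snest (dynkin_word f g ps) 2))"
    by (simp add: bch_linear_part)
  also have "(\<Sum>ps\<in>dynkin_indices 2. scale (dynkin_coeff 2 ps) (snest (dynkin_word f g ps) 2))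
    = scale (1 / 2) (br (f 1) (g 1)) + scale (- 1 / 4) (br (f 1) (g 1)) + scale (- 1 / 4) (br (g 1) (f 1))"
    unfolding dynkin_indices_2
    by (simp add: dynkin_coeff_def dynkin_word_def snest_simps s assms br_self two)
  also have "\<dots> = scale (1 / 2) (br (f 1) (g 1))"
    using br_antisym[of "g 1" "f 1"] by simp
  finally show ?thesis .
qed

context lie_algebra_basis
begin

lemma pol_bracket_self: "pol_bracket F F = 0"
proof -
  have "Const 2 * pol_bracket F F = pol_bracket F F + pol_bracket F F"
    by (simp add: Const_numeral)
  also have "\<dots> = 0" using pol_bracket_antisym[of F F] by (simp only: eq_neg_iff_add_eq_0)
  finally show ?thesis by (rule Const_mult_eq_0) simp
qed

lemma lie_alg_pol: "lie_alg (\<lambda>c F. Const c * F) pol_bracket"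
proof unfold_locales
qed (simp_all add: Const_add Const_mult distrib_left distrib_right mult.assoc pol_bracket_add_left
    pol_bracket_add_right pol_bracket_scale pol_bracket_self pol_bracket_jacobi)

text \<open>Lowering the degree by one turns the Poisson bracket, which has degree \<open>-1\<close>, into the bracket of
  power series with coefficients in the Lie algebra of polynomials.  The star product becomes the group law of
  the previous part.\<close>

abbreviation bch_pol :: "('g, 'k) formal \<Rightarrow> ('g, 'k) formal \<Rightarrow> ('g, 'k) formal" where
  "bch_pol \<equiv> lie_alg.bch (\<lambda>c F. Const c * F) pol_bracket"

abbreviation sbr_pol :: "('g, 'k) formal \<Rightarrow> ('g, 'k) formal \<Rightarrow> ('g, 'k) formal" where
  "sbr_pol \<equiv> lie_alg.sbr pol_bracket"

definition lower :: "('g, 'k) formal \<Rightarrow> ('g, 'k) formal" where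
  "lower f = (\<lambda>n. f (Suc n))"

definition order2 :: "('g, 'k) formal \<Rightarrow> bool" where
  "order2 f \<longleftrightarrow> f 0 = 0 \<and> f 1 = 0"

lemma lower_eqI: "f 0 = g 0 \<Longrightarrow> lower f = lower g \<Longrightarrow> f = g"
  unfolding lower_def fun_eq_iff by (metis not0_implies_Suc)

lemma lower_apply: "lower f n = f (Suc n)" by (simp add: lower_def)

lemma lower_0: "order2 f \<Longrightarrow> lower f 0 = 0" by (simp add: order2_def lower_apply)

lemma lower_bracket:
  assumes "f 0 = 0" "g 0 = 0"
  shows "lower (bracket f g) = sbr_pol (lower f) (lower g)" "bracket f g 0 = 0"
proof -
  interpret P: lie_alg "\<lambda>c F. Const c * F" pol_bracket by (rule lie_alg_pol)
  have "bracket f g (Suc n) = P.sbr (lower f) (lower g) n" for n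
  proof -
    have "bracket f g (Suc n) = (\<Sum>i\<le>Suc (Suc n). pol_bracket (f i) (g (Suc (Suc n) - i)))"
      by (simp add: bracket_def)
    also have "\<dots> = (\<Sum>i\<le>n. pol_bracket (f (Suc i)) (g (Suc (Suc n) - Suc i)))"
      by (rule sum_atMost_Suc_drop_ends) (simp_all add: assms)
    also have "\<dots> = P.sbr (lower f) (lower g) n"
      by (auto simp: P.sbr_def lower_apply Suc_diff_le intro!: sum.cong)
    finally show ?thesis .
  qed
  then show "lower (bracket f g) = P.sbr (lower f) (lower g)" by (auto simp: lower_def fun_eq_iff)
  show "bracket f g 0 = 0" by (simp add: bracket_def assms)
qed

lemma lower_nested_bracket:
  assumes "\<forall>f\<in>set fs. f 0 = 0"
  shows "lower (nested_bracket fs) = lie_alg.nest sbr_pol (map lower fs) \<and> nested_bracket fs 0 = 0"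
proof -
  interpret P: lie_alg "\<lambda>c F. Const c * F" pol_bracket by (rule lie_alg_pol)
  show ?thesis using assms
  proof (induction fs rule: nested_bracket.induct)
    case (3 f g fs)
    then show ?case using lower_bracket[of f "nested_bracket (g # fs)"] by (simp add: P.snest_simps)
  qed (auto simp: P.snest_simps lower_def fun_eq_iff)
qed

lemma lower_star:
  assumes f: "order2 f" and g: "order2 g"
  shows "lower (f \<star> g) = bch_pol (lower f) (lower g)" "order2 (f \<star> g)"
proof -
  interpret P: lie_alg "\<lambda>c F. Const c * F" pol_bracket by (rule lie_alg_pol)
  have nest: "nested_bracket (dynkin_word f g ps) (Suc n) = P.snest (dynkin_word (lower f) (lower g) ps) n" for ps n
  proof -
    have "\<forall>h\<in>set (dynkin_word f g ps). h 0 = 0"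
      using set_dynkin_word[of f g ps] f g by (auto simp: order2_def)
    then have "lower (nested_bracket (dynkin_word f g ps)) = P.snest (map lower (dynkin_word f g ps))"
      using lower_nested_bracket by blast
    then show ?thesis by (simp add: map_dynkin_word lower_def fun_eq_iff)
  qed
  have top: "P.snest (dynkin_word (lower f) (lower g) ps) n = 0" if "ps \<in> dynkin_indices (Suc n)" for ps n
    using that set_dynkin_word[of "lower f" "lower g" ps] f g
    by (intro P.snest_order) (auto simp: length_dynkin_word lower_0)
  have *: "(f \<star> g) (Suc n) = P.bch (lower f) (lower g) n" for n
    by (simp add: star_def P.bch_def nest top)
  then show "lower (f \<star> g) = P.bch (lower f) (lower g)" by (simp add: lower_def fun_eq_iff)
  show "order2 (f \<star> g)" using *[of 0] by (simp add: order2_def star_def[of f g] One_nat_def[symmetric] del: One_nat_def)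
qed

lemma order2_star [intro]: "order2 f \<Longrightarrow> order2 g \<Longrightarrow> order2 (f \<star> g)"
  by (rule lower_star)

theorem star_assoc:
  assumes "order2 f" "order2 g" "order2 h"
  shows "f \<star> g \<star> h = f \<star> (g \<star> h)"
proof (rule lower_eqI)
  interpret P: lie_alg "\<lambda>c F. Const c * F" pol_bracket by (rule lie_alg_pol)
  show "lower (f \<star> g \<star> h) = lower (f \<star> (g \<star> h))"
    using P.bch_assoc[of "lower f" "lower g" "lower h"] assms by (simp add: lower_star lower_0)
qed (simp add: star_def)

lemma star_commuting:
  assumes f: "order2 f" and g: "order2 g" and fg: "bracket f g = 0"
  shows "f \<star> g = f + g"
proof (rule lower_eqI)
  interpret P: lie_alg "\<lambda>c F. Const c * F" pol_bracket by (rule lie_alg_pol)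
  have "P.sbr (lower f) (lower g) = lower (bracket f g)"
    using f g by (simp add: lower_bracket order2_def)
  also have "\<dots> = 0" by (simp add: fg lower_def fun_eq_iff)
  finally have "P.bch (lower f) (lower g) = lower f + lower g"
    using f g by (intro P.bch_commuting lower_0)
  then show "lower (f \<star> g) = lower (f + g)"
    using f g by (simp add: lower_star) (simp add: lower_def fun_eq_iff)
qed (use f g in \<open>simp add: star_def order2_def\<close>)

lemma star_top:
  assumes "order2 f" "order2 g" "order2 f'" "order2 g'" "\<forall>i<n. f i = f' i" "\<forall>i<n. g i = g' i"
  shows "(f \<star> g) n - f n - g n = (f' \<star> g') n - f' n - g' n"
proof (cases n)
  case (Suc k)
  interpret P: lie_alg "\<lambda>c F. Const c * F" pol_bracket by (rule lie_alg_pol)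
  have "P.bch (lower f) (lower g) k - lower f k - lower g k = P.bch (lower f') (lower g') k - lower f' k - lower g' k"
    using assms Suc by (intro P.bch_top lower_0) (auto simp: lower_apply)
  moreover have "(a \<star> b) (Suc k) = P.bch (lower a) (lower b) k" if "order2 a" "order2 b" for a b
    using fun_cong[OF lower_star(1)[OF that], of k] by (simp only: lower_apply)
  ultimately show ?thesis using assms Suc by (simp add: lower_apply)
qed (use assms in \<open>simp add: star_def order2_def\<close>)

lemma star_degree_3:
  assumes f: "order2 f" and g: "order2 g"
  shows "(f \<star> g) 3 = f 3 + g 3 + Const (1 / 2) * pol_bracket (f 2) (g 2)"
proof -
  interpret P: lie_alg "\<lambda>c F. Const c * F" pol_bracket by (rule lie_alg_pol)
  have "(f \<star> g) (Suc 2) = P.bch (lower f) (lower g) 2"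
    using fun_cong[OF lower_star(1)[OF f g], of 2] by (simp only: lower_apply)
  also have "\<dots> = lower f 2 + lower g 2 + Const (1 / 2) * pol_bracket (lower f 1) (lower g 1)"
    using f g by (intro P.bch_degree_2 lower_0)
  finally show ?thesis by (simp add: lower_apply eval_nat_numeral)
qed

lemma bracket_self: "bracket f f = 0"
proof
  fix n
  have "bracket f f n = (\<Sum>i\<le>n + 1. pol_bracket (f (n + 1 - i)) (f i))"
    unfolding bracket_def by (rule sum.reindex_bij_witness[of _ "\<lambda>i. n + 1 - i" "\<lambda>i. n + 1 - i"]) auto
  also have "\<dots> = - bracket f f n"
    unfolding bracket_def by (subst pol_bracket_antisym) (simp add: sum_negf)
  finally have "bracket f f n + bracket f f n = 0" by (simp only: eq_neg_iff_add_eq_0)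
  then have "Const 2 * bracket f f n = 0" by (simp add: Const_numeral)
  then show "bracket f f n = 0 n" by (simp add: Const_mult_eq_0)
qed

lemma bracket_neg: "bracket f (neg g) = - bracket f g" "bracket (neg f) g = - bracket f g"
  by (auto simp: bracket_def neg_def pol_bracket_minus sum_negf fun_eq_iff)

lemma order2_neg [intro]: "order2 f \<Longrightarrow> order2 (neg f)"
  by (simp add: order2_def neg_def)

lemma order2_0 [simp]: "order2 0"
  by (simp add: order2_def)

lemma star_neg:
  assumes "order2 f" shows "f \<star> neg f = 0" "neg f \<star> f = 0"
proof -
  have "f \<star> neg f = f + neg f" "neg f \<star> f = neg f + f"
    using assms by (auto intro!: star_commuting simp: bracket_neg bracket_self simp del: zero_fun_apply)
  then show "f \<star> neg f = 0" "neg f \<star> f = 0" by (auto simp: neg_def fun_eq_iff)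
qed

lemma star_0:
  assumes "order2 f" shows "f \<star> 0 = f" "0 \<star> f = f"
proof -
  have "bracket f 0 = 0" "bracket 0 f = 0" by (auto simp: bracket_def fun_eq_iff)
  then have "f \<star> 0 = f + 0" "0 \<star> f = 0 + f"
    using star_commuting[OF assms order2_0] star_commuting[OF order2_0 assms] by blast+
  then show "f \<star> 0 = f" "0 \<star> f = f" by (simp_all only: add_0 add_0_right)
qed

lemma bracket_zero_iff_commute:
  assumes "bracket f g = 0" shows "bracket g f = 0"
proof
  fix n
  have "bracket g f n = (\<Sum>i\<le>n + 1. pol_bracket (g (n + 1 - i)) (f i))"
    unfolding bracket_def by (rule sum.reindex_bij_witness[of _ "\<lambda>i. n + 1 - i" "\<lambda>i. n + 1 - i"]) auto
  also have "\<dots> = - bracket f g n"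
    unfolding bracket_def by (subst pol_bracket_antisym) (simp add: sum_negf)
  finally show "bracket g f n = 0 n" by (simp add: assms)
qed

lemma star_commute:
  assumes "order2 f" "order2 g" "bracket f g = 0"
  shows "f \<star> g = g \<star> f"
  using star_commuting[OF assms] star_commuting[OF assms(2,1)] bracket_zero_iff_commute[OF assms(3)]
  by (simp only: add.commute)

lemma star_cancel_left: "order2 f \<Longrightarrow> order2 g \<Longrightarrow> f \<star> (neg f \<star> g) = g" "order2 f \<Longrightarrow> order2 g \<Longrightarrow> neg f \<star> (f \<star> g) = g"
  by (simp_all add: star_assoc[symmetric] order2_neg star_neg star_0 del: zero_fun_apply)

section \<open>Insertions are Poisson morphisms\<close>

lemma isub_lin: "isub S (lin i x) = (\<Sum>a\<in>S i. lin a x)"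
proof -
  have "isub S (lin i x) = (\<Sum>b | representation B x b \<noteq> 0. \<Sum>a\<in>S i. Const (representation B x b) * Var (a, b))"
    by (simp add: lin_def isub_hom isub_Var sum_distrib_left)
  also have "\<dots> = (\<Sum>a\<in>S i. lin a x)"
    unfolding lin_def by (rule sum.swap)
  finally show ?thesis .
qed

lemma isub_pol_bracket:
  assumes S: "disjoint_sets S"
  shows "isub S (pol_bracket F G) = pol_bracket (isub S F) (isub S G)"
proof (induction F rule: pol_induct)
  case (Var u)
  show ?case
  proof (induction G rule: pol_induct)
    case (Var v)
    obtain i b j c where uv: "u = (i, b)" "v = (j, c)" by (cases u, cases v)
    have "pol_bracket (isub S (Var u)) (isub S (Var v)) = (\<Sum>a\<in>S i. \<Sum>a'\<in>S j. if a = a' then lin a (br b c) else 0)"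
      unfolding uv isub_Var
      by (simp only: pol_bracket_sum_left)
        (simp add: pol_bracket_sum_right pol_bracket_Var structure_fun_def cong: if_cong)
    also have "\<dots> = (\<Sum>a\<in>S i. if a \<in> S j then lin a (br b c) else 0)"
      using S by (intro sum.cong refl) (simp add: disjoint_sets_def)
    also have "\<dots> = (if i = j then \<Sum>a\<in>S i. lin a (br b c) else 0)"
    proof (cases "i = j")
      case False
      then have "S i \<inter> S j = {}" using S by (simp add: disjoint_sets_def)
      then have "(\<Sum>a\<in>S i. if a \<in> S j then lin a (br b c) else 0) = 0" by (intro sum.neutral) auto
      then show ?thesis using False by simp
    qed simp
    also have "\<dots> = isub S (pol_bracket (Var u) (Var v))"
      by (simp add: uv pol_bracket_Var structure_fun_def isub_lin)
    finally show ?case ..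
  qed (simp_all add: pol_bracket_add_right pol_bracket_mult_right isub_hom)
qed (simp_all add: pol_bracket_add_left pol_bracket_mult_left isub_hom)

definition isubf :: "(nat \<Rightarrow> nat set) \<Rightarrow> ('g, 'k) formal \<Rightarrow> ('g, 'k) formal" where
  "isubf S f = (\<lambda>n. isub S (f n))"

lemma isubf_apply: "isubf S f n = isub S (f n)" by (simp add: isubf_def)

lemma isubf_bracket: "disjoint_sets S \<Longrightarrow> isubf S (bracket f g) = bracket (isubf S f) (isubf S g)"
  by (simp add: isubf_def bracket_def isub_hom isub_pol_bracket)

lemma isubf_nested_bracket:
  "disjoint_sets S \<Longrightarrow> isubf S (nested_bracket fs) = nested_bracket (map (isubf S) fs)"
  by (induction fs rule: nested_bracket.induct) (simp_all add: isubf_bracket, simp add: isubf_def)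

lemma isubf_star: "disjoint_sets S \<Longrightarrow> isubf S (f \<star> g) = isubf S f \<star> isubf S g"
proof
  fix n assume S: "disjoint_sets S"
  have "isub S (nested_bracket (dynkin_word f g ps) n) = nested_bracket (dynkin_word (isubf S f) (isubf S g) ps) n" for ps
    using fun_cong[OF isubf_nested_bracket[OF S, of "dynkin_word f g ps"], of n]
    by (simp add: isubf_def map_dynkin_word)
  then show "isubf S (f \<star> g) n = (isubf S f \<star> isubf S g) n"
    unfolding isubf_apply star_def isub_hom by simp
qed

lemma order2_isubf [intro]: "order2 f \<Longrightarrow> order2 (isubf S f)"
  by (simp add: order2_def isubf_def)

lemma isubf_neg: "isubf S (neg f) = neg (isubf S f)"
  by (simp add: isubf_def neg_def isub_hom)

section \<open>Poisson commuting functions\<close>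

lemma pol_bracket_separate:
  assumes "vars F \<subseteq> K \<times> UNIV" "vars G \<subseteq> L \<times> UNIV" "K \<inter> L = {}"
  shows "pol_bracket F G = 0"
  by (subst pol_bracket_superset[OF finite_vars order_refl finite_vars order_refl])
    (use assms in \<open>force simp: structure_fun_def intro!: sum.neutral\<close>)

text \<open>The diagonal adjoint action of \<open>x\<close> is Hamiltonian; its Hamiltonian is the sum of the copies of \<open>x\<close>.\<close>

lemma pol_ad_eq_bracket:
  assumes "finite K" "vars F \<subseteq> K \<times> UNIV"
  shows "pol_ad x F = pol_bracket (\<Sum>a\<in>K. lin a x) F"
proof -
  have Var: "pol_bracket (\<Sum>a\<in>K. lin a x) (Var v) = (if fst v \<in> K then lin (fst v) (br x (snd v)) else 0)" for v
  proof -
    have "pol_bracket (lin a x) (Var v) = (if a = fst v then lin (fst v) (br x (snd v)) else 0)" for a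
      using pol_bracket_Var_lin[of "fst v" "snd v" a x] pol_bracket_antisym[of "lin a x" "Var v"]
        lie_alg.br_antisym[OF lie_alg_g, of "snd v" x] by (simp add: lin_minus)
    then show ?thesis using assms by (simp add: pol_bracket_sum_left)
  qed
  have chain: "pol_bracket G F = (\<Sum>v\<in>vars F. pol_bracket G (Var v) * pdiff v F)" for G
  proof -
    have "pol_bracket G F = (\<Sum>u\<in>vars G. \<Sum>v\<in>vars F. structure_fun u v * pdiff u G * pdiff v F)"
      by (rule pol_bracket_superset) auto
    also have "\<dots> = (\<Sum>v\<in>vars F. \<Sum>u\<in>vars G. structure_fun u v * pdiff u G * pdiff v F)"
      by (rule sum.swap)
    also have "\<dots> = (\<Sum>v\<in>vars F. pol_bracket G (Var v) * pdiff v F)"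
      by (intro sum.cong refl) (subst pol_bracket_superset[of "vars G" G "{_}"],
          auto simp: vars_Var pdiff_Var sum_distrib_right)
    finally show ?thesis .
  qed
  show ?thesis
    unfolding chain[of "\<Sum>a\<in>K. lin a x"] Var pol_ad_def using assms(2) by (intro sum.cong) (auto split: prod.splits)
qed

lemma vars_psubst:
  fixes F :: "('g, 'k) pol"
  assumes "\<And>v. v \<in> vars F \<Longrightarrow> vars (s v) \<subseteq> W"
  shows "vars (psubst s F) \<subseteq> W"
proof -
  have mult: "vars (G * H) \<subseteq> W" if "vars G \<subseteq> W" "vars H \<subseteq> W" for G H :: "('g, 'k) pol" and W
    using vars_mult[of G H] that by blast
  have one: "vars (1 :: ('g, 'k) pol) = {}" by (auto simp: vars_def)
  have sum: "vars (\<Sum>i\<in>A. G i) \<subseteq> W" if "\<And>i. i \<in> A \<Longrightarrow> vars (G i) \<subseteq> W" for A :: "'i set" and G :: "'i \<Rightarrow> ('g, 'k) pol" and W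
    using that
  proof (induction A rule: infinite_finite_induct)
    case (insert x A)
    then show ?case using vars_add[of "G x" "sum G A"] by auto
  qed (auto simp: vars_def)
  have pow: "vars (G ^ k) \<subseteq> W" if "vars G \<subseteq> W" for G :: "('g, 'k) pol" and k W
    using that by (induction k) (simp_all add: one mult)
  have prod: "vars (\<Prod>i\<in>A. G i) \<subseteq> W" if "\<And>i. i \<in> A \<Longrightarrow> vars (G i) \<subseteq> W" for A :: "'i set" and G :: "'i \<Rightarrow> ('g, 'k) pol" and W
    using that by (induction A rule: infinite_finite_induct) (simp_all add: one mult)
  show ?thesis unfolding psubst_def
    by (intro sum mult prod pow assms) (auto simp: vars_def Const_def split: if_splits)
qed

lemma vars_isub:
  fixes F :: "('g, 'k) pol"
  assumes "vars F \<subseteq> K \<times> UNIV" shows "vars (isub S F) \<subseteq> (\<Union>i\<in>K. S i) \<times> UNIV"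
  unfolding isub_def
proof (rule vars_psubst)
  fix v assume "v \<in> vars F"
  then obtain i b where v: "v = (i, b)" "i \<in> K" using assms by auto
  have "vars (\<Sum>a\<in>A. Var (a, b)) \<subseteq> A \<times> UNIV" for A
  proof (induction A rule: infinite_finite_induct)
    case (insert x A)
    then show ?case using vars_add[of "Var (x, b)" "\<Sum>a\<in>A. Var (a, b)"] by (auto simp: vars_Var)
  qed (auto simp: vars_def)
  then show "vars (case v of (i, b) \<Rightarrow> \<Sum>a\<in>S i. Var (a, b)) \<subseteq> (\<Union>i\<in>K. S i) \<times> UNIV"
    using v by fastforce
qed

text \<open>Variables outside the basis are allowed, but they enter a Poisson bracket only through their expansion
  in the basis.\<close>

lemma pol_bracket_lin: "pol_bracket F (lin a x) = pol_bracket F (Var (a, x))"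
proof (induction F rule: pol_induct)
  case (Var v)
  obtain i b where v: "v = (i, b)" by (cases v)
  show ?case unfolding v pol_bracket_Var_lin by (simp add: pol_bracket_Var structure_fun_def)
qed (simp_all add: pol_bracket_add_left pol_bracket_mult_left)

text \<open>Invariance means that \<open>F\<close> commutes with the sums over \<open>K\<close> of the copies of a Lie algebra element, and these
  generate the functions of the sum of the arguments in \<open>K\<close>.  Copies outside \<open>K\<close> commute with \<open>F\<close> anyway.\<close>

lemma pol_bracket_invariant:
  assumes F: "vars F \<subseteq> K \<times> UNIV" "finite K" "\<And>x. pol_ad x F = 0"
    and S: "\<And>i. finite (S i)" "\<And>i. K \<subseteq> S i \<or> K \<inter> S i = {}"
  shows "pol_bracket F (isub S G) = 0"
proof (induction G rule: pol_induct)
  case (Var v)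
  obtain i b where v: "v = (i, b)" by (cases v)
  have Var0: "pol_bracket F (Var (a, b)) = 0" if "a \<notin> K" for a
    by (rule pol_bracket_separate[OF F(1), of _ "{a}"]) (use that in \<open>auto simp: vars_Var\<close>)
  have sum: "(\<Sum>a\<in>K. pol_bracket F (Var (a, b))) = 0"
    using F(3)[of b] pol_ad_eq_bracket[OF F(2,1), of b] pol_bracket_antisym[of F "\<Sum>a\<in>K. lin a b"]
    by (simp add: pol_bracket_sum_right pol_bracket_lin)
  have "(\<Sum>a\<in>S i. pol_bracket F (Var (a, b))) = 0"
  proof (cases "K \<subseteq> S i")
    case True
    then have "(\<Sum>a\<in>S i. pol_bracket F (Var (a, b))) = (\<Sum>a\<in>K. pol_bracket F (Var (a, b)))"
      using S(1) Var0 by (intro sum.mono_neutral_right) auto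
    then show ?thesis by (simp add: sum)
  next
    case False
    then have "K \<inter> S i = {}" using S(2) by blast
    then show ?thesis using Var0 by (intro sum.neutral) blast
  qed
  then show ?case by (simp add: v isub_Var pol_bracket_sum_right)
qed (simp_all add: pol_bracket_add_right pol_bracket_mult_right isub_hom)

lemma pol_ad_isub:
  assumes F: "vars F \<subseteq> K \<times> UNIV" "finite K" and S: "disjoint_sets S"
  shows "pol_ad x (isub S F) = isub S (pol_ad x F)"
proof -
  have "pol_ad x (isub S F) = pol_bracket (\<Sum>a\<in>(\<Union>i\<in>K. S i). lin a x) (isub S F)"
    by (rule pol_ad_eq_bracket) (use F S vars_isub[OF F(1)] in \<open>auto simp: disjoint_sets_def\<close>)
  also have "(\<Sum>a\<in>(\<Union>i\<in>K. S i). lin a x) = isub S (\<Sum>i\<in>K. lin i x)"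
    using F S by (subst sum.UNION_disjoint) (auto simp: disjoint_sets_def isub_hom isub_lin)
  also have "pol_bracket \<dots> (isub S F) = isub S (pol_ad x F)"
    by (simp add: isub_pol_bracket[OF S] pol_ad_eq_bracket[OF F(2,1)])
  finally show ?thesis .
qed

lemma bracket_invariant:
  assumes f: "f \<in> invariants" "\<And>n. vars (f n) \<subseteq> K \<times> UNIV" "finite K" and T: "disjoint_sets T"
    and S: "\<And>i. finite (S i)" "\<And>i. (\<Union>j\<in>K. T j) \<subseteq> S i \<or> (\<Union>j\<in>K. T j) \<inter> S i = {}"
  shows "bracket (isubf T f) (isubf S g) = 0"
proof -
  have "pol_bracket (isub T (f n)) (isub S (g m)) = 0" for n m
  proof (rule pol_bracket_invariant[OF vars_isub[OF f(2)]])
    show "finite (\<Union>j\<in>K. T j)" using f(3) T by (auto simp: disjoint_sets_def)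
    show "pol_ad x (isub T (f n)) = 0" for x
      using f(1) by (subst pol_ad_isub[OF f(2,3) T]) (simp add: invariants_def)
  qed (use S in auto)
  then show ?thesis by (auto simp: bracket_def isubf_def fun_eq_iff)
qed

lemma bracket_separate:
  assumes "\<And>n. vars (f n) \<subseteq> K \<times> UNIV" "\<And>n. vars (g n) \<subseteq> L \<times> UNIV" "K \<inter> L = {}"
  shows "bracket f g = 0"
  by (auto simp: bracket_def fun_eq_iff pol_bracket_separate[OF assms(1,2,3)])

section \<open>Formal functions on powers of the dual Lie algebra\<close>

lemma \<O>_iff: "f \<in> \<O> k \<longleftrightarrow> (\<forall>n. homog ({1..k} \<times> B) n (f n))"
  by (auto simp: \<O>_def homog_def)

lemma \<O>_vars: "f \<in> \<O> k \<Longrightarrow> vars (f n) \<subseteq> {1..k} \<times> UNIV"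
  using homog_vars[of "{1..k} \<times> B" n "f n"] by (auto simp: \<O>_iff)

lemma homog_pol_bracket:
  assumes F: "homog (K \<times> B) n F" and G: "homog (K \<times> B) m G"
  shows "homog (K \<times> B) (n + m - 1) (pol_bracket F G)"
proof (cases "n = 0 \<or> m = 0")
  case True
  then consider "F = Const (lookup F 0)" | "G = Const (lookup G 0)"
    using F G homog_0_Const by blast
  then have "pol_bracket F G = 0"
    by cases (erule ssubst, rule pol_bracket_Const_left, erule ssubst, rule pol_bracket_Const_right)
  then show ?thesis by simp
next
  case False
  have "homog (K \<times> B) (Suc 0 + (n - 1) + (m - 1)) (structure_fun u v * pdiff u F * pdiff v G)"
    if "u \<in> vars F" for u v
  proof -
    have "fst u \<in> K" using that homog_vars[OF F] by auto
    then have "{fst u} \<times> B \<subseteq> K \<times> B" by auto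
    then have "homog (K \<times> B) (Suc 0) (structure_fun u v)"
      unfolding structure_fun_def using homog_mono[OF homog_lin, of "fst u" "K \<times> B"]
      by (cases "fst u = fst v") (simp_all del: split_paired_All)
    then show ?thesis by (intro homog_mult homog_pdiff F G)
  qed
  moreover have "Suc 0 + (n - 1) + (m - 1) = n + m - 1" using False by auto
  ultimately show ?thesis
    by (subst pol_bracket_superset[of "vars F" F "vars G" G]) (auto intro!: homog_sum simp del: mult.assoc)
qed

lemma \<O>_bracket: "f \<in> \<O> k \<Longrightarrow> g \<in> \<O> k \<Longrightarrow> bracket f g \<in> \<O> k"
  unfolding \<O>_iff bracket_def
proof (intro allI homog_sum)
  fix n i :: nat assume "\<forall>n. homog ({1..k} \<times> B) n (f n)" "\<forall>n. homog ({1..k} \<times> B) n (g n)" "i \<in> {..n + 1}"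
  then show "homog ({1..k} \<times> B) n (pol_bracket (f i) (g (n + 1 - i)))"
    using homog_pol_bracket[of "{1..k}" i "f i" "n + 1 - i" "g (n + 1 - i)"] by simp
qed

lemma \<O>_nested_bracket: "set fs \<subseteq> \<O> k \<Longrightarrow> nested_bracket fs \<in> \<O> k"
proof (induction fs rule: nested_bracket.induct)
  case 1
  show ?case by (simp add: \<O>_iff)
qed (auto intro!: \<O>_bracket)

lemma \<O>_star [intro]: "f \<in> \<O> k \<Longrightarrow> g \<in> \<O> k \<Longrightarrow> f \<star> g \<in> \<O> k"
proof -
  assume fg: "f \<in> \<O> k" "g \<in> \<O> k"
  have "nested_bracket (dynkin_word f g ps) \<in> \<O> k" for ps
    using fg set_dynkin_word[of f g ps] by (intro \<O>_nested_bracket) auto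
  then show ?thesis by (auto simp: \<O>_iff star_def intro!: homog_sum homog_Const_mult)
qed

lemma \<O>_neg [intro]: "f \<in> \<O> k \<Longrightarrow> neg f \<in> \<O> k"
  by (simp add: \<O>_iff neg_def homog_minus)

text \<open>Superscripts are numbered from one, and absent superscripts are empty.\<close>

definition sup_sets :: "nat set list \<Rightarrow> nat \<Rightarrow> nat set" where
  "sup_sets P i = (if i = 0 \<or> length P < i then {} else P ! (i - 1))"

lemma sup_sets_Nil [simp]: "sup_sets [] i = {}"
  by (cases "i = 0") (simp_all add: sup_sets_def)

lemma sup_sets_Cons: "sup_sets (A # P) i = (if i = 1 then A else if i = 0 then {} else sup_sets P (i - 1))"
  by (auto simp: sup_sets_def nth_Cons')

lemma ins_eq_isubf: "f \<in> \<O> (length P) \<Longrightarrow> ins P f = isubf (sup_sets P) f"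
proof
  fix n assume f: "f \<in> \<O> (length P)"
  show "ins P f n = isubf (sup_sets P) f n"
    unfolding ins_def isubf_def isub_def
    by (rule psubst_cong) (use \<O>_vars[OF f, of n] in \<open>force simp: sup_sets_def\<close>)
qed

lemma isubf_id: "f \<in> \<O> k \<Longrightarrow> (\<And>i. i \<in> {1..k} \<Longrightarrow> S i = {i}) \<Longrightarrow> isubf S f = f"
  unfolding isubf_def by (intro ext isub_id[OF \<O>_vars])

end

section \<open>Co-Hochschild cohomology of the symmetric algebra in degrees two and three\<close>

definition weight :: "((nat \<times> 'g \<Rightarrow>\<^sub>0 nat) \<Rightarrow> 'k::field_char_0) \<Rightarrow> ('g, 'k) pol \<Rightarrow> ('g, 'k) pol" where
  "weight c F = (\<Sum>m\<in>keys F. single m (c m * lookup F m))"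

lemma weight_add: "weight c (F + G) = weight c F + weight c G"
  unfolding weight_def
  by (rule setsum_keys_plus_distrib[where f = "\<lambda>m a. single m (c m * a)"])
    (auto simp: algebra_simps single_add)

lemma weight_0 [simp]: "weight c 0 = 0"
  by (simp add: weight_def)

lemma weight_single: "weight c (single m a) = single m (c m * a)"
  by (cases "a = 0") (auto simp: weight_def)

lemma weight_sum: "weight c (\<Sum>i\<in>A. F i) = (\<Sum>i\<in>A. weight c (F i))"
  by (rule sum_additive) (auto simp: weight_add)

lemma homog_weight: "homog V n F \<Longrightarrow> homog V n (weight c F)"
  unfolding weight_def by (intro homog_sum) (auto simp: homog_def split: if_splits)

text \<open>The primitive is the integral along the lines through the origin in the variables \<open>T\<close>, which divides
  each monomial of \<open>Var v * e v\<close> by its degree in \<open>T\<close>.  Its form as a sum of multiples of the variables in \<open>T\<close> shows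
  that it vanishes when they do.\<close>

lemma poincare_one_form:
  fixes e :: "nat \<times> 'g \<Rightarrow> ('g, 'k::field_char_0) pol"
  assumes T: "finite T" and closed: "\<And>u v. u \<in> T \<Longrightarrow> v \<in> T \<Longrightarrow> pdiff u (e v) = pdiff v (e u)"
    and e: "\<And>v. v \<in> T \<Longrightarrow> homog V n (e v)" and TV: "T \<subseteq> V"
  obtains \<sigma> h where "\<And>v. v \<in> T \<Longrightarrow> pdiff v \<sigma> = e v" "homog V (Suc n) \<sigma>" "\<sigma> = (\<Sum>v\<in>T. Var v * h v)"
proof -
  define d where "d m = (\<Sum>v\<in>T. lookup m v)" for m :: "nat \<times> 'g \<Rightarrow>\<^sub>0 nat"
  define c :: "_ \<Rightarrow> 'k" where "c m = 1 / of_nat (Suc (d m))" for m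
  define c' :: "_ \<Rightarrow> 'k" where "c' m = 1 / of_nat (Suc (Suc (d m)))" for m
  have d1: "d (m + single v 1) = Suc (d m)" if "v \<in> T" for m v
  proof -
    have "d (m + single v 1) = d m + (\<Sum>w\<in>T. if v = w then 1 else 0)"
      by (auto simp: d_def lookup_add lookup_single when_def simp flip: sum.distrib intro!: sum.cong)
    then show ?thesis using T that by simp
  qed
  have pdiff: "pdiff v (weight c F) = weight c' (pdiff v F)" if v: "v \<in> T" for v F
  proof (induction F rule: poly_mapping_single_induct)
    case (single m a)
    show ?case
    proof (cases "lookup m v = 0")
      case False
      then have "m = (m - single v 1) + single v 1" by (rule monom_split)
      then have "d m = Suc (d (m - single v 1))" using d1[OF v] by metis
      then show ?thesis by (simp add: weight_single pdiff_single c_def c'_def)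
    qed (simp add: weight_single pdiff_single)
  qed (simp add: weight_add pdiff_add)
  have Var: "Var v * weight c' F = weight c (Var v * F)" if v: "v \<in> T" for v F
  proof (induction F rule: poly_mapping_single_induct)
    case (single m a)
    have "d (single v 1 + m) = Suc (d m)" using d1[OF v, of m] by (simp add: add.commute)
    then show ?case by (simp add: weight_single Var_def mult_single c_def c'_def)
  qed (simp add: weight_add algebra_simps)
  have euler: "weight c F + weight c (\<Sum>v\<in>T. Var v * pdiff v F) = F" for F
  proof (induction F rule: poly_mapping_single_induct)
    case (single m a)
    have "(\<Sum>v\<in>T. Var v * pdiff v (single m a)) = (\<Sum>v\<in>T. single m (of_nat (lookup m v) * a))"
      by (simp only: Var_mult_pdiff_single)
    also have "\<dots> = single m (of_nat (d m) * a)"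
      unfolding d_def of_nat_sum sum_distrib_right by (rule sum_additive[symmetric]) (auto simp: single_add)
    finally have "weight c (single m a) + weight c (\<Sum>v\<in>T. Var v * pdiff v (single m a))
      = single m (c m * (of_nat (Suc (d m)) * a))"
      by (simp add: weight_single algebra_simps flip: single_add)
    also have "c m * (of_nat (Suc (d m)) * a) = a" by (simp add: c_def del: of_nat_Suc)
    finally show ?case .
  next
    case (add F G)
    have "weight c (F + G) + weight c (\<Sum>v\<in>T. Var v * pdiff v (F + G))
      = (weight c F + weight c (\<Sum>v\<in>T. Var v * pdiff v F)) + (weight c G + weight c (\<Sum>v\<in>T. Var v * pdiff v G))"
      by (simp add: pdiff_add weight_add algebra_simps sum.distrib)
    then show ?case by (simp only: add)
  qed
  define \<sigma> where "\<sigma> = (\<Sum>v\<in>T. Var v * weight c (e v))"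
  have "pdiff u \<sigma> = e u" if u: "u \<in> T" for u
  proof -
    have "pdiff u \<sigma> = (\<Sum>v\<in>T. (if u = v then weight c (e v) else 0)) + (\<Sum>v\<in>T. Var v * pdiff u (weight c (e v)))"
      by (auto simp: \<sigma>_def pdiff_sum pdiff_mult pdiff_Var simp flip: sum.distrib intro!: sum.cong)
    also have "(\<Sum>v\<in>T. (if u = v then weight c (e v) else 0)) = weight c (e u)"
      using T u by simp
    also have "(\<Sum>v\<in>T. Var v * pdiff u (weight c (e v))) = weight c (\<Sum>v\<in>T. Var v * pdiff v (e u))"
      unfolding weight_sum using u by (intro sum.cong refl) (simp add: pdiff Var closed)
    finally show ?thesis by (simp only: euler)
  qed
  moreover have "homog V (Suc n) \<sigma>"
    unfolding \<sigma>_def using homog_mult[OF homog_Var homog_weight[OF e]] TV by (auto intro!: homog_sum)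
  ultimately show thesis by (intro that[of \<sigma> "\<lambda>v. weight c (e v)"]) (auto simp: \<sigma>_def)
qed

lemma lookup_pdiff:
  "lookup (pdiff v F) m
    = of_nat (Suc (lookup m v)) * lookup F (m + single v 1)"
proof (induction F rule: poly_mapping_single_induct)
  case (single m' a)
  have "m' - single v 1 = m \<and> lookup m' v \<noteq> 0 \<longleftrightarrow> m' = m + single v 1"
  proof
    assume *: "m' - single v 1 = m \<and> lookup m' v \<noteq> 0"
    then have "m' = (m' - single v 1) + single v 1" by (intro monom_split) simp
    with * show "m' = m + single v 1" by simp
  qed (auto simp: lookup_add)
  then show ?case
    by (cases "lookup m' v = 0") (auto simp: pdiff_single lookup_single when_def lookup_add)
qed (simp add: pdiff_add lookup_add algebra_simps)

text \<open>Characteristic zero is essential here.\<close>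

lemma pdiff_eq_0_vars: "pdiff v F = 0 \<Longrightarrow> v \<notin> vars F"
proof
  assume F: "pdiff v F = 0" and "v \<in> vars F"
  then obtain m where m: "m \<in> keys F" "v \<in> keys m" by (auto simp: vars_def)
  then have "m = (m - single v 1) + single v 1" by (intro monom_split) (simp add: in_keys_iff)
  then have "lookup F m = 0"
    using lookup_pdiff[of v F "m - single v 1"] F by (simp del: of_nat_Suc)
  with m show False by (simp add: in_keys_iff)
qed

lemma homog_no_vars: "homog {} n F \<Longrightarrow> n \<noteq> 0 \<Longrightarrow> F = 0"
proof -
  assume F: "homog {} n F" "n \<noteq> 0"
  have "keys F = {}"
  proof (rule ccontr)
    assume "keys F \<noteq> {}"
    then obtain m where "m \<in> keys F" by blast
    then have "mdeg m = n" "keys m = {}" using F by (auto simp: homog_def)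
    then show False using F by (simp add: mdeg_def)
  qed
  then show "F = 0" by simp
qed

context lie_algebra_basis
begin

abbreviation ev :: "nat set list \<Rightarrow> ('g, 'k) pol \<Rightarrow> ('g, 'k) pol" where
  "ev P \<equiv> isub (sup_sets P)"

lemma sup_sets_simps [simp]:
  "sup_sets P 0 = {}" "sup_sets (A # P) (Suc 0) = A" "sup_sets (A # P) (Suc (Suc i)) = sup_sets P (Suc i)"
  "sup_sets (A # P) (numeral k) = (if numeral k = (1 :: nat) then A else sup_sets P (pred_numeral k))"
  by (auto simp: sup_sets_Cons sup_sets_def[of P 0] numeral_eq_Suc)

text \<open>Disjointness of the superscripts, in a form that simplification decides for explicit lists.\<close>

fun disj :: "nat set list \<Rightarrow> bool" where
  "disj [] \<longleftrightarrow> True"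
| "disj (A # P) \<longleftrightarrow> finite A \<and> (\<forall>C\<in>set P. A \<inter> C = {}) \<and> disj P"

lemma sup_sets_cases: "sup_sets P i = {} \<or> sup_sets P i \<in> set P"
proof (cases "i = 0 \<or> length P < i")
  case False
  then show ?thesis by (auto simp: sup_sets_def)
qed (auto simp: sup_sets_def)

lemma disjoint_sup_sets: "disj P \<Longrightarrow> disjoint_sets (sup_sets P)"
proof (induction P)
  case (Cons A P)
  then have IH: "disjoint_sets (sup_sets P)" by simp
  have A: "A \<inter> sup_sets P i = {}" "finite A" for i
    using Cons.prems sup_sets_cases[of P i] by auto
  have "sup_sets (A # P) i \<inter> sup_sets (A # P) j = {}" if "i \<noteq> j" for i j
  proof -
    have "i - 1 \<noteq> j - 1" if "i \<noteq> 0" "j \<noteq> 0" using that \<open>i \<noteq> j\<close> by auto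
    then show ?thesis
      using IH A \<open>i \<noteq> j\<close> by (auto simp: sup_sets_Cons disjoint_sets_def)
  qed
  then show ?case using IH A by (auto simp: disjoint_sets_def sup_sets_Cons)
qed (simp add: disjoint_sets_def)

text \<open>The number of the set which contains \<open>a\<close>, and zero if there is none.  It makes the chain rule for
  insertions computable by simplification.\<close>

fun slot :: "nat \<Rightarrow> nat set list \<Rightarrow> nat" where
  "slot a [] = 0"
| "slot a (A # P) = (if a \<in> A then 1 else if slot a P = 0 then 0 else slot a P + 1)"

lemma slot_sup_sets: "if slot a P = 0 then \<forall>i. a \<notin> sup_sets P i else a \<in> sup_sets P (slot a P)"
  by (induction P) (auto simp: sup_sets_Cons split: if_splits)

lemma pdiff_ev:
  "disj P \<Longrightarrow> pdiff (a, b) (ev P F) = (if slot a P = 0 then 0 else ev P (pdiff (slot a P, b) F))"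
  using slot_sup_sets[of a P] pdiff_isub[OF disjoint_sup_sets, of P a "slot a P" b F] pdiff_isub_0[of a "sup_sets P" b F]
  by auto

lemma ev_ev: "disj P \<Longrightarrow> disj Q \<Longrightarrow> ev Q (ev P F) = ev (map (\<lambda>A. \<Union>a\<in>A. sup_sets Q a) P) F"
proof -
  assume "disj P" "disj Q"
  then have "ev Q (ev P F) = isub (\<lambda>i. \<Union>a\<in>sup_sets P i. sup_sets Q a) F"
    by (intro isub_isub disjoint_sup_sets)
  also have "(\<lambda>i. \<Union>a\<in>sup_sets P i. sup_sets Q a) = sup_sets (map (\<lambda>A. \<Union>a\<in>A. sup_sets Q a) P)"
    by (auto simp: sup_sets_def fun_eq_iff)
  finally show ?thesis .
qed

lemma ev_id: "homog ({1..k} \<times> B') n F \<Longrightarrow> (\<And>i. i \<in> {1..k} \<Longrightarrow> sup_sets P i = {i}) \<Longrightarrow> ev P F = F"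
  using homog_vars[of "{1..k} \<times> B'" n F] by (intro isub_id[of F "{1..k}"]) auto

lemma homog_ev: "homog ({1..k} \<times> B') n F \<Longrightarrow> \<Union>(set P) \<subseteq> {1..l} \<Longrightarrow> homog ({1..l} \<times> B') n (ev P F)"
proof (rule homog_isub)
  fix i assume "\<Union>(set P) \<subseteq> {1..l}"
  then show "sup_sets P i \<subseteq> {1..l}" using sup_sets_cases[of P i] by auto
qed

lemma zero_if_constant_in_slot:
  assumes F: "homog ({1..k} \<times> B') n F" and d: "\<And>b. pdiff (i, b) F = 0"
    and P: "\<And>j. j \<in> {1..k} \<Longrightarrow> sup_sets P j = (if j = i then {} else {j})"
    and z: "ev P F = 0"
  shows "F = 0"
proof -
  have "vars F \<subseteq> ({1..k} - {i}) \<times> UNIV"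
    using homog_vars[OF F] d pdiff_eq_0_vars by fastforce
  then have "ev P F = F"
    by (rule isub_id) (use P in auto)
  with z show ?thesis by simp
qed

lemma ev_empty: "homog ({1..k} \<times> B') n F \<Longrightarrow> n \<noteq> 0 \<Longrightarrow> \<Union>(set P) = {} \<Longrightarrow> ev P F = 0"
proof -
  assume F: "homog ({1..k} \<times> B') n F" "n \<noteq> 0" "\<Union>(set P) = {}"
  then have "homog ({} \<times> B') n (ev P F)"
    using sup_sets_cases[of P] by (intro homog_isub[of "{1..k}"]) auto
  then show "ev P F = 0" using F by (intro homog_no_vars) auto
qed

text \<open>Let \<open>f\<^sub>b(x)\<close> be the derivative of \<open>F(x, y)\<close> in \<open>y\<close> in the direction \<open>b\<close> at \<open>y = 0\<close>.  The cocycle equation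
  gives \<open>f\<^sub>b(x + y) - f\<^sub>b(y)\<close> for the derivative at arbitrary \<open>y\<close>.  By the symmetry of second derivatives the
  exterior derivative of the one-form \<open>f\<close> is translation invariant, hence zero, since its degree \<open>N - 2\<close> is
  positive.  A primitive of \<open>f\<close> solves the problem.\<close>

theorem cohomology_2:
  assumes F: "homog ({1..2} \<times> B') N F" and B': "finite B'" and N: "3 \<le> N"
    and norm: "ev [{1}, {}] F = 0"
    and cocycle: "ev [{2}, {3}] F - ev [{1, 2}, {3}] F + ev [{1}, {2, 3}] F - ev [{1}, {2}] F = 0"
  obtains \<sigma> where "homog ({1..1} \<times> B') N \<sigma>" "F = ev [{1, 2}] \<sigma> - ev [{1}] \<sigma> - ev [{2}] \<sigma>"
proof -
  define f where "f b = ev [{1}, {}] (pdiff (2, b) F)" for b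
  have f: "homog ({1..1} \<times> B') (N - 1) (f b)" for b
    unfolding f_def by (intro homog_ev[of 2] homog_pdiff F) auto
  have id2: "ev [{1}, {2}] G = G" if "homog ({1..2} \<times> B') n G" for n G
    by (rule ev_id[OF that]) (auto simp: sup_sets_Cons)
  have d: "pdiff (2, b) F = ev [{1, 2}] (f b) - ev [{2}] (f b)" for b
  proof -
    have "pdiff (3, b) (ev [{2}, {3}] F - ev [{1, 2}, {3}] F + ev [{1}, {2, 3}] F - ev [{1}, {2}] F) = 0"
      unfolding cocycle by simp
    then have "ev [{2}, {3}] (pdiff (2, b) F) - ev [{1, 2}, {3}] (pdiff (2, b) F) + ev [{1}, {2, 3}] (pdiff (2, b) F) = 0"
      by (simp add: pdiff_diff pdiff_add pdiff_ev flip: numeral_2_eq_2)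
    then have "ev [{1}, {2}, {}] (ev [{2}, {3}] (pdiff (2, b) F) - ev [{1, 2}, {3}] (pdiff (2, b) F)
        + ev [{1}, {2, 3}] (pdiff (2, b) F)) = 0"
      by simp
    then have "ev [{2}, {}] (pdiff (2, b) F) - ev [{1, 2}, {}] (pdiff (2, b) F) + ev [{1}, {2}] (pdiff (2, b) F) = 0"
      by (simp add: isub_hom ev_ev insert_commute)
    moreover have "ev [{1}, {2}] (pdiff (2, b) F) = pdiff (2, b) F"
      by (rule id2[OF homog_pdiff[OF F]])
    ultimately show ?thesis by (simp add: f_def ev_ev insert_commute algebra_simps)
  qed
  have closed: "pdiff (1, a) (f b) = pdiff (1, b) (f a)" for a b
  proof -
    define t where "t = pdiff (1, a) (f b) - pdiff (1, b) (f a)"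
    have t: "homog ({1..1} \<times> B') (N - 1 - 1) t"
      unfolding t_def by (intro homog_diff homog_pdiff f)
    have "pdiff (2, a) (pdiff (2, b) F) - pdiff (2, b) (pdiff (2, a) F) = ev [{1, 2}] t - ev [{2}] t"
      unfolding d t_def by (simp add: pdiff_diff pdiff_ev isub_hom)
    then have "ev [{1}, {}] (ev [{1, 2}] t - ev [{2}] t) = 0"
      by (simp add: pdiff_commute[of "(2, a)"])
    then have "ev [{1}] t = ev [{}] t" by (simp add: isub_hom ev_ev insert_commute)
    moreover have "ev [{}] t = 0" using N by (intro ev_empty[OF t]) auto
    moreover have "ev [{1}] t = t" by (rule ev_id[OF t]) (auto simp: sup_sets_Cons)
    ultimately show ?thesis by (simp add: t_def)
  qed
  have T: "finite ({1..1 :: nat} \<times> B')" using B' by simp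
  have T_closed: "pdiff u (f (snd v)) = pdiff v (f (snd u))" if "u \<in> {1..1} \<times> B'" "v \<in> {1..1} \<times> B'" for u v
    using that closed by auto
  obtain \<sigma> h where s: "\<And>v. v \<in> {1..1} \<times> B' \<Longrightarrow> pdiff v \<sigma> = f (snd v)" "homog ({1..1} \<times> B') (Suc (N - 1)) \<sigma>"
    and "\<sigma> = (\<Sum>v\<in>{1..1} \<times> B'. Var v * h v)"
  proof (rule poincare_one_form[of "{1..1} \<times> B'" "\<lambda>v. f (snd v)" "{1..1} \<times> B'" "N - 1"])
    fix \<sigma> h
    assume "\<And>v. v \<in> {1..1} \<times> B' \<Longrightarrow> pdiff v \<sigma> = f (snd v)" "homog ({1..1} \<times> B') (Suc (N - 1)) \<sigma>"
      "\<sigma> = (\<Sum>v\<in>{1..1} \<times> B'. Var v * h v)"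
    then show thesis by (rule that)
  qed (use T T_closed f in auto)
  have sN: "homog ({1..1} \<times> B') N \<sigma>" using s(2) N by simp
  have ds: "pdiff (1, b) \<sigma> = f b" for b
  proof (cases "b \<in> B'")
    case False
    then have "pdiff (2, b) F = 0" "pdiff (1, b) \<sigma> = 0"
      using homog_vars[OF F] homog_vars[OF sN] by (auto intro!: pdiff_not_vars)
    then show ?thesis by (simp add: f_def)
  qed (use s(1) in force)
  \<comment> \<open>The two sides have the same derivatives in \<open>y\<close>, and both vanish at \<open>y = 0\<close>.\<close>
  let ?G = "F - (ev [{1, 2}] \<sigma> - ev [{1}] \<sigma> - ev [{2}] \<sigma>)"
  have "?G = 0"
  proof (rule zero_if_constant_in_slot)
    show "homog ({1..2} \<times> B') N ?G"
      by (intro homog_diff F homog_ev[OF sN]) auto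
    show "pdiff (2, b) ?G = 0" for b
      using ds[of b] by (simp add: pdiff_diff pdiff_ev d)
    show "sup_sets [{1}, {}] j = (if j = 2 then {} else {j})" if "j \<in> {1..2}" for j
      using that by (auto simp: sup_sets_Cons)
    have "ev [{}] \<sigma> = 0" using N by (intro ev_empty[OF sN]) auto
    then show "ev [{1}, {}] ?G = 0"
      using norm by (simp add: isub_hom ev_ev insert_commute)
  qed
  then show thesis by (intro that[OF sN]) simp
qed

definition alternation :: "('g, 'k) pol \<Rightarrow> ('g, 'k) pol" where
  "alternation F = F - ev [{1}, {3}, {2}] F + ev [{2}, {3}, {1}] F - ev [{2}, {1}, {3}] F
    + ev [{3}, {1}, {2}] F - ev [{3}, {2}, {1}] F"

text \<open>In degree three the third derivatives are constants, which insertions leave unchanged.\<close>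

lemma alternation_derivative:
  assumes F: "homog ({1..3} \<times> B') 3 F" and alt: "alternation F = 0"
  shows "let K = (\<lambda>a b c. pdiff (1, a) (pdiff (2, b) (pdiff (3, c) F)))
      in K a b c - K a c b + K b c a - K b a c + K c a b - K c b a = 0"
proof -
  define K where "K a b c = pdiff (1, a) (pdiff (2, b) (pdiff (3, c) F))" for a b c
  have "homog ({1..3} \<times> B') (3 - 1 - 1 - 1) (K a b c)" for a b c
    unfolding K_def by (intro homog_pdiff F)
  then have "homog ({1..3} \<times> B') 0 (K a b c)" for a b c by simp
  then have Kc: "ev P (K a b c) = K a b c" for P a b c
    using homog_0_Const[of "{1..3} \<times> B'" "K a b c"] isub_Const by metis
  have D: "pdiff (1, a) (pdiff (2, b) (pdiff (3, c) (alternation F))) = 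
    K a b c - ev [{1}, {3}, {2}] (K a c b) + ev [{2}, {3}, {1}] (K b c a) - ev [{2}, {1}, {3}] (K b a c)
    + ev [{3}, {1}, {2}] (K c a b) - ev [{3}, {2}, {1}] (K c b a)"
    unfolding alternation_def K_def
    by (simp add: pdiff_diff pdiff_add pdiff_ev pdiff_commute[of "(3, _)" "(Suc 0, _)"] pdiff_commute[of "(3, _)" "(2, _)"]
        pdiff_commute[of "(2, _)" "(Suc 0, _)"] flip: numeral_2_eq_2 numeral_3_eq_3)
  show ?thesis using D unfolding alt Kc by (simp add: K_def Let_def)
qed

text \<open>For the cocycle \<open>F(x, y, z)\<close> let \<open>f\<^sub>b(x, y)\<close> be the derivative in \<open>z\<close> in the direction \<open>b\<close> at \<open>z = 0\<close>.  The
  cocycle equation expresses all derivatives in \<open>z\<close> by \<open>f\<close>, as the differential of \<open>f\<close> without its last term.  Thus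
  \<open>f\<close> would be the derivative of a primitive if it were closed in \<open>y\<close>.  Its exterior derivative \<open>t(x, y)\<close> equals
  \<open>g(y) - g(x + y)\<close> with a two-form \<open>g\<close> in one variable.  The three-form \<open>d g\<close> is translation invariant, so it
  vanishes for reasons of degree if \<open>N > 3\<close>; for \<open>N = 3\<close> it is the antisymmetric part of \<open>F\<close>.  Hence \<open>g = d k\<close>, and
  \<open>e(x, y) = f(x, y) - k(y) + k(x + y)\<close> is closed in \<open>y\<close>.  The correction by \<open>k\<close> cancels in the differential of a
  primitive \<open>\<sigma>\<close> of \<open>e\<close>.\<close>

theorem cohomology_3:
  assumes F: "homog ({1..3} \<times> B') N F" and B': "finite B'" and N: "3 \<le> N"
    and norm: "ev [{1}, {2}, {}] F = 0" "ev [{}, {1}, {2}] F = 0"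
    and cocycle: "ev [{2}, {3}, {4}] F - ev [{1, 2}, {3}, {4}] F + ev [{1}, {2, 3}, {4}] F
      - ev [{1}, {2}, {3, 4}] F + ev [{1}, {2}, {3}] F = 0"
    and alt: "N = 3 \<Longrightarrow> alternation F = 0"
  obtains \<sigma> where "homog ({1..2} \<times> B') N \<sigma>" "ev [{1}, {}] \<sigma> = 0" "ev [{}, {1}] \<sigma> = 0"
    "F = ev [{2}, {3}] \<sigma> - ev [{1, 2}, {3}] \<sigma> + ev [{1}, {2, 3}] \<sigma> - ev [{1}, {2}] \<sigma>"
proof -
  define f where "f b = ev [{1}, {2}, {}] (pdiff (3, b) F)" for b
  have f: "homog ({1..2} \<times> B') (N - 1) (f b)" for b
    unfolding f_def by (intro homog_ev[of 3] homog_pdiff F) auto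
  have id1: "ev [{1}] G = G" "ev [{1}, {}] G = G" if "homog ({1..1} \<times> B') n G" for n G
    by (rule ev_id[OF that], auto simp: sup_sets_Cons)+
  have id2: "ev [{1}, {2}] G = G" if "homog ({1..2} \<times> B') n G" for n G
    by (rule ev_id[OF that]) (auto simp: sup_sets_Cons)
  have id3: "ev [{1}, {2}, {3}] G = G" if "homog ({1..3} \<times> B') n G" for n G
    by (rule ev_id[OF that]) (auto simp: sup_sets_Cons)
  have cut1: "ev [A, {}] G = ev [A] G" for A G
  proof -
    have "sup_sets [A, {}] = sup_sets [A]" by (auto simp: fun_eq_iff sup_sets_Cons)
    then show ?thesis by simp
  qed
  have cut2: "ev [A, C, {}] G = ev [A, C] G" for A C G
  proof -
    have "sup_sets [A, C, {}] = sup_sets [A, C]" by (auto simp: fun_eq_iff sup_sets_Cons)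
    then show ?thesis by simp
  qed
  \<comment> \<open>Differentiate the cocycle equation in its fourth argument, and set this argument to zero.\<close>
  have d: "pdiff (3, b) F = ev [{2}, {3}] (f b) - ev [{1, 2}, {3}] (f b) + ev [{1}, {2, 3}] (f b)" for b
  proof -
    have "pdiff (4, b) (ev [{2}, {3}, {4}] F - ev [{1, 2}, {3}, {4}] F + ev [{1}, {2, 3}, {4}] F
      - ev [{1}, {2}, {3, 4}] F + ev [{1}, {2}, {3}] F) = 0"
      unfolding cocycle by simp
    then have "ev [{2}, {3}, {4}] (pdiff (3, b) F) - ev [{1, 2}, {3}, {4}] (pdiff (3, b) F)
      + ev [{1}, {2, 3}, {4}] (pdiff (3, b) F) - ev [{1}, {2}, {3, 4}] (pdiff (3, b) F) = 0"
      by (simp add: pdiff_diff pdiff_add pdiff_ev flip: numeral_2_eq_2 numeral_3_eq_3)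
    then have "ev [{1}, {2}, {3}, {}] (ev [{2}, {3}, {4}] (pdiff (3, b) F) - ev [{1, 2}, {3}, {4}] (pdiff (3, b) F)
      + ev [{1}, {2, 3}, {4}] (pdiff (3, b) F) - ev [{1}, {2}, {3, 4}] (pdiff (3, b) F)) = 0"
      by simp
    then have "ev [{2}, {3}, {}] (pdiff (3, b) F) - ev [{1, 2}, {3}, {}] (pdiff (3, b) F)
      + ev [{1}, {2, 3}, {}] (pdiff (3, b) F) - ev [{1}, {2}, {3}] (pdiff (3, b) F) = 0"
      by (simp add: isub_hom ev_ev insert_commute)
    moreover have "ev [{1}, {2}, {3}] (pdiff (3, b) F) = pdiff (3, b) F"
      by (rule id3[OF homog_pdiff[OF F]])
    ultimately show ?thesis by (simp add: f_def ev_ev insert_commute algebra_simps)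
  qed
  \<comment> \<open>The exterior derivative of \<open>f\<close> in \<open>y\<close>; the symmetry of the second derivatives of \<open>F\<close> in \<open>z\<close> constrains it.\<close>
  define t where "t a b = pdiff (2, a) (f b) - pdiff (2, b) (f a)" for a b
  have t: "homog ({1..2} \<times> B') (N - 1 - 1) (t a b)" for a b
    unfolding t_def by (intro homog_diff homog_pdiff f)
  define g where "g a b = - ev [{1}] (t a b)" for a b
  have g: "homog ({1..1} \<times> B') (N - 1 - 1) (g a b)" for a b
    unfolding g_def by (intro homog_minus homog_ev[OF t]) auto
  have t_eq: "t a b = ev [{2}] (g a b) - ev [{1, 2}] (g a b)" for a b
  proof -
    have "pdiff (3, a) (pdiff (3, b) F) - pdiff (3, b) (pdiff (3, a) F)
      = ev [{2}, {3}] (t a b) - ev [{1, 2}, {3}] (t a b) + ev [{1}, {2, 3}] (t a b)"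
      unfolding d t_def by (simp add: pdiff_diff pdiff_add pdiff_ev isub_hom flip: numeral_2_eq_2)
    then have "ev [{1}, {2}, {}] (ev [{2}, {3}] (t a b) - ev [{1, 2}, {3}] (t a b) + ev [{1}, {2, 3}] (t a b)) = 0"
      by (simp add: pdiff_commute[of "(3, a)"])
    then have "ev [{2}] (t a b) - ev [{1, 2}] (t a b) + ev [{1}, {2}] (t a b) = 0"
      by (simp add: isub_hom ev_ev insert_commute cut1)
    then have "t a b = ev [{1, 2}] (t a b) - ev [{2}] (t a b)"
      using id2[OF t] by (simp add: algebra_simps)
    moreover have "ev [{1, 2}] (t a b) = - ev [{1, 2}] (g a b)" "ev [{2}] (t a b) = - ev [{2}] (g a b)"
      by (simp_all add: g_def isub_hom ev_ev insert_commute)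
    ultimately show ?thesis by simp
  qed
  have g_anti: "g b a = - g a b" for a b
    by (simp add: g_def t_def isub_hom)
  have g_closed: "pdiff (1, c) (g a b) + pdiff (1, a) (g b c) + pdiff (1, b) (g c a) = 0" for a b c
  proof (cases "N = 3")
    case True
    define K where "K a b c = pdiff (1, a) (pdiff (2, b) (pdiff (3, c) F))" for a b c
    have "homog ({1..3} \<times> B') (N - 1 - 1 - 1) (K a b c)" for a b c
      unfolding K_def by (intro homog_pdiff F)
    then have "homog ({1..3} \<times> B') 0 (K a b c)" for a b c using True by simp
    then have Kc: "ev [{1}] (K a b c) = K a b c" for a b c
      using homog_0_Const[of "{1..3} \<times> B'" "K a b c"] isub_Const by metis
    have "pdiff (1, c) (ev [{1}] (pdiff (2, a) (f b))) = K c a b" for a b c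
    proof -
      have "pdiff (1, c) (ev [{1}] (pdiff (2, a) (f b))) = ev [{1}] (K c a b)"
        unfolding f_def K_def using cut1[of "{1}"] cut2[of "{1}" "{}"]
        by (simp add: pdiff_ev ev_ev flip: numeral_2_eq_2)
      then show ?thesis by (simp only: Kc)
    qed
    then have dg: "pdiff (1, c) (g a b) = K c b a - K c a b" for a b c
      by (simp add: g_def t_def isub_hom pdiff_minus pdiff_diff)
    have "K a b c - K a c b + K b c a - K b a c + K c a b - K c b a = 0"
      using alternation_derivative[OF _ alt[OF True], of B' a b c] F True by (simp add: Let_def K_def)
    then show ?thesis unfolding dg by (simp add: algebra_simps)
  next
    case False
    define C where "C = pdiff (1, c) (g a b) + pdiff (1, a) (g b c) + pdiff (1, b) (g c a)"
    have C: "homog ({1..1} \<times> B') (N - 1 - 1 - 1) C"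
      unfolding C_def by (intro homog_add homog_pdiff g)
    have "pdiff (2, c) (t a b) + pdiff (2, a) (t b c) + pdiff (2, b) (t c a) = 0"
      unfolding t_def by (simp add: pdiff_diff pdiff_commute[of "(2, c)"] pdiff_commute[of "(2, b)" "(2, a)"])
    moreover have "pdiff (2, c) (t a b) = ev [{2}] (pdiff (1, c) (g a b)) - ev [{1, 2}] (pdiff (1, c) (g a b))" for a b c
      unfolding t_eq by (simp add: pdiff_diff pdiff_ev)
    ultimately have "ev [{2}] C = ev [{1, 2}] C"
      by (simp add: C_def isub_hom algebra_simps)
    then have "ev [{1}, {}] (ev [{2}] C) = ev [{1}, {}] (ev [{1, 2}] C)" by simp
    then have "ev [{}] C = ev [{1}] C" by (simp add: ev_ev)
    moreover have "ev [{}] C = 0" using N False by (intro ev_empty[OF C]) auto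
    ultimately show ?thesis using id1[OF C] by (simp add: C_def)
  qed
  have outside: "pdiff (i, b) F = 0" if "b \<notin> B'" for i b
    using homog_vars[OF F] that by (intro pdiff_not_vars) auto
  have f0: "f b = 0" if "b \<notin> B'" for b using outside[OF that] by (simp add: f_def)
  have g0: "g a b = 0" if "a \<notin> B' \<or> b \<notin> B'" for a b
  proof -
    have "pdiff (2, c) (f d) = 0" if "c \<notin> B'" for c d
      using homog_vars[OF f[of d]] that by (intro pdiff_not_vars) auto
    then show ?thesis using that f0 by (auto simp: g_def t_def)
  qed
  \<comment> \<open>The primitive of \<open>g\<close> is its contraction with the Euler vector field, divided by the degree \<open>N\<close> of \<open>g\<close> as a form.\<close>
  define k where "k b = Const (1 / of_nat N) * (\<Sum>a\<in>B'. Var (1, a) * g a b)" for b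
  have k: "homog ({1..1} \<times> B') (N - 1) (k b)" for b
  proof -
    have "homog ({1..1} \<times> B') (Suc 0 + (N - 1 - 1)) (k b)"
      unfolding k_def by (intro homog_Const_mult homog_sum homog_mult homog_Var g) auto
    moreover have "Suc 0 + (N - 1 - 1) = N - 1" using N by linarith
    ultimately show ?thesis by (simp only:)
  qed
  have k_d: "pdiff (1, a) (k b) - pdiff (1, b) (k a) = g a b" for a b
  proof -
    have dk: "pdiff (1, a) (k b) = Const (1 / of_nat N) * (g a b + (\<Sum>c\<in>B'. Var (1, c) * pdiff (1, a) (g c b)))" for a b
    proof -
      have "pdiff (1, a) (\<Sum>c\<in>B'. Var (1, c) * g c b)
        = (\<Sum>c\<in>B'. if a = c then g c b else 0) + (\<Sum>c\<in>B'. Var (1, c) * pdiff (1, a) (g c b))"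
        by (auto simp: pdiff_sum pdiff_mult pdiff_Var simp flip: sum.distrib intro!: sum.cong)
      also have "(\<Sum>c\<in>B'. if a = c then g c b else 0) = g a b"
        using B' g0 by auto
      finally show ?thesis by (simp add: k_def pdiff_Const_mult)
    qed
    have "pdiff (1, a) (g c b) - pdiff (1, b) (g c a) = pdiff (1, c) (g a b)" for c
    proof -
      have solve: "x - y = z" if "z + - x + y = 0" for x y z :: "('g, 'k) pol"
      proof -
        have "x - y = (z + - x + y) + (x - y)" by (simp only: that add_0)
        then show ?thesis by simp
      qed
      have "pdiff (1, a) (g b c) = - pdiff (1, a) (g c b)"
        by (subst g_anti[of b c]) (rule pdiff_minus)
      then show ?thesis using g_closed[of c a b] by (intro solve) (simp only:)
    qed
    then have "(\<Sum>c\<in>B'. Var (1, c) * pdiff (1, a) (g c b)) - (\<Sum>c\<in>B'. Var (1, c) * pdiff (1, b) (g c a))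
      = (\<Sum>c\<in>B'. Var (1, c) * pdiff (1, c) (g a b))"
      by (simp flip: sum_subtractf right_diff_distrib)
    also have "\<dots> = (\<Sum>v\<in>{1..1} \<times> B'. Var v * pdiff v (g a b))"
      by (rule sum.reindex_bij_witness[of _ snd "Pair 1"]) auto
    also have "\<dots> = of_nat (N - 2) * g a b"
      using euler_identity[OF g[of a b]] B' by (simp add: numeral_2_eq_2)
    finally have e: "(\<Sum>c\<in>B'. Var (1, c) * pdiff (1, a) (g c b)) - (\<Sum>c\<in>B'. Var (1, c) * pdiff (1, b) (g c a))
      = of_nat (N - 2) * g a b" .
    have "pdiff (1, a) (k b) - pdiff (1, b) (k a) = Const (1 / of_nat N) * (g a b - g b a
      + ((\<Sum>c\<in>B'. Var (1, c) * pdiff (1, a) (g c b)) - (\<Sum>c\<in>B'. Var (1, c) * pdiff (1, b) (g c a))))"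
      unfolding dk by (simp add: algebra_simps)
    also have "\<dots> = Const (1 / of_nat N) * (of_nat (2 + (N - 2)) * g a b)"
      unfolding e by (simp add: g_anti[of a b] algebra_simps)
    also have "2 + (N - 2) = N" using N by simp
    also have "Const (1 / of_nat N) * (of_nat N * g a b) = g a b"
      using N by (simp flip: mult.assoc Const_of_nat Const_mult)
    finally show ?thesis .
  qed
  define e where "e b = f b - ev [{2}] (k b) + ev [{1, 2}] (k b)" for b
  have e: "homog ({1..2} \<times> B') (N - 1) (e b)" for b
    unfolding e_def by (intro homog_add homog_diff f homog_ev[OF k]) auto
  have e_closed: "pdiff (2, a) (e b) = pdiff (2, b) (e a)" for a b
  proof -
    have "pdiff (2, a) (e b) - pdiff (2, b) (e a) = t a b - ev [{2}] (g a b) + ev [{1, 2}] (g a b)"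
      unfolding e_def t_def k_d[symmetric] by (simp add: pdiff_add pdiff_diff pdiff_ev isub_hom algebra_simps)
    then show ?thesis by (simp add: t_eq)
  qed
  have T: "finite ({2 :: nat} \<times> B')" "{2 :: nat} \<times> B' \<subseteq> {1..2} \<times> B'" using B' by auto
  have T_closed: "pdiff u (e (snd v)) = pdiff v (e (snd u))" if "u \<in> {2} \<times> B'" "v \<in> {2} \<times> B'" for u v
    using that e_closed by auto
  obtain \<sigma> h where s: "\<And>v. v \<in> {2} \<times> B' \<Longrightarrow> pdiff v \<sigma> = e (snd v)" "homog ({1..2} \<times> B') (Suc (N - 1)) \<sigma>"
    and sh: "\<sigma> = (\<Sum>v\<in>{2} \<times> B'. Var v * h v)"
  proof (rule poincare_one_form[of "{2} \<times> B'" "\<lambda>v. e (snd v)" "{1..2} \<times> B'" "N - 1"])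
    fix \<sigma> h
    assume "\<And>v. v \<in> {2} \<times> B' \<Longrightarrow> pdiff v \<sigma> = e (snd v)" "homog ({1..2} \<times> B') (Suc (N - 1)) \<sigma>"
      "\<sigma> = (\<Sum>v\<in>{2} \<times> B'. Var v * h v)"
    then show thesis by (rule that)
  qed (use T T_closed e in auto)
  have sN: "homog ({1..2} \<times> B') N \<sigma>" using s(2) N by simp
  have ds: "pdiff (2, b) \<sigma> = e b" for b
  proof (cases "b \<in> B'")
    case False
    then have "pdiff (2, b) \<sigma> = 0" using homog_vars[OF sN] by (intro pdiff_not_vars) auto
    moreover have "k b = 0" using g0 False by (simp add: k_def)
    ultimately show ?thesis using f0 False by (simp add: e_def)
  qed (use s(1) in force)
  have s1: "ev [{1}, {}] \<sigma> = 0"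
    unfolding sh isub_hom by (intro sum.neutral) (auto simp: isub_Var numeral_2_eq_2)
  have f_norm: "ev [{}, {2}] (f b) = 0" for b
  proof -
    have "pdiff (3, b) (ev [{2}, {3}] (ev [{}, {1}, {2}] F)) = 0" unfolding norm by simp
    then have "ev [{}, {2}, {3}] (pdiff (3, b) F) = 0"
      by (simp add: ev_ev pdiff_ev flip: numeral_2_eq_2 numeral_3_eq_3)
    then have "ev [{}, {2}, {}] (ev [{}, {2}, {3}] (pdiff (3, b) F)) = 0" by simp
    then show ?thesis by (simp add: f_def ev_ev insert_commute)
  qed
  \<comment> \<open>The primitive inherits the normalization in \<open>x\<close> because \<open>e(0, y) = f(0, y) = 0\<close>.\<close>
  have s2: "ev [{}, {2}] \<sigma> = 0"
  proof (rule zero_if_constant_in_slot)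
    show "homog ({1..2} \<times> B') N (ev [{}, {2}] \<sigma>)" by (rule homog_ev[OF sN]) auto
    have "ev [{}, {2}] (e b) = 0" for b
      by (simp add: e_def isub_hom f_norm ev_ev)
    then show "pdiff (2, b) (ev [{}, {2}] \<sigma>) = 0" for b
      using ds[of b] by (simp add: pdiff_ev flip: numeral_2_eq_2)
    show "sup_sets [{1}, {}] j = (if j = 2 then {} else {j})" if "j \<in> {1..2}" for j
      using that by (auto simp: sup_sets_Cons)
    have "ev [{}, {}] \<sigma> = 0" using N by (intro ev_empty[OF sN]) auto
    then show "ev [{1}, {}] (ev [{}, {2}] \<sigma>) = 0" by (simp add: ev_ev)
  qed
  have s2': "ev [{}, {1}] \<sigma> = 0"
  proof -
    have "ev [{}, {1}] \<sigma> = ev [{}, {1}] (ev [{}, {2}] \<sigma>)" by (simp add: ev_ev)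
    then show ?thesis by (simp add: s2)
  qed
  \<comment> \<open>The two sides have the same derivatives in \<open>z\<close>, and both vanish at \<open>z = 0\<close>.\<close>
  let ?d = "ev [{2}, {3}] \<sigma> - ev [{1, 2}, {3}] \<sigma> + ev [{1}, {2, 3}] \<sigma> - ev [{1}, {2}] \<sigma>"
  have "F - ?d = 0"
  proof (rule zero_if_constant_in_slot)
    show "homog ({1..3} \<times> B') N (F - ?d)"
      by (intro homog_diff homog_add F homog_ev[OF sN]) auto
    show "pdiff (3, b) (F - ?d) = 0" for b
      using ds[of b] by (simp add: pdiff_diff pdiff_add pdiff_ev d e_def isub_hom ev_ev insert_commute flip: numeral_2_eq_2)
    show "sup_sets [{1}, {2}, {}] j = (if j = 3 then {} else {j})" if "j \<in> {1..3}" for j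
    proof -
      have "j = 1 \<or> j = 2 \<or> j = 3" using that by auto
      then show ?thesis by auto
    qed
    have "ev [{2}, {}] \<sigma> = 0" "ev [{1, 2}, {}] \<sigma> = 0"
    proof -
      have "ev [{2}, {}] \<sigma> = ev [{2}] (ev [{1}, {}] \<sigma>)" "ev [{1, 2}, {}] \<sigma> = ev [{1, 2}] (ev [{1}, {}] \<sigma>)"
        by (simp_all add: ev_ev)
      then show "ev [{2}, {}] \<sigma> = 0" "ev [{1, 2}, {}] \<sigma> = 0" by (simp_all only: s1 isub_0)
    qed
    then show "ev [{1}, {2}, {}] (F - ?d) = 0"
      using norm by (simp add: isub_hom ev_ev insert_commute)
  qed
  then have "F = ?d" by simp
  then show thesis by (rule that[OF sN s1 s2'])
qed

end

section \<open>Functions that vanish when one argument vanishes\<close>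

definition involves :: "nat \<Rightarrow> ('g, 'k::field_char_0) pol \<Rightarrow> bool" where
  "involves a F \<longleftrightarrow> (\<forall>m\<in>keys F. \<exists>b. (a, b) \<in> keys m)"

lemma involves_isub_0:
  fixes F :: "('g, 'k::field_char_0) pol"
  assumes "involves a F" "S a = {}"
  shows "isub S F = 0"
  unfolding isub_def psubst_def
proof (rule sum.neutral, rule ballI)
  fix m assume "m \<in> keys F"
  then obtain b where b: "(a, b) \<in> keys m" using assms(1) by (auto simp: involves_def)
  have "(\<Prod>v\<in>keys m. (case v of (i, b) \<Rightarrow> \<Sum>a\<in>S i. Var (a, b)) ^ lookup m v) = (0 :: ('g, 'k) pol)"
    by (rule prod_zero[OF finite_keys], rule bexI[OF _ b]) (use b assms(2) in \<open>auto simp: in_keys_iff power_0_left\<close>)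
  then show "Const (lookup F m) *
      (\<Prod>v\<in>keys m. (case v of (i, b) \<Rightarrow> \<Sum>a\<in>S i. Var (a, b)) ^ lookup m v) = 0"
    by (simp only: mult_zero_right)
qed

text \<open>The monomials that do not involve \<open>a\<close> survive the substitution unchanged.\<close>

lemma isub_0_involves:
  assumes F: "vars F \<subseteq> K \<times> UNIV" and S: "\<And>j. j \<in> K \<Longrightarrow> S j = (if j = a then {} else {j})" and z: "isub S F = 0"
  shows "involves a F"
proof -
  define A where "A = {m \<in> keys F. \<exists>b. (a, b) \<in> keys m}"
  define part where "part C = (\<Sum>m\<in>C. single m (lookup F m))" for C
  have keys_part: "keys (part C) = C" if "C \<subseteq> keys F" for C
  proof -
    have "finite C" using finite_subset[OF that] by simp
    then have "lookup (part C) m = (if m \<in> C then lookup F m else 0)" for m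
      by (simp add: part_def lookup_sum lookup_single when_def)
    then show ?thesis using that by (auto simp: in_keys_iff split: if_splits)
  qed
  have F_eq: "F = part A + part (keys F - A)"
    using sum.subset_diff[of A "keys F" "\<lambda>m. single m (lookup F m)"]
    by (subst poly_mapping_eq_sum) (simp add: part_def A_def add.commute)
  have "involves a (part A)"
    by (subst involves_def, subst keys_part) (auto simp: A_def)
  moreover have "A = {}" if "a \<notin> K" using F that by (auto simp: A_def vars_def)
  ultimately have "isub S (part A) = 0"
    by (cases "a \<in> K") (auto intro: involves_isub_0 simp: S part_def)
  have "isub S (part (keys F - A)) = part (keys F - A)"
  proof (rule isub_id)
    have "vars (part (keys F - A)) \<subseteq> vars F"
      by (simp add: vars_def keys_part) blast
    moreover have "(a, b) \<notin> vars (part (keys F - A))" for b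
      by (auto simp add: vars_def keys_part A_def)
    ultimately show "vars (part (keys F - A)) \<subseteq> (K - {a}) \<times> UNIV" using F by fastforce
  qed (use S in auto)
  then have "part (keys F - A) = 0"
    using z \<open>isub S (part A) = 0\<close> by (subst (asm) F_eq) (simp add: isub_hom)
  then have "keys F - A = {}" using keys_part[of "keys F - A"] by simp
  then show ?thesis by (auto simp: involves_def A_def)
qed

text \<open>The letter in position \<open>i\<close> of the word becomes a variable of the factor \<open>i + 1\<close>.\<close>

definition word_monom :: "'g list \<Rightarrow> (nat \<times> 'g) \<Rightarrow>\<^sub>0 nat" where
  "word_monom w = (\<Sum>i<length w. single (i + 1, w ! i) 1)"

lemma lookup_word_monom:
  "lookup (word_monom w) (a, b) = (if 1 \<le> a \<and> a \<le> length w \<and> w ! (a - 1) = b then 1 else 0)"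
proof -
  have "lookup (word_monom w) (a, b) = (\<Sum>i<length w. if Suc i = a \<and> w ! i = b then 1 else 0)"
    unfolding word_monom_def lookup_sum by (intro sum.cong) (auto simp: lookup_single when_def)
  also have "\<dots> = (if 1 \<le> a \<and> a \<le> length w \<and> w ! (a - 1) = b then 1 else 0)"
  proof (cases a)
    case (Suc n)
    have "(\<Sum>i<length w. if Suc i = a \<and> w ! i = b then 1 else 0 :: nat)
      = (\<Sum>i\<in>{..<length w}. if i = n then (if w ! n = b then 1 else 0) else 0)"
      by (intro sum.cong) (auto simp: Suc)
    then show ?thesis by (simp add: Suc Suc_le_eq)
  qed simp
  finally show ?thesis .
qed

lemma word_monom_inj: "length w = length w' \<Longrightarrow> word_monom w = word_monom w' \<Longrightarrow> w = w'"
proof (rule nth_equalityI)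
  fix i assume len: "length w = length w'" and eq: "word_monom w = word_monom w'" and i: "i < length w"
  have "lookup (word_monom w) (i + 1, w ! i) = 1" using i by (simp add: lookup_word_monom)
  then show "w ! i = w' ! i" unfolding eq lookup_word_monom by (auto split: if_splits)
qed

lemma mdeg_word_monom: "mdeg (word_monom w) = length w"
proof -
  have "mdeg (\<Sum>i<n. single (i + 1, w ! i) 1) = n" for n
    by (induction n) (auto simp: mdeg_add)
  then show ?thesis by (simp add: word_monom_def)
qed

lemma keys_word_monom: "keys (word_monom w) = {(i + 1, w ! i) | i. i < length w}"
proof -
  have "(a, b) \<in> keys (word_monom w) \<longleftrightarrow> (a, b) \<in> {(i + 1, w ! i) | i. i < length w}" for a b
    by (cases a) (auto simp: in_keys_iff lookup_word_monom)
  then show ?thesis by auto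
qed

text \<open>Choosing one variable from each factor splits off a multilinear monomial; in the lowest possible
  degree nothing else remains.\<close>

lemma monom_involving_all:
  assumes "\<And>a. a \<in> {1..k} \<Longrightarrow> \<exists>b. (a, b) \<in> keys m"
  obtains w m' where "length w = k" "m = word_monom w + m'"
proof -
  from assms obtain f where f: "\<And>a. a \<in> {1..k} \<Longrightarrow> (a, f a) \<in> keys m" by metis
  define w where "w = map (\<lambda>i. f (i + 1)) [0..<k]"
  have "m = word_monom w + (m - word_monom w)"
  proof (rule poly_mapping_eqI)
    fix v :: "nat \<times> 'a"
    obtain a b where v: "v = (a, b)" by (cases v)
    have "lookup (word_monom w) (a, b) \<le> lookup m (a, b)"
      using f[of a] by (auto simp: lookup_word_monom w_def in_keys_iff)
    then show "lookup m v = lookup (word_monom w + (m - word_monom w)) v"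
      by (simp add: v lookup_add lookup_minus)
  qed
  then show thesis by (intro that[of w]) (simp add: w_def)
qed

lemma mdeg_eq_0: "mdeg m = 0 \<Longrightarrow> m = 0"
proof (rule poly_mapping_eqI)
  fix v assume "mdeg m = 0"
  then show "lookup m v = lookup 0 v"
    by (cases v; cases "v \<in> keys m") (auto simp: mdeg_def in_keys_iff)
qed

lemma involves_all_degree:
  assumes F: "homog V n F" "\<And>a. a \<in> {1..k} \<Longrightarrow> involves a F" and n: "n < k"
  shows "F = 0"
proof (rule ccontr)
  assume "F \<noteq> 0"
  then obtain m where m: "m \<in> keys F" by (metis all_not_in_conv keys_eq_empty)
  then obtain w m' where "length w = k" "m = word_monom w + m'"
    using monom_involving_all[of k m] F(2) by (auto simp: involves_def)
  then have "k \<le> mdeg m" by (simp add: mdeg_add mdeg_word_monom)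
  then show False using m F(1) n by (auto simp: homog_def)
qed

section \<open>Tensors as multilinear polynomials\<close>

text \<open>This identifies tensors with the polynomials that are linear in each factor, so that permutations of
  tensor factors become insertions and \<open>CYB\<close> becomes a sum of Poisson brackets.\<close>

definition tpoly :: "('g, 'k::field_char_0) tensor \<Rightarrow> ('g, 'k) pol" where
  "tpoly t = (\<Sum>w\<in>keys t. single (word_monom w) (lookup t w))"

lemma tpoly_add: "tpoly (s + t) = tpoly s + tpoly t"
  unfolding tpoly_def
  by (rule setsum_keys_plus_distrib[where f = "\<lambda>w c. single (word_monom w) c"]) (auto simp: single_add)

lemma tpoly_0 [simp]: "tpoly 0 = 0" by (simp add: tpoly_def)

lemma tpoly_sum: "tpoly (\<Sum>i\<in>A. t i) = (\<Sum>i\<in>A. tpoly (t i))"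
  by (rule sum_additive) (auto simp: tpoly_add)

lemma tpoly_single: "tpoly (single w c) = single (word_monom w) c"
  by (cases "c = 0") (auto simp: tpoly_def)

lemma tscale_add: "tscale c (s + t) = tscale c s + tscale c t"
  by (rule poly_mapping_eqI) (simp add: tscale_def Poly_Mapping.map.rep_eq lookup_add when_def flip: distrib_left)

lemma tscale_single: "tscale c (single w d) = single w (c * d)"
  by (simp add: tscale_def)

lemma tpoly_tscale: "tpoly (tscale c t) = Const c * tpoly t"
  by (induction t rule: poly_mapping_single_induct)
    (auto simp: tscale_single tpoly_single Const_mult_single tscale_add tpoly_add algebra_simps)

lemma single_word_monom_3:
  "single (word_monom [x, y, z]) c = Const c * Var (1, x) * Var (2, y) * Var (3, z)"
  by (simp add: word_monom_def Const_def Var_def mult_single eval_nat_numeral lessThan_Suc add_ac)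

lemma single_word_monom_2:
  "single (word_monom [x, y]) c = Const c * Var (1, x) * Var (2, y)"
  by (simp add: word_monom_def Const_def Var_def mult_single eval_nat_numeral lessThan_Suc add_ac)

lemma finite_multilinear_support:
  "finite {w. length w = k \<and> lookup F (word_monom w) \<noteq> 0}"
proof (rule finite_imageD)
  show "finite (word_monom ` {w. length w = k \<and> lookup F (word_monom w) \<noteq> 0})"
    by (rule finite_subset[of _ "keys F"]) (auto simp: in_keys_iff)
  show "inj_on word_monom {w. length w = k \<and> lookup F (word_monom w) \<noteq> 0}"
    by (auto intro!: inj_onI word_monom_inj)
qed

lemma lookup_multilinear_part:
  "lookup (multilinear_part k f) w
    = (if length w = k then lookup (f k) (word_monom w) else 0)"
proof -
  have "{w. (if length w = k then lookup (f k) (\<Sum>i<k. single (i + 1, w ! i) 1) else 0) \<noteq> 0}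
    \<subseteq> {w. length w = k \<and> lookup (f k) (word_monom w) \<noteq> 0}"
    by (auto simp: word_monom_def split: if_splits)
  then have fin: "finite {w. (if length w = k then lookup (f k) (\<Sum>i<k. single (i + 1, w ! i) 1) else 0) \<noteq> 0}"
    using finite_subset finite_multilinear_support by fast
  show ?thesis
    unfolding multilinear_part_def lookup_Abs_poly_mapping[OF fin] by (auto simp: word_monom_def)
qed

lemma lookup_tpoly:
  assumes t: "\<And>w. w \<in> keys t \<Longrightarrow> length w = k" and w: "length w = k"
  shows "lookup (tpoly t) (word_monom w) = lookup t w"
proof -
  have "lookup (tpoly t) (word_monom w) = (\<Sum>u\<in>keys t. if u = w then lookup t w else 0)"
    unfolding tpoly_def lookup_sum
    by (intro sum.cong refl) (auto simp: lookup_single when_def dest!: t intro: word_monom_inj simp: w)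
  then show ?thesis by (simp add: in_keys_iff)
qed

lemma tpoly_multilinear_part:
  assumes F: "homog V k (f k)" "\<And>a. a \<in> {1..k} \<Longrightarrow> involves a (f k)"
  shows "tpoly (multilinear_part k f) = f k"
proof (rule poly_mapping_eqI)
  fix m
  let ?t = "multilinear_part k f"
  have t: "length w = k" if "w \<in> keys ?t" for w
    using that by (auto simp: in_keys_iff lookup_multilinear_part split: if_splits)
  show "lookup (tpoly ?t) m = lookup (f k) m"
  proof (cases "\<exists>w. length w = k \<and> m = word_monom w")
    case True
    then show ?thesis using lookup_tpoly[of ?t k, OF t] by (auto simp: lookup_multilinear_part)
  next
    case False
    have "m \<notin> keys (f k)"
    proof
      assume m: "m \<in> keys (f k)"
      then obtain w m' where w: "length w = k" "m = word_monom w + m'"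
        using monom_involving_all[of k m] F(2) by (auto simp: involves_def)
      have "mdeg m = k" using m F(1) by (auto simp: homog_def)
      then have "m' = 0" using w by (intro mdeg_eq_0) (simp add: mdeg_add mdeg_word_monom)
      then have "m = word_monom w" using w(2) by simp
      with w(1) False show False by blast
    qed
    moreover have "lookup (tpoly ?t) m = 0"
      unfolding tpoly_def lookup_sum using False t by (intro sum.neutral) (auto simp: lookup_single when_def)
    ultimately show ?thesis by (simp add: in_keys_iff)
  qed
qed

lemma multilinear_part_tpoly:
  assumes t: "\<And>w. w \<in> keys t \<Longrightarrow> length w = k" and f: "f k = tpoly t"
  shows "multilinear_part k f = t"
proof (rule poly_mapping_eqI)
  fix w show "lookup (multilinear_part k f) w = lookup t w"
    using lookup_tpoly[of t k w, OF t] t[of w] by (auto simp: lookup_multilinear_part f in_keys_iff)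
qed

lemma homog_tpoly:
  assumes "\<And>w. w \<in> keys t \<Longrightarrow> length w = k \<and> set w \<subseteq> B"
  shows "homog ({1..k} \<times> B) k (tpoly t)" "a \<in> {1..k} \<Longrightarrow> involves a (tpoly t)"
proof -
  have key: "\<exists>w\<in>keys t. m = word_monom w" if "m \<in> keys (tpoly t)" for m
    using that keys_sum[of "\<lambda>w. single (word_monom w) (lookup t w)" "keys t"]
    by (auto simp: tpoly_def split: if_splits)
  show "homog ({1..k} \<times> B) k (tpoly t)"
    unfolding homog_def
  proof
    fix m assume "m \<in> keys (tpoly t)"
    then obtain w where w: "w \<in> keys t" "m = word_monom w" using key by blast
    then show "mdeg m = k \<and> keys m \<subseteq> {1..k} \<times> B"
      using assms[OF w(1)] by (auto simp: mdeg_word_monom keys_word_monom)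
  qed
  show "involves a (tpoly t)" if "a \<in> {1..k}"
    unfolding involves_def
  proof
    fix m assume "m \<in> keys (tpoly t)"
    then obtain w where w: "w \<in> keys t" "m = word_monom w" using key by blast
    then have "(a, w ! (a - 1)) \<in> keys m"
      using assms[OF w(1)] that by (simp add: in_keys_iff lookup_word_monom)
    then show "\<exists>b. (a, b) \<in> keys m" ..
  qed
qed

section \<open>Antisymmetrization\<close>

lemma tpoly_tpermute:
  assumes t: "\<And>w. w \<in> keys t \<Longrightarrow> length w = 3"
  shows "tpoly (tpermute \<sigma> t) = (\<Sum>w\<in>keys t. Const (lookup t w) *
    Var (1, w ! \<sigma> 0) * Var (2, w ! \<sigma> 1) * Var (3, w ! \<sigma> 2))"
  unfolding tpermute_def tpoly_sum tpoly_single
proof (rule sum.cong[OF refl])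
  fix w assume "w \<in> keys t"
  then have "length w = 3" by (rule t)
  then have "permute_list \<sigma> w = [w ! \<sigma> 0, w ! \<sigma> 1, w ! \<sigma> 2]"
    by (simp add: permute_list_def eval_nat_numeral)
  then show "single (word_monom (permute_list \<sigma> w)) (lookup t w)
    = Const (lookup t w) * Var (1, w ! \<sigma> 0) * Var (2, w ! \<sigma> 1) * Var (3, w ! \<sigma> 2)"
    by (simp only: single_word_monom_3)
qed

context lie_algebra_basis
begin

lemma tpoly_Alt3:
  assumes t: "\<And>w. w \<in> keys t \<Longrightarrow> length w = 3"
  shows "tpoly (Alt3 t) = Const (1 / 4) * alternation (tpoly t)"
proof -
  let ?M = "\<lambda>i j k. \<Sum>w\<in>keys t. Const (lookup t w) * Var (1, w ! i) * Var (2, w ! j) * Var (3, w ! k)"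
  have t_eq: "tpoly t = ?M 0 1 2"
    unfolding tpoly_def
  proof (rule sum.cong[OF refl])
    fix w assume "w \<in> keys t"
    then have "length w = 3" by (rule t)
    then have "w = [w ! 0, w ! 1, w ! 2]" by (auto simp: eval_nat_numeral length_Suc_conv)
    then show "single (word_monom w) (lookup t w)
      = Const (lookup t w) * Var (1, w ! 0) * Var (2, w ! 1) * Var (3, w ! 2)"
      using single_word_monom_3[of "w ! 0" "w ! 1" "w ! 2" "lookup t w"] by metis
  qed
  have set3: "{..<3} = insert 0 (insert 1 (insert (2 :: nat) {}))" by auto
  have "tpoly (Alt3 t) = Const (1 / 4) * (\<Sum>\<sigma> | \<sigma> permutes {..<3}. Const (of_int (sign \<sigma>)) * ?M (\<sigma> 0) (\<sigma> 1) (\<sigma> 2))"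
    by (simp add: Alt3_def tpoly_tscale tpoly_sum tpoly_tpermute[OF t])
  also have "(\<Sum>\<sigma> | \<sigma> permutes {..<3}. Const (of_int (sign \<sigma>)) * ?M (\<sigma> 0) (\<sigma> 1) (\<sigma> 2))
    = ?M 0 1 2 - ?M 0 2 1 - ?M 1 0 2 + ?M 1 2 0 - ?M 2 1 0 + ?M 2 0 1"
    unfolding set3
    by (simp add: sum_over_permutations_insert sign_compose permutation_compose sign_swap_id permutation_swap_id
        Const_minus transpose_def)
  also have "\<dots> = alternation (tpoly t)"
    unfolding alternation_def t_eq isub_hom isub_Const isub_Var by (simp add: algebra_simps)
  finally show ?thesis .
qed

lemma sum_triple_product:
  fixes f g h :: "'i \<Rightarrow> 'r::comm_semiring_0"
  shows "(\<Sum>(a, b, c)\<in>X \<times> Y \<times> Z. f a * (g b * h c)) = sum f X * (sum g Y * sum h Z)"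
proof -
  have "(\<Sum>(a, b, c)\<in>X \<times> Y \<times> Z. f a * (g b * h c)) = (\<Sum>a\<in>X. \<Sum>(b, c)\<in>Y \<times> Z. f a * (g b * h c))"
    by (simp add: sum.cartesian_product split_beta)
  also have "\<dots> = (\<Sum>a\<in>X. \<Sum>b\<in>Y. \<Sum>c\<in>Z. f a * (g b * h c))"
    by (simp add: sum.cartesian_product split_beta)
  also have "\<dots> = sum f X * (sum g Y * sum h Z)"
    by (simp only: sum_distrib_left[symmetric] sum_distrib_right[symmetric])
  finally show ?thesis .
qed

lemma tpoly_pure_3: "tpoly (pure [x, y, z]) = lin 1 x * lin 2 y * lin 3 z"
proof -
  let ?S = "\<lambda>x. {b. representation B x b \<noteq> 0}"
  let ?r = "representation B"
  have ls: "listset (map ?S [x, y, z]) = (\<lambda>(a, b, c). [a, b, c]) ` (?S x \<times> ?S y \<times> ?S z)"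
    by (auto simp: set_Cons_def image_iff)
  have "tpoly (pure [x, y, z]) = (\<Sum>(a, b, c)\<in>?S x \<times> ?S y \<times> ?S z.
      Const (?r x a) * Var (1, a) * (Const (?r y b) * Var (2, b) * (Const (?r z c) * Var (3, c))))"
    unfolding pure_def tpoly_sum ls
    by (subst sum.reindex) (auto simp: inj_on_def tpoly_single single_word_monom_3 eval_nat_numeral lessThan_Suc
        Const_mult mult_ac intro!: sum.cong)
  also have "\<dots> = lin 1 x * (lin 2 y * lin 3 z)"
    unfolding lin_def by (rule sum_triple_product)
  finally show ?thesis by (simp only: mult.assoc)
qed

text \<open>The element \<open>r\<close>, placed in the factors \<open>i\<close> and \<open>j\<close>.\<close>

definition rpol :: "('g, 'k) tensor \<Rightarrow> nat \<Rightarrow> nat \<Rightarrow> ('g, 'k) pol" where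
  "rpol r i j = (\<Sum>w\<in>keys r. Const (lookup r w) * Var (i, w ! 0) * Var (j, w ! 1))"

lemma tensor_space_2:
  assumes "r \<in> tensor_space 2" "w \<in> keys r"
  shows "length w = 2" "w = [w ! 0, w ! 1]" "w ! 0 \<in> B" "w ! 1 \<in> B"
proof -
  show l: "length w = 2" using assms by (auto simp: tensor_space_def)
  then show "w = [w ! 0, w ! 1]" by (auto simp: eval_nat_numeral length_Suc_conv)
  have "set w \<subseteq> B" using assms by (auto simp: tensor_space_def)
  then show "w ! 0 \<in> B" "w ! 1 \<in> B" using l by (auto simp: subset_iff)
qed

lemma tpoly_2: "r \<in> tensor_space 2 \<Longrightarrow> tpoly r = rpol r 1 2"
  unfolding tpoly_def rpol_def
proof (rule sum.cong[OF refl])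
  fix w assume "r \<in> tensor_space 2" "w \<in> keys r"
  then show "single (word_monom w) (lookup r w)
      = Const (lookup r w) * Var (1, w ! 0) * Var (2, w ! 1)"
    using single_word_monom_2[of "w ! 0" "w ! 1" "lookup r w"] tensor_space_2(2)[of r w] by metis
qed

lemma ev_rpol: "sup_sets P i = {i'} \<Longrightarrow> sup_sets P j = {j'} \<Longrightarrow> ev P (rpol r i j) = rpol r i' j'"
  unfolding rpol_def isub_hom isub_Const isub_Var by simp

lemma ev_rpol_sum:
  "sup_sets P i = {i', i''} \<Longrightarrow> i' \<noteq> i'' \<Longrightarrow> sup_sets P j = {j'} \<Longrightarrow> ev P (rpol r i j) = rpol r i' j' + rpol r i'' j'"
  "sup_sets P i = {i'} \<Longrightarrow> sup_sets P j = {j', j''} \<Longrightarrow> j' \<noteq> j'' \<Longrightarrow> ev P (rpol r i j) = rpol r i' j' + rpol r i' j''"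
  unfolding rpol_def isub_hom isub_Const isub_Var by (simp_all add: algebra_simps sum.distrib)

lemma rpol_antisym:
  assumes r: "r \<in> wedge 2"
  shows "rpol r j i = - rpol r i j"
proof -
  have t: "r \<in> tensor_space 2" using r by (simp add: wedge_def)
  let ?\<sigma> = "transpose 0 (1 :: nat)"
  have perm: "?\<sigma> permutes {..<2}" by (rule permutes_swap_id) auto
  have "tpoly (tpermute ?\<sigma> r) = (\<Sum>w\<in>keys r. Const (lookup r w) * Var (1, w ! 1) * Var (2, w ! 0))"
    unfolding tpermute_def tpoly_sum tpoly_single
  proof (rule sum.cong[OF refl])
    fix w assume "w \<in> keys r"
    then have "length w = 2" using tensor_space_2[OF t] by blast
    then have "permute_list ?\<sigma> w = [w ! 1, w ! 0]"
      by (simp add: permute_list_def eval_nat_numeral)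
    then show "single (word_monom (permute_list ?\<sigma> w)) (lookup r w)
      = Const (lookup r w) * Var (1, w ! 1) * Var (2, w ! 0)"
      by (simp only: single_word_monom_2)
  qed
  also have "\<dots> = rpol r 2 1"
    unfolding rpol_def by (simp add: mult_ac)
  finally have 1: "tpoly (tpermute ?\<sigma> r) = rpol r 2 1" .
  have "tpermute ?\<sigma> r = tscale (of_int (sign ?\<sigma>)) r" using r perm by (auto simp: wedge_def)
  then have "rpol r 2 1 = - rpol r 1 2"
    using 1 by (simp add: tpoly_tscale tpoly_2[OF t] sign_swap_id Const_minus)
  then have "ev [{i}, {j}] (rpol r 2 1) = ev [{i}, {j}] (- rpol r 1 2)" by simp
  then show ?thesis
    unfolding isub_hom using ev_rpol[of "[{i}, {j}]" 2 j 1 i r] ev_rpol[of "[{i}, {j}]" 1 i 2 j r] by simp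
qed

lemma tpoly_CYB:
  assumes r: "r \<in> tensor_space 2"
  shows "tpoly (CYB r) = pol_bracket (rpol r 1 2) (rpol r 1 3) + pol_bracket (rpol r 1 2) (rpol r 2 3)
    + pol_bracket (rpol r 1 3) (rpol r 2 3)"
proof -
  have basis: "lin a (w ! 0) = Var (a, w ! 0)" "lin a (w ! 1) = Var (a, w ! 1)" if "w \<in> keys r" for a w
    using tensor_space_2[OF r that] by (simp_all add: lin_basis)
  have "tpoly (CYB r) = (\<Sum>u\<in>keys r. \<Sum>v\<in>keys r.
     Const (lookup r u) * Const (lookup r v) *
       (lin 1 (br (u ! 0) (v ! 0)) * Var (2, u ! 1) * Var (3, v ! 1)
       + Var (1, u ! 0) * lin 2 (br (u ! 1) (v ! 0)) * Var (3, v ! 1)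
       + Var (1, u ! 0) * Var (2, v ! 0) * lin 3 (br (u ! 1) (v ! 1))))"
    unfolding CYB_def tpoly_sum tpoly_tscale tpoly_add tpoly_pure_3
    by (intro sum.cong refl) (simp only: basis Const_mult)
  moreover have "pol_bracket (rpol r i j) (rpol r k l) = (\<Sum>u\<in>keys r. \<Sum>v\<in>keys r.
     Const (lookup r u) * Const (lookup r v) *
       (structure_fun (i, u ! 0) (k, v ! 0) * Var (j, u ! 1) * Var (l, v ! 1)
       + structure_fun (i, u ! 0) (l, v ! 1) * Var (j, u ! 1) * Var (k, v ! 0)
       + structure_fun (j, u ! 1) (k, v ! 0) * Var (i, u ! 0) * Var (l, v ! 1)
       + structure_fun (j, u ! 1) (l, v ! 1) * Var (i, u ! 0) * Var (k, v ! 0)))" for i j k l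
    unfolding rpol_def pol_bracket_sum_left unfolding pol_bracket_sum_right
    by (intro sum.cong refl)
      (simp add: pol_bracket_mult_left pol_bracket_mult_right pol_bracket_Var algebra_simps)
  ultimately show ?thesis
    by (simp add: structure_fun_def algebra_simps sum.distrib)
qed

text \<open>By the antisymmetry of \<open>r\<close>, permuting the factors permutes the three brackets in \<open>CYB r\<close> up to sign, and
  each of them is fixed up to sign by one transposition.\<close>

lemma alternation_CYB:
  assumes r: "r \<in> wedge 2"
  defines "C \<equiv> pol_bracket (rpol r 1 2) (rpol r 1 3) + pol_bracket (rpol r 1 2) (rpol r 2 3)
    + pol_bracket (rpol r 1 3) (rpol r 2 3)"
  shows "alternation C = of_nat 6 * C" "alternation (pol_bracket (rpol r 1 2) (rpol r 2 3)) = of_nat 2 * C"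
proof -
  have br: "ev P (pol_bracket F G) = pol_bracket (ev P F) (ev P G)" if "disj P" for P F G
    using that by (intro isub_pol_bracket disjoint_sup_sets)
  have anti: "rpol r 2 (Suc 0) = - rpol r (Suc 0) 2" "rpol r 3 (Suc 0) = - rpol r (Suc 0) 3" "rpol r 3 2 = - rpol r 2 3"
    by (rule rpol_antisym[OF r])+
  have anti2: "pol_bracket (rpol r (Suc 0) 3) (rpol r (Suc 0) 2) = - pol_bracket (rpol r (Suc 0) 2) (rpol r (Suc 0) 3)"
    "pol_bracket (rpol r 2 3) (rpol r (Suc 0) 2) = - pol_bracket (rpol r (Suc 0) 2) (rpol r 2 3)"
    "pol_bracket (rpol r 2 3) (rpol r (Suc 0) 3) = - pol_bracket (rpol r (Suc 0) 3) (rpol r 2 3)"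
    by (rule pol_bracket_antisym)+
  show "alternation C = of_nat 6 * C" "alternation (pol_bracket (rpol r 1 2) (rpol r 2 3)) = of_nat 2 * C"
    by (simp_all add: C_def alternation_def isub_hom br ev_rpol anti anti2 pol_bracket_minus algebra_simps)
qed

section \<open>Formal functions with vanishing conditions\<close>

lemma max_ideal_tensor_iff:
  "f \<in> max_ideal_tensor k \<longleftrightarrow> f \<in> \<O> k \<and> (\<forall>n. \<forall>a\<in>{1..k}. involves a (f n))"
  by (auto simp: max_ideal_tensor_def involves_def)

lemma max_ideal_tensor_low: "f \<in> max_ideal_tensor k \<Longrightarrow> n < k \<Longrightarrow> f n = 0"
  using involves_all_degree[of "{1..k} \<times> B" n "f n" k] by (auto simp: max_ideal_tensor_iff \<O>_iff)

lemma order2_max_ideal_tensor: "f \<in> max_ideal_tensor k \<Longrightarrow> 2 \<le> k \<Longrightarrow> order2 f"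
  using max_ideal_tensor_low[of f k] by (auto simp: order2_def)

abbreviation evf :: "nat set list \<Rightarrow> ('g, 'k) formal \<Rightarrow> ('g, 'k) formal" where
  "evf P \<equiv> isubf (sup_sets P)"

lemma evf_star: "disj P \<Longrightarrow> evf P (f \<star> g) = evf P f \<star> evf P g"
  by (intro isubf_star disjoint_sup_sets)

lemma evf_evf: "disj P \<Longrightarrow> disj Q \<Longrightarrow> evf Q (evf P f) = evf (map (\<lambda>A. \<Union>a\<in>A. sup_sets Q a) P) f"
  by (simp add: isubf_def ev_ev)

lemma evf_vanish: "f \<in> max_ideal_tensor k \<Longrightarrow> a \<in> {1..k} \<Longrightarrow> sup_sets P a = {} \<Longrightarrow> evf P f = 0"
proof
  fix n assume "f \<in> max_ideal_tensor k" "a \<in> {1..k}" "sup_sets P a = {}"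
  then show "evf P f n = 0 n" by (simp add: isubf_def max_ideal_tensor_iff involves_isub_0[of a])
qed

lemma evf_id: "f \<in> \<O> k \<Longrightarrow> (\<And>i. i \<in> {1..k} \<Longrightarrow> sup_sets P i = {i}) \<Longrightarrow> evf P f = f"
  by (rule isubf_id)

lemma evf_\<O>: "f \<in> \<O> k \<Longrightarrow> \<Union>(set P) \<subseteq> {1..l} \<Longrightarrow> evf P f \<in> \<O> l"
  unfolding \<O>_iff isubf_def using homog_ev[of k B] by blast

lemma evf_invariant:
  assumes f: "f \<in> invariants" "f \<in> \<O> (length P)" and P: "disj P"
    and Q: "\<And>C. C \<in> set Q \<Longrightarrow> finite C \<and> (\<Union>(set P) \<subseteq> C \<or> \<Union>(set P) \<inter> C = {})"
  shows "bracket (evf P f) (evf Q g) = 0"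
proof (rule bracket_invariant[OF f(1) \<O>_vars[OF f(2)]])
  show "disjoint_sets (sup_sets P)" by (rule disjoint_sup_sets[OF P])
  have sub: "(\<Union>j\<in>{1..length P}. sup_sets P j) \<subseteq> \<Union>(set P)"
    using sup_sets_cases[of P] by blast
  show "finite (sup_sets Q i)" for i using sup_sets_cases[of Q i] Q by auto
  show "(\<Union>j\<in>{1..length P}. sup_sets P j) \<subseteq> sup_sets Q i \<or> (\<Union>j\<in>{1..length P}. sup_sets P j) \<inter> sup_sets Q i = {}" for i
    using sup_sets_cases[of Q i] Q[of "sup_sets Q i"] sub by blast
qed simp

lemma evf_separate:
  assumes "\<Union>(set P) \<inter> \<Union>(set Q) = {}"
  shows "bracket (evf P f) (evf Q g) = 0"
proof (rule bracket_separate)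
  have "(\<Union>i\<in>UNIV. sup_sets P i) \<subseteq> \<Union>(set P)" for P using sup_sets_cases[of P] by blast
  then have "vars (evf P f n) \<subseteq> \<Union>(set P) \<times> UNIV" for P f n
    using vars_isub[of "f n" UNIV "sup_sets P"] by (fastforce simp: isubf_def)
  then show "vars (evf P f n) \<subseteq> \<Union>(set P) \<times> UNIV" "vars (evf Q g n) \<subseteq> \<Union>(set Q) \<times> UNIV" for n by blast+
qed (rule assms)

section \<open>Comparison of formal functions up to a given degree\<close>

text \<open>Modulo terms of degree above \<open>n\<close> the components of degree \<open>n\<close> are central in the star group and are
  added; \<open>near\<close> keeps track of such a central difference \<open>u\<close>.\<close>

definition near :: "nat \<Rightarrow> ('g, 'k) formal \<Rightarrow> ('g, 'k) formal \<Rightarrow> ('g, 'k) pol \<Rightarrow> bool" where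
  "near n f g u \<longleftrightarrow> order2 f \<and> order2 g \<and> (\<forall>i<n. f i = g i) \<and> f n = g n + u"

lemma near_refl: "order2 f \<Longrightarrow> near n f f 0"
  by (simp add: near_def)

lemma near_star: "near n f g u \<Longrightarrow> near n f' g' u' \<Longrightarrow> near n (f \<star> f') (g \<star> g') (u + u')"
proof -
  assume n: "near n f g u" "near n f' g' u'"
  have "(f \<star> f') i - f i - f' i = (g \<star> g') i - g i - g' i" if "i \<le> n" for i
    using n that by (intro star_top) (auto simp: near_def)
  moreover have "x = y + (a - c) + (b - d)" if "x - a - b = y - c - d" for x y a b c d :: "('g, 'k) pol"
  proof -
    have "x = (x - a - b) + (a + b)" by simp
    also have "\<dots> = y + (a - c) + (b - d)" unfolding that by simp
    finally show ?thesis .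
  qed
  ultimately have *: "(f \<star> f') i = (g \<star> g') i + (f i - g i) + (f' i - g' i)" if "i \<le> n" for i
    using that by blast
  show ?thesis using n *[of n] by (auto simp: near_def * order2_star algebra_simps)
qed

lemma near_evf: "near n f g u \<Longrightarrow> near n (evf P f) (evf P g) (ev P u)"
  by (auto simp: near_def isubf_apply isub_hom intro: order2_isubf)

lemma near_neg: "near n f g u \<Longrightarrow> near n (neg f) (neg g) (- u)"
  by (auto simp: near_def neg_def order2_def)

section \<open>Both sides of the cocycle equation\<close>

definition cocycle_left :: "('g, 'k) formal \<Rightarrow> ('g, 'k) formal" where
  "cocycle_left \<rho> = evf [{1}, {2}] \<rho> \<star> evf [{1, 2}, {3}] \<rho>"

definition cocycle_right :: "('g, 'k) formal \<Rightarrow> ('g, 'k) formal \<Rightarrow> ('g, 'k) formal" where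
  "cocycle_right \<phi> \<rho> = evf [{2}, {3}] \<rho> \<star> evf [{1}, {2, 3}] \<rho> \<star> \<phi>"

lemma ins_1: "f \<in> \<O> 1 \<Longrightarrow> ins [A] f = evf [A] f"
  by (rule ins_eq_isubf) simp

lemma ins_2: "f \<in> \<O> 2 \<Longrightarrow> ins [A, C] f = evf [A, C] f"
  by (rule ins_eq_isubf) (simp add: numeral_2_eq_2)

lemma ins_3: "f \<in> \<O> 3 \<Longrightarrow> ins [A, C, D] f = evf [A, C, D] f"
  by (rule ins_eq_isubf) (simp add: numeral_3_eq_3)

lemma cocycle_equation_iff:
  "\<rho> \<in> \<O> 2 \<Longrightarrow> cocycle_equation \<phi> \<rho> \<longleftrightarrow> cocycle_left \<rho> = cocycle_right \<phi> \<rho>"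
  by (simp add: cocycle_equation_def cocycle_left_def cocycle_right_def ins_2)

lemma near_cocycle_left:
  "near n f g u \<Longrightarrow> near n (cocycle_left f) (cocycle_left g) (ev [{1}, {2}] u + ev [{1, 2}, {3}] u)"
  unfolding cocycle_left_def by (intro near_star near_evf)

lemma near_cocycle_right:
  "near n f g u \<Longrightarrow> order2 \<phi> \<Longrightarrow>
    near n (cocycle_right \<phi> f) (cocycle_right \<phi> g) (ev [{2}, {3}] u + ev [{1}, {2, 3}] u)"
proof -
  assume n: "near n f g u" "order2 \<phi>"
  have "near n (cocycle_right \<phi> f) (cocycle_right \<phi> g) (ev [{2}, {3}] u + ev [{1}, {2, 3}] u + 0)"
    unfolding cocycle_right_def by (intro near_star near_evf near_refl n)
  then show ?thesis by simp
qed

lemma cocycle_left_\<O>: "\<rho> \<in> \<O> 2 \<Longrightarrow> cocycle_left \<rho> \<in> \<O> 3"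
  unfolding cocycle_left_def by (intro \<O>_star evf_\<O>[of _ 2]) auto

lemma cocycle_right_\<O>: "\<rho> \<in> \<O> 2 \<Longrightarrow> \<phi> \<in> \<O> 3 \<Longrightarrow> cocycle_right \<phi> \<rho> \<in> \<O> 3"
  unfolding cocycle_right_def by (intro \<O>_star evf_\<O>[of _ 2]) auto

lemma order2_cocycle_left: "order2 \<rho> \<Longrightarrow> order2 (cocycle_left \<rho>)"
  unfolding cocycle_left_def by (intro order2_star order2_isubf)

lemma order2_cocycle_right: "order2 \<rho> \<Longrightarrow> order2 \<phi> \<Longrightarrow> order2 (cocycle_right \<phi> \<rho>)"
  unfolding cocycle_right_def by (intro order2_star order2_isubf)

text \<open>Put \<open>\<kappa> = R \<star> neg L\<close>, where \<open>L\<close> and \<open>R\<close> are the two sides of the cocycle equation; its lowest component is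
  \<open>\<psi>\<close>.  Substituting the resulting expression for \<open>\<phi>\<close> into the pentagon equation cancels all \<open>\<rho>\<close>, up to
  conjugations, and leaves a pentagon equation for \<open>\<kappa>\<close>.  In degree \<open>n\<close> the conjugations disappear and the equation
  becomes linear.  Invariance of \<open>\<phi>\<close> is used to move it past the outer factors.\<close>

theorem obstruction_cocycle:
  assumes \<rho>: "order2 \<rho>" and \<phi>: "order2 \<phi>" "\<phi> \<in> \<O> 3" "\<phi> \<in> invariants"
    and pent: "evf [{1}, {2}, {3, 4}] \<phi> \<star> evf [{1, 2}, {3}, {4}] \<phi> =
      evf [{2}, {3}, {4}] \<phi> \<star> evf [{1}, {2, 3}, {4}] \<phi> \<star> evf [{1}, {2}, {3}] \<phi>"
    and eq: "\<forall>i<n. cocycle_right \<phi> \<rho> i = cocycle_left \<rho> i"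
  defines "\<psi> \<equiv> cocycle_right \<phi> \<rho> n - cocycle_left \<rho> n"
  shows "ev [{2}, {3}, {4}] \<psi> - ev [{1, 2}, {3}, {4}] \<psi> + ev [{1}, {2, 3}, {4}] \<psi>
      - ev [{1}, {2}, {3, 4}] \<psi> + ev [{1}, {2}, {3}] \<psi> = 0"
proof -
  define L where "L = cocycle_left \<rho>"
  define R where "R = cocycle_right \<phi> \<rho>"
  have ord: "order2 L" "order2 R"
    unfolding L_def R_def using \<rho> \<phi>(1) by (auto intro: order2_cocycle_left order2_cocycle_right)
  define \<kappa> where "\<kappa> = R \<star> neg L"
  have ordk: "order2 \<kappa>" unfolding \<kappa>_def using ord by (intro order2_star order2_neg)
  have "near n R L \<psi>"
    using ord eq by (auto simp: near_def L_def R_def \<psi>_def)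
  then have "near n (R \<star> neg L) (L \<star> neg L) (\<psi> + 0)"
    by (rule near_star) (rule near_refl, rule order2_neg, rule ord)
  then have near: "near n \<kappa> 0 \<psi>" by (simp add: \<kappa>_def star_neg[of L, OF ord(1)] del: zero_fun_apply)
  have base: "\<kappa> \<star> L = R"
    unfolding \<kappa>_def using ord by (simp add: star_assoc order2_neg star_neg star_0 del: zero_fun_apply)
  \<comment> \<open>The pentagon equation has five terms; the equations \<open>E\<close> below are the insertions of \<open>\<kappa> \<star> L = R\<close> that express them by
    the insertions of \<open>\<rho>\<close> and \<open>\<kappa>\<close>.\<close>
  define a b c d e f g h i j where defs: "a = evf [{1}, {2}] \<rho>" "b = evf [{1, 2}, {3}] \<rho>" "c = evf [{1, 2, 3}, {4}] \<rho>"
    "d = evf [{1, 2}, {3, 4}] \<rho>" "e = evf [{3}, {4}] \<rho>" "f = evf [{2}, {3, 4}] \<rho>" "g = evf [{1}, {2, 3, 4}] \<rho>"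
    "h = evf [{2}, {3}] \<rho>" "i = evf [{2, 3}, {4}] \<rho>" "j = evf [{1}, {2, 3}] \<rho>"
  define p1 p2 p3 p4 p5 where pdefs: "p1 = evf [{1}, {2}, {3, 4}] \<phi>" "p2 = evf [{1, 2}, {3}, {4}] \<phi>"
    "p3 = evf [{2}, {3}, {4}] \<phi>" "p4 = evf [{1}, {2, 3}, {4}] \<phi>" "p5 = evf [{1}, {2}, {3}] \<phi>"
  define k1 k2 k3 k4 k5 where kdefs: "k1 = evf [{1}, {2}, {3, 4}] \<kappa>" "k2 = evf [{1, 2}, {3}, {4}] \<kappa>"
    "k3 = evf [{2}, {3}, {4}] \<kappa>" "k4 = evf [{1}, {2, 3}, {4}] \<kappa>" "k5 = evf [{1}, {2}, {3}] \<kappa>"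
  have o: "order2 a" "order2 b" "order2 c" "order2 d" "order2 e" "order2 f" "order2 g" "order2 h" "order2 i" "order2 j"
    "order2 p1" "order2 p2" "order2 p3" "order2 p4" "order2 p5" "order2 k1" "order2 k2" "order2 k3" "order2 k4" "order2 k5"
    unfolding defs pdefs kdefs using \<rho> \<phi>(1) ordk by (simp_all add: order2_isubf)
  have base': "\<kappa> \<star> (evf [{1}, {2}] \<rho> \<star> evf [{1, 2}, {3}] \<rho>) = evf [{2}, {3}] \<rho> \<star> evf [{1}, {2, 3}] \<rho> \<star> \<phi>"
    using base by (simp only: L_def R_def cocycle_left_def cocycle_right_def)
  have E: "k1 \<star> (a \<star> d) = f \<star> g \<star> p1" "k2 \<star> (b \<star> c) = e \<star> d \<star> p2" "k3 \<star> (h \<star> i) = e \<star> f \<star> p3"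
    "k4 \<star> (j \<star> c) = i \<star> g \<star> p4" "k5 \<star> (a \<star> b) = h \<star> j \<star> p5"
    unfolding defs pdefs kdefs
    using arg_cong[OF base', of "evf [{1}, {2}, {3, 4}]"] arg_cong[OF base', of "evf [{1, 2}, {3}, {4}]"]
      arg_cong[OF base', of "evf [{2}, {3}, {4}]"] arg_cong[OF base', of "evf [{1}, {2, 3}, {4}]"]
      arg_cong[OF base', of "evf [{1}, {2}, {3}]"]
    by (simp_all add: evf_star evf_evf insert_commute)
  have P: "p1 \<star> p2 = p3 \<star> p4 \<star> p5" unfolding pdefs by (rule pent)
  have "bracket p3 g = 0" "bracket p5 c = 0"
    unfolding pdefs defs using \<phi> by (auto intro!: evf_invariant simp flip: numeral_3_eq_3)
  then have comm: "g \<star> p3 = p3 \<star> g" "c \<star> p5 = p5 \<star> c"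
    using star_commute o by auto
  have "bracket a e = 0" unfolding defs by (rule evf_separate) auto
  then have ae: "a \<star> e = e \<star> a" using star_commute o by auto
  note A = star_assoc order2_star order2_neg o
  \<comment> \<open>Both sides of the next chain are \<open>e \<star> f \<star> g\<close> times a side of the pentagon equation.\<close>
  have "e \<star> (k1 \<star> (neg e \<star> (a \<star> (k2 \<star> (b \<star> c))))) = e \<star> (k1 \<star> (neg e \<star> ((a \<star> e) \<star> (d \<star> p2))))"
    unfolding E by (simp add: A)
  also have "\<dots> = e \<star> ((k1 \<star> (a \<star> d)) \<star> p2)"
    unfolding ae by (simp add: A star_cancel_left)
  also have "\<dots> = e \<star> (f \<star> (g \<star> (p1 \<star> p2)))"
    unfolding E by (simp add: A)
  also have "\<dots> = e \<star> (f \<star> ((g \<star> p3) \<star> (p4 \<star> p5)))"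
    unfolding P by (simp add: A)
  also have "\<dots> = (e \<star> f \<star> p3) \<star> (g \<star> (p4 \<star> p5))"
    unfolding comm by (simp add: A)
  also have "\<dots> = (k3 \<star> (h \<star> i)) \<star> (g \<star> (p4 \<star> p5))"
    by (simp only: E)
  also have "\<dots> = k3 \<star> (h \<star> ((i \<star> g \<star> p4) \<star> p5))"
    by (simp add: A)
  also have "\<dots> = k3 \<star> (h \<star> ((k4 \<star> (j \<star> c)) \<star> p5))"
    by (simp only: E)
  also have "\<dots> = k3 \<star> (h \<star> (k4 \<star> (j \<star> (c \<star> p5))))"
    by (simp add: A)
  also have "\<dots> = k3 \<star> (h \<star> (k4 \<star> (neg h \<star> ((h \<star> j \<star> p5) \<star> c))))"
    unfolding comm by (simp add: A star_cancel_left)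
  also have "\<dots> = k3 \<star> (h \<star> (k4 \<star> (neg h \<star> (k5 \<star> (a \<star> (b \<star> c))))))"
    unfolding E[symmetric] by (simp add: A)
  finally have key: "e \<star> (k1 \<star> (neg e \<star> (a \<star> (k2 \<star> (b \<star> c)))))
    = k3 \<star> (h \<star> (k4 \<star> (neg h \<star> (k5 \<star> (a \<star> (b \<star> c))))))" .
  \<comment> \<open>Replacing every insertion of \<open>\<kappa>\<close> by zero turns both sides into \<open>a \<star> b \<star> c\<close>.\<close>
  have z: "evf Q 0 = 0" for Q by (simp add: isubf_def fun_eq_iff)
  have nk: "near n k1 0 (ev [{1}, {2}, {3, 4}] \<psi>)" "near n k2 0 (ev [{1, 2}, {3}, {4}] \<psi>)"
    "near n k3 0 (ev [{2}, {3}, {4}] \<psi>)" "near n k4 0 (ev [{1}, {2, 3}, {4}] \<psi>)" "near n k5 0 (ev [{1}, {2}, {3}] \<psi>)"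
    unfolding kdefs using near_evf[OF near] z by metis+
  have r: "near n a a 0" "near n b b 0" "near n c c 0" "near n e e 0" "near n (neg e) (neg e) 0" "near n h h 0"
    "near n (neg h) (neg h) 0"
    using o by (auto intro: near_refl)
  have "near n (e \<star> (k1 \<star> (neg e \<star> (a \<star> (k2 \<star> (b \<star> c)))))) (e \<star> (0 \<star> (neg e \<star> (a \<star> (0 \<star> (b \<star> c))))))
    (0 + (ev [{1}, {2}, {3, 4}] \<psi> + (0 + (0 + (ev [{1, 2}, {3}, {4}] \<psi> + (0 + 0))))))"
    by (intro near_star nk r)
  moreover have "e \<star> (0 \<star> (neg e \<star> (a \<star> (0 \<star> (b \<star> c))))) = a \<star> (b \<star> c)"
    by (simp add: A star_0 star_cancel_left del: zero_fun_apply)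
  ultimately have 1: "(e \<star> (k1 \<star> (neg e \<star> (a \<star> (k2 \<star> (b \<star> c)))))) n
    = (a \<star> (b \<star> c)) n + (ev [{1}, {2}, {3, 4}] \<psi> + ev [{1, 2}, {3}, {4}] \<psi>)"
    by (simp add: near_def)
  have "near n (k3 \<star> (h \<star> (k4 \<star> (neg h \<star> (k5 \<star> (a \<star> (b \<star> c))))))) (0 \<star> (h \<star> (0 \<star> (neg h \<star> (0 \<star> (a \<star> (b \<star> c)))))))
    (ev [{2}, {3}, {4}] \<psi> + (0 + (ev [{1}, {2, 3}, {4}] \<psi> + (0 + (ev [{1}, {2}, {3}] \<psi> + (0 + (0 + 0)))))))"
    by (intro near_star nk r)
  moreover have "0 \<star> (h \<star> (0 \<star> (neg h \<star> (0 \<star> (a \<star> (b \<star> c)))))) = a \<star> (b \<star> c)"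
    by (simp add: A star_0 star_cancel_left del: zero_fun_apply)
  ultimately have 2: "(k3 \<star> (h \<star> (k4 \<star> (neg h \<star> (k5 \<star> (a \<star> (b \<star> c))))))) n
    = (a \<star> (b \<star> c)) n + (ev [{2}, {3}, {4}] \<psi> + ev [{1}, {2, 3}, {4}] \<psi> + ev [{1}, {2}, {3}] \<psi>)"
    by (simp add: near_def add.assoc)
  have "ev [{1}, {2}, {3, 4}] \<psi> + ev [{1, 2}, {3}, {4}] \<psi>
    = ev [{2}, {3}, {4}] \<psi> + ev [{1}, {2, 3}, {4}] \<psi> + ev [{1}, {2}, {3}] \<psi>"
    using 1 2 key by simp
  then show ?thesis by (simp add: algebra_simps)
qed

section \<open>Existence of lifts\<close>

lemma homog_finite_basis:
  assumes F: "homog (K \<times> B) n F"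
  obtains B' where "finite B'" "B' \<subseteq> B" "homog (K \<times> B') n F"
proof (rule that)
  show "finite (snd ` vars F)" "snd ` vars F \<subseteq> B" using homog_vars[OF F] by auto
  show "homog (K \<times> snd ` vars F) n F"
    unfolding homog_def
  proof (intro ballI conjI)
    fix m assume m: "m \<in> keys F"
    then show "mdeg m = n" using F by (simp add: homog_def)
    have "keys m \<subseteq> K \<times> B" "keys m \<subseteq> vars F"
      using F m by (auto simp: homog_def vars_def)
    then show "keys m \<subseteq> K \<times> snd ` vars F" by force
  qed
qed

lemma near_local: "near n f g 0 \<Longrightarrow> i \<le> n \<Longrightarrow> f i = g i"
  by (cases "i = n") (auto simp: near_def)

lemma near_low: "near n f 0 (f n)" if "order2 f" "\<forall>i<n. f i = 0"
  using that by (simp add: near_def)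

text \<open>If the first or the last argument vanishes, then each side of the equation reduces to one factor.\<close>

lemma cocycle_normalized:
  assumes \<rho>: "\<rho> \<in> max_ideal_tensor 2" and \<phi>: "\<phi> \<in> max_ideal_tensor 3"
  shows "evf [{1}, {2}, {}] (cocycle_left \<rho>) = \<rho>" "evf [{1}, {2}, {}] (cocycle_right \<phi> \<rho>) = \<rho>"
    "evf [{}, {1}, {2}] (cocycle_left \<rho>) = \<rho>" "evf [{}, {1}, {2}] (cocycle_right \<phi> \<rho>) = \<rho>"
proof -
  have O: "\<rho> \<in> \<O> 2" "\<phi> \<in> \<O> 3" "order2 \<rho>" "order2 \<phi>"
    using \<rho> \<phi> order2_max_ideal_tensor[of \<rho> 2] order2_max_ideal_tensor[of \<phi> 3] by (auto simp: max_ideal_tensor_def)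
  have id: "evf [{Suc 0}, {2}] \<rho> = \<rho>" "evf [{Suc 0}, {2}, {}] \<rho> = \<rho>"
    by (rule evf_id[OF O(1)], auto simp: sup_sets_Cons)+
  have v2: "evf [A, {}] \<rho> = 0" "evf [{}, A] \<rho> = 0" "evf [{}, A, C] \<rho> = 0" for A C
    using evf_vanish[OF \<rho>, of 2 "[A, {}]"] evf_vanish[OF \<rho>, of 1 "[{}, A]"] evf_vanish[OF \<rho>, of 1 "[{}, A, C]"]
    by auto
  have v3: "evf [A, C, {}] \<phi> = 0" "evf [{}, A, C] \<phi> = 0" for A C
    using evf_vanish[OF \<phi>, of 3 "[A, C, {}]"] evf_vanish[OF \<phi>, of 1 "[{}, A, C]"] by auto
  show "evf [{1}, {2}, {}] (cocycle_left \<rho>) = \<rho>" "evf [{1}, {2}, {}] (cocycle_right \<phi> \<rho>) = \<rho>"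
    "evf [{}, {1}, {2}] (cocycle_left \<rho>) = \<rho>" "evf [{}, {1}, {2}] (cocycle_right \<phi> \<rho>) = \<rho>"
    using O by (simp_all add: cocycle_left_def cocycle_right_def evf_star evf_evf id v2 v3 star_0 del: zero_fun_apply)
qed

lemma star_degree_2:
  assumes "order2 f" "order2 g" shows "(f \<star> g) 2 = f 2 + g 2"
proof -
  have low: "\<forall>i<2. h i = 0" if "order2 h" for h
    using that by (auto simp: order2_def less_2_cases_iff)
  have "near 2 (f \<star> g) (0 \<star> 0) (f 2 + g 2)"
    using near_star[OF near_low near_low, of f 2 g] assms low by blast
  then show ?thesis by (simp add: near_def star_0 del: zero_fun_apply) simp
qed

lemma cocycle_degree_2:
  assumes r: "r \<in> tensor_space 2" and \<rho>: "order2 \<rho>" "\<rho> 2 = tpoly r" and \<phi>: "order2 \<phi>" "\<phi> 2 = 0"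
  shows "cocycle_left \<rho> 2 = cocycle_right \<phi> \<rho> 2"
proof -
  have "cocycle_left \<rho> 2 = ev [{1}, {2}] (tpoly r) + ev [{1, 2}, {3}] (tpoly r)"
    using \<rho> by (simp add: cocycle_left_def star_degree_2 order2_isubf isubf_apply)
  moreover have "cocycle_right \<phi> \<rho> 2 = ev [{2}, {3}] (tpoly r) + ev [{1}, {2, 3}] (tpoly r)"
    using \<rho> \<phi> by (simp add: cocycle_right_def star_degree_2 order2_star order2_isubf isubf_apply)
  ultimately show ?thesis by (simp add: tpoly_2[OF r] ev_rpol ev_rpol_sum)
qed

text \<open>In degree three the difference of the two sides is \<open>\<phi>\<^sub>3 - (CYB r + [r\<^sup>1\<^sup>2, r\<^sup>2\<^sup>3]) / 2\<close>.  Its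
  antisymmetrization is \<open>4 - 6 / 2 - 2 / 2 = 0\<close> times \<open>CYB r\<close>, where the first term comes from the condition that \<open>\<phi>\<close>
  lifts \<open>CYB r\<close>.\<close>

lemma obstruction_degree_3:
  assumes r: "r \<in> wedge 2" and \<rho>: "order2 \<rho>" "\<rho> 2 = tpoly r" "\<rho> 3 = 0"
    and \<phi>: "\<phi> \<in> max_ideal_tensor 3" "Alt3 (multilinear_part 3 \<phi>) = CYB r"
  shows "alternation (cocycle_right \<phi> \<rho> 3 - cocycle_left \<rho> 3) = 0"
proof -
  have t: "r \<in> tensor_space 2" using r by (simp add: wedge_def)
  have o: "order2 \<phi>" "\<phi> 2 = 0"
    using order2_max_ideal_tensor[OF \<phi>(1)] max_ideal_tensor_low[OF \<phi>(1), of 2] by auto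
  define C where "C = pol_bracket (rpol r 1 2) (rpol r 1 3) + pol_bracket (rpol r 1 2) (rpol r 2 3)
    + pol_bracket (rpol r 1 3) (rpol r 2 3)"
  define Q where "Q = pol_bracket (rpol r 1 2) (rpol r 2 3)"
  have alt: "alternation C = of_nat 6 * C" "alternation Q = of_nat 2 * C"
    unfolding C_def Q_def by (rule alternation_CYB[OF r])+
  have "cocycle_left \<rho> 3 = Const (1 / 2) * pol_bracket (rpol r 1 2) (rpol r 1 3 + rpol r 2 3)"
    using \<rho> unfolding cocycle_left_def
    by (subst star_degree_3) (auto simp: order2_isubf isubf_apply tpoly_2[OF t] ev_rpol ev_rpol_sum)
  moreover have "cocycle_right \<phi> \<rho> 3 = Const (1 / 2) * pol_bracket (rpol r 2 3) (rpol r 1 2 + rpol r 1 3) + \<phi> 3"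
    using \<rho> o unfolding cocycle_right_def
    by (subst star_degree_3, force intro: order2_isubf, simp, subst star_degree_3)
      (auto simp: order2_isubf isubf_apply tpoly_2[OF t] ev_rpol ev_rpol_sum)
  moreover have "pol_bracket (rpol r 2 3) (rpol r 1 2 + rpol r 1 3) = - Q - pol_bracket (rpol r 1 3) (rpol r 2 3)"
    using pol_bracket_antisym[of "rpol r 2 3" "rpol r 1 2"] pol_bracket_antisym[of "rpol r 2 3" "rpol r 1 3"]
    by (simp add: pol_bracket_add_right Q_def)
  ultimately have lr: "cocycle_left \<rho> 3 = Const (1 / 2) * (pol_bracket (rpol r 1 2) (rpol r 1 3) + Q)"
    "cocycle_right \<phi> \<rho> 3 = Const (1 / 2) * (- Q - pol_bracket (rpol r 1 3) (rpol r 2 3)) + \<phi> 3"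
    by (simp_all only: pol_bracket_add_right Q_def)
  have "cocycle_right \<phi> \<rho> 3 - cocycle_left \<rho> 3 = \<phi> 3 - Const (1 / 2) * C - Const (1 / 2) * Q"
    unfolding lr C_def Q_def[symmetric] by (simp add: algebra_simps)
  moreover have "Const (1 / 4) * alternation (\<phi> 3) = C"
  proof -
    have "homog ({1..3} \<times> B) 3 (\<phi> 3)" "\<And>a. a \<in> {1..3} \<Longrightarrow> involves a (\<phi> 3)"
      using \<phi>(1) by (auto simp: max_ideal_tensor_iff \<O>_iff)
    then have p: "tpoly (multilinear_part 3 \<phi>) = \<phi> 3" by (rule tpoly_multilinear_part)
    have "Const (1 / 4) * alternation (tpoly (multilinear_part 3 \<phi>)) = tpoly (CYB r)"
      unfolding \<phi>(2)[symmetric]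
      by (rule tpoly_Alt3[symmetric]) (auto simp: in_keys_iff lookup_multilinear_part split: if_splits)
    then show ?thesis unfolding p tpoly_CYB[OF t] C_def .
  qed
  then have "alternation (\<phi> 3) = of_nat 4 * C"
  proof -
    assume "Const (1 / 4) * alternation (\<phi> 3) = C"
    then have "of_nat 4 * C = (Const (of_nat 4) * Const (1 / 4)) * alternation (\<phi> 3)"
      by (simp only: Const_of_nat mult.assoc)
    also have "Const (of_nat 4) * Const (1 / 4) = (1 :: ('g, 'k) pol)" by (simp flip: Const_mult)
    finally show ?thesis by simp
  qed
  moreover have lin: "alternation (F - Const c * G - Const c * H) = alternation F - Const c * alternation G - Const c * alternation H" for F G H c
    by (simp add: alternation_def isub_hom algebra_simps)
  ultimately have "alternation (cocycle_right \<phi> \<rho> 3 - cocycle_left \<rho> 3)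
    = of_nat 4 * C - Const (1 / 2) * (of_nat 6 * C) - Const (1 / 2) * (of_nat 2 * C)"
    by (simp only: lin alt)
  also have "\<dots> = Const (4 - 1 / 2 * 6 - 1 / 2 * 2) * C"
    by (simp only: Const_of_nat[symmetric] Const_mult[symmetric] mult.assoc[symmetric] left_diff_distrib[symmetric])
      (simp add: Const_def single_diff[symmetric] left_diff_distrib[symmetric])
  finally show ?thesis by simp
qed

text \<open>Given the components below \<open>n\<close>, the error in degree \<open>n\<close> is a normalized cocycle \<open>\<psi>\<close>, hence the differential of some
  \<open>\<sigma>\<close>, and \<open>- \<sigma>\<close> is the component of degree \<open>n\<close>.\<close>

theorem exists_lift:
  assumes r: "r \<in> wedge 2" and \<phi>: "lift_of_Z (CYB r) \<phi>"
  shows "\<exists>\<rho>. lift_of_r r \<phi> \<rho>"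
proof -
  have t: "r \<in> tensor_space 2" using r by (simp add: wedge_def)
  have \<phi>m: "\<phi> \<in> max_ideal_tensor 3" "\<phi> \<in> \<O> 3" "\<phi> \<in> invariants" and Alt: "Alt3 (multilinear_part 3 \<phi>) = CYB r"
    and "pentagon \<phi>"
    using \<phi> by (auto simp: lift_of_Z_def max_ideal_tensor_iff)
  then have pent: "evf [{1}, {2}, {3, 4}] \<phi> \<star> evf [{1, 2}, {3}, {4}] \<phi> =
      evf [{2}, {3}, {4}] \<phi> \<star> evf [{1}, {2, 3}, {4}] \<phi> \<star> evf [{1}, {2}, {3}] \<phi>"
    by (simp add: pentagon_def ins_3)
  have \<phi>o: "order2 \<phi>" "\<phi> 2 = 0"
    using order2_max_ideal_tensor[OF \<phi>m(1)] max_ideal_tensor_low[OF \<phi>m(1), of 2] by auto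
  define ok where "ok n F \<longleftrightarrow> homog ({1..2} \<times> B) n F \<and> involves 1 F \<and> involves 2 F" for n and F :: "('g, 'k) pol"
  have range2: "{1..2 :: nat} = {1, 2}" by auto
  have ok_r: "ok 2 (tpoly r)"
    using homog_tpoly[of r 2 B] t by (auto simp: tensor_space_def ok_def)
  have ok_0: "ok n 0" for n by (simp add: ok_def involves_def)
  have ok_low: "F = 0" if "ok n F" "n \<le> 1" for n F
  proof (rule involves_all_degree[of "{1..2} \<times> B" n F 2])
    show "involves a F" if "a \<in> {1..2}" for a
      using that \<open>ok n F\<close> unfolding range2 ok_def by auto
  qed (use that in \<open>auto simp: ok_def\<close>)
  have ok_iff: "(\<forall>n. ok n (\<rho> n)) \<longleftrightarrow> \<rho> \<in> max_ideal_tensor 2" for \<rho>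
    unfolding max_ideal_tensor_iff \<O>_iff ok_def range2 by auto
  \<comment> \<open>The equation in degree \<open>n\<close> depends only on the components up to \<open>n\<close> once the first two of them vanish; this is
    why the condition on the order is repeated in each degree.\<close>
  define P where "P n \<rho> \<longleftrightarrow> ok n (\<rho> n) \<and>
    (2 \<le> n \<longrightarrow> order2 \<rho> \<and> \<rho> 2 = tpoly r \<and> cocycle_right \<phi> \<rho> n = cocycle_left \<rho> n)" for n \<rho>
  have eq_below: "cocycle_right \<phi> \<rho> i = cocycle_left \<rho> i" if "order2 \<rho>" "P i \<rho>" for \<rho> i
  proof (cases "2 \<le> i")
    case False
    then have "i = 0 \<or> i = 1" by auto
    then show ?thesis
      using order2_cocycle_left[OF that(1)] order2_cocycle_right[OF that(1) \<phi>o(1)] by (auto simp: order2_def)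
  qed (use that in \<open>simp add: P_def\<close>)
  have loc: "P n f = P n g" if "\<forall>i\<le>n. f i = g i" for n and f g :: "('g, 'k) formal"
  proof (cases "2 \<le> n")
    case True
    then have o: "order2 f \<longleftrightarrow> order2 g" using that by (simp add: order2_def)
    have "cocycle_left f n = cocycle_left g n \<and> cocycle_right \<phi> f n = cocycle_right \<phi> g n" if "order2 f"
    proof -
      have "near n f g 0" using that o \<open>\<forall>i\<le>n. f i = g i\<close> by (simp add: near_def)
      then show ?thesis
        using near_cocycle_left[of n f g 0] near_cocycle_right[OF _ \<phi>o(1), of n f g 0] by (simp add: near_def)
    qed
    then show ?thesis using that o True by (auto simp: P_def)
  qed (use that in \<open>auto simp: P_def\<close>)
  have "\<exists>\<rho>. \<forall>n. P n \<rho>"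
  proof (rule exists_sequence)
    fix n and \<rho>' :: "('g, 'k) formal" assume IH: "\<forall>m<n. P m \<rho>'"
    have low: "\<rho>' i = 0" if "i < n" "i \<le> 1" for i
      using IH that by (intro ok_low[of i]) (auto simp: P_def)
    consider "n \<le> 1" | "n = 2" | "2 < n" by linarith
    then show "\<exists>a. P n (\<rho>'(n := a))"
    proof cases
      case 1
      then show ?thesis by (intro exI[of _ 0]) (simp add: P_def ok_0)
    next
      case 2
      then have "order2 (\<rho>'(n := tpoly r))" using low by (simp add: order2_def)
      then show ?thesis
        using 2 cocycle_degree_2[OF t, of "\<rho>'(n := tpoly r)" \<phi>] \<phi>o by (intro exI[of _ "tpoly r"]) (simp add: P_def ok_r)
    next
      case 3
      define \<rho> where "\<rho> i = (if i < n then \<rho>' i else 0)" for i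
      have P\<rho>: "P m \<rho>" if "m < n" for m
        using IH that by (subst loc[of m \<rho> \<rho>']) (auto simp: \<rho>_def)
      have o: "order2 \<rho>" and \<rho>2: "\<rho> 2 = tpoly r" using P\<rho>[OF 3] by (simp_all add: P_def)
      have "ok m (\<rho> m)" for m
        using P\<rho>[of m] ok_0 by (cases "m < n") (simp_all add: P_def \<rho>_def)
      then have "\<rho> \<in> max_ideal_tensor 2" using ok_iff by blast
      then have \<rho>m: "\<rho> \<in> max_ideal_tensor 2" "\<rho> \<in> \<O> 2" by (auto simp: max_ideal_tensor_iff)
      have eq: "\<forall>i<n. cocycle_right \<phi> \<rho> i = cocycle_left \<rho> i"
        using eq_below[OF o P\<rho>] by blast
      define \<psi> where "\<psi> = cocycle_right \<phi> \<rho> n - cocycle_left \<rho> n"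
      have "homog ({1..3} \<times> B) n \<psi>"
        unfolding \<psi>_def using cocycle_left_\<O>[OF \<rho>m(2)] cocycle_right_\<O>[OF \<rho>m(2) \<phi>m(2)]
        by (intro homog_diff) (auto simp: \<O>_iff)
      then obtain B' where B': "finite B'" "B' \<subseteq> B" "homog ({1..3} \<times> B') n \<psi>"
        by (rule homog_finite_basis)
      note norm = cocycle_normalized[OF \<rho>m(1) \<phi>m(1)]
      have n1: "ev [{1}, {2}, {}] \<psi> = 0"
        using fun_cong[OF norm(1), of n] fun_cong[OF norm(2), of n] by (simp add: \<psi>_def isubf_apply isub_hom)
      have n2: "ev [{}, {1}, {2}] \<psi> = 0"
        using fun_cong[OF norm(3), of n] fun_cong[OF norm(4), of n] by (simp add: \<psi>_def isubf_apply isub_hom)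
      have cocycle: "ev [{2}, {3}, {4}] \<psi> - ev [{1, 2}, {3}, {4}] \<psi> + ev [{1}, {2, 3}, {4}] \<psi>
        - ev [{1}, {2}, {3, 4}] \<psi> + ev [{1}, {2}, {3}] \<psi> = 0"
        unfolding \<psi>_def by (rule obstruction_cocycle[OF o \<phi>o(1) \<phi>m(2,3) pent eq])
      have alt: "alternation \<psi> = 0" if "n = 3"
        unfolding \<psi>_def that
        by (rule obstruction_degree_3[OF r o \<rho>2 _ \<phi>m(1) Alt]) (use that in \<open>simp add: \<rho>_def\<close>)
      obtain \<sigma> where \<sigma>: "homog ({1..2} \<times> B') n \<sigma>" "ev [{1}, {}] \<sigma> = 0" "ev [{}, {1}] \<sigma> = 0"
        "\<psi> = ev [{2}, {3}] \<sigma> - ev [{1, 2}, {3}] \<sigma> + ev [{1}, {2, 3}] \<sigma> - ev [{1}, {2}] \<sigma>"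
        using cohomology_3[OF B'(3,1) _ n1 n2 cocycle alt] 3 by auto
      have ok: "ok n (- \<sigma>)"
      proof -
        have "homog ({1..2} \<times> B) n \<sigma>" using \<sigma>(1) by (rule homog_mono) (use B'(2) in auto)
        moreover have v: "vars \<sigma> \<subseteq> {1..2} \<times> UNIV" using homog_vars[OF \<sigma>(1)] by auto
        moreover have "involves 2 \<sigma>"
          by (rule isub_0_involves[OF v _ \<sigma>(2)]) (auto simp: sup_sets_Cons)
        moreover have "involves 1 \<sigma>"
        proof (rule isub_0_involves[OF v])
          have "ev [{2}] (ev [{}, {1}] \<sigma>) = 0" by (simp only: \<sigma>(3) isub_0)
          then show "ev [{}, {2}] \<sigma> = 0" by (simp add: ev_ev)
        qed (auto simp: sup_sets_Cons)
        ultimately show ?thesis by (simp add: ok_def homog_minus involves_def)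
      qed
      have near: "near n (\<rho>(n := - \<sigma>)) \<rho> (- \<sigma>)"
        using o 3 by (auto simp: near_def order2_def \<rho>_def)
      have "cocycle_left (\<rho>(n := - \<sigma>)) n = cocycle_left \<rho> n - ev [{1}, {2}] \<sigma> - ev [{1, 2}, {3}] \<sigma>"
        using near_cocycle_left[OF near] by (simp add: near_def isub_hom)
      also have "\<dots> = cocycle_right \<phi> \<rho> n - ev [{2}, {3}] \<sigma> - ev [{1}, {2, 3}] \<sigma>"
        using \<sigma>(4) by (simp add: \<psi>_def algebra_simps)
      also have "\<dots> = cocycle_right \<phi> (\<rho>(n := - \<sigma>)) n"
        using near_cocycle_right[OF near \<phi>o(1)] by (simp add: near_def isub_hom)
      finally have "P n (\<rho>(n := - \<sigma>))"
        using 3 ok near \<rho>2 by (simp add: P_def near_def)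
      moreover have "P n (\<rho>(n := - \<sigma>)) = P n (\<rho>'(n := - \<sigma>))"
        by (rule loc) (auto simp: \<rho>_def)
      ultimately show ?thesis by blast
    qed
  qed (rule loc)
  then obtain \<rho> where P: "\<And>n. P n \<rho>" by blast
  have o: "order2 \<rho>" and \<rho>2: "\<rho> 2 = tpoly r" using P[of 2] by (simp_all add: P_def)
  have "\<rho> \<in> max_ideal_tensor 2" using P ok_iff by (auto simp: P_def)
  then have \<rho>m: "\<rho> \<in> max_ideal_tensor 2" "\<rho> \<in> \<O> 2" by (auto simp: max_ideal_tensor_iff)
  have "cocycle_left \<rho> = cocycle_right \<phi> \<rho>"
    using eq_below[OF o P] by (intro ext) simp
  moreover have "multilinear_part 2 \<rho> = r"
    by (rule multilinear_part_tpoly[of r 2 \<rho>, OF _ \<rho>2]) (use t in \<open>auto simp: tensor_space_def\<close>)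
  ultimately have "lift_of_r r \<phi> \<rho>"
    using \<rho>m by (simp add: lift_of_r_def cocycle_equation_iff)
  then show ?thesis by blast
qed

section \<open>Uniqueness of lifts up to gauge transformations\<close>

definition gauge_transform :: "('g, 'k) formal \<Rightarrow> ('g, 'k) formal \<Rightarrow> ('g, 'k) formal" where
  "gauge_transform l \<rho> = evf [{1}] l \<star> evf [{2}] l \<star> \<rho> \<star> evf [{1, 2}] (neg l)"

lemma gauge_eq: "l \<in> \<O> 1 \<Longrightarrow> gauge l \<rho> = gauge_transform l \<rho>"
  by (simp add: gauge_def gauge_transform_def ins_1 \<O>_neg)

lemma near_gauge:
  assumes "near n l l' u" "order2 \<rho>"
  shows "near n (gauge_transform l \<rho>) (gauge_transform l' \<rho>) (ev [{1}] u + ev [{2}] u - ev [{1, 2}] u)"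
proof -
  have "near n (gauge_transform l \<rho>) (gauge_transform l' \<rho>) (ev [{1}] u + ev [{2}] u + 0 + ev [{1, 2}] (- u))"
    unfolding gauge_transform_def by (intro near_star near_evf near_refl near_neg assms)
  then show ?thesis by (simp add: isub_hom)
qed

text \<open>The product of the two gauge transformed factors telescopes.  The remaining factors are separated by
  moving functions of different arguments past each other, and \<open>\<phi>\<close> past the function \<open>neg abc\<close> of the sum of all arguments.\<close>

lemma gauge_cocycle:
  assumes l: "l \<in> \<O> 1" "order2 l" and \<rho>: "\<rho> \<in> \<O> 2" "order2 \<rho>" and \<phi>: "\<phi> \<in> \<O> 3" "order2 \<phi>" "\<phi> \<in> invariants"
    and eq: "cocycle_left \<rho> = cocycle_right \<phi> \<rho>"
  shows "cocycle_left (gauge_transform l \<rho>) = cocycle_right \<phi> (gauge_transform l \<rho>)"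
proof -
  define a b c ab bc abc where ldefs: "a = evf [{1}] l" "b = evf [{2}] l" "c = evf [{3}] l"
    "ab = evf [{1, 2}] l" "bc = evf [{2, 3}] l" "abc = evf [{1, 2, 3}] l"
  define p q s t where pdefs: "p = evf [{1}, {2}] \<rho>" "q = evf [{1, 2}, {3}] \<rho>" "s = evf [{2}, {3}] \<rho>" "t = evf [{1}, {2, 3}] \<rho>"
  have o: "order2 a" "order2 b" "order2 c" "order2 ab" "order2 bc" "order2 abc" "order2 p" "order2 q" "order2 s" "order2 t"
    "order2 \<phi>"
    unfolding ldefs pdefs using l \<rho> \<phi> by (simp_all add: order2_isubf)
  note A = star_assoc order2_star order2_neg o
  have E: "p \<star> q = s \<star> t \<star> \<phi>"
    using eq by (simp add: cocycle_left_def cocycle_right_def pdefs)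
  have L: "cocycle_left (gauge_transform l \<rho>) = (a \<star> b \<star> p \<star> neg ab) \<star> (ab \<star> c \<star> q \<star> neg abc)"
    unfolding cocycle_left_def gauge_transform_def ldefs pdefs
    by (simp add: evf_star evf_evf isubf_neg insert_commute)
  have R: "cocycle_right \<phi> (gauge_transform l \<rho>) = (b \<star> c \<star> s \<star> neg bc) \<star> (a \<star> bc \<star> t \<star> neg abc) \<star> \<phi>"
    unfolding cocycle_right_def gauge_transform_def ldefs pdefs
    by (simp add: evf_star evf_evf isubf_neg insert_commute)
  have "bracket p c = 0" "bracket a bc = 0" "bracket a b = 0" "bracket a c = 0" "bracket s a = 0"
    unfolding ldefs pdefs by (rule evf_separate; simp)+
  moreover have "bracket \<phi> abc = 0"
  proof -
    have "evf [{1}, {2}, {3}] \<phi> = \<phi>"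
    proof (rule evf_id[OF \<phi>(1)])
      fix i :: nat assume "i \<in> {1..3}"
      then have "i = 1 \<or> i = 2 \<or> i = 3" by auto
      then show "sup_sets [{1}, {2}, {3}] i = {i}" by auto
    qed
    moreover have "bracket (evf [{1}, {2}, {3}] \<phi>) (evf [{1, 2, 3}] l) = 0"
      using \<phi> by (intro evf_invariant) (auto simp flip: numeral_3_eq_3)
    ultimately show ?thesis by (simp add: ldefs)
  qed
  then have "bracket \<phi> (neg abc) = 0" by (simp only: bracket_neg) simp
  ultimately have comm: "p \<star> c = c \<star> p" "a \<star> bc = bc \<star> a" "a \<star> b = b \<star> a" "a \<star> c = c \<star> a" "s \<star> a = a \<star> s"
    "\<phi> \<star> neg abc = neg abc \<star> \<phi>"
    using star_commute o order2_neg by blast+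
  have "cocycle_left (gauge_transform l \<rho>) = a \<star> (b \<star> ((p \<star> c) \<star> (q \<star> neg abc)))"
    unfolding L by (simp add: A star_cancel_left)
  also have "\<dots> = a \<star> (b \<star> (c \<star> ((p \<star> q) \<star> neg abc)))"
    unfolding comm(1) by (simp add: A)
  also have "\<dots> = (a \<star> b) \<star> (c \<star> (s \<star> (t \<star> (\<phi> \<star> neg abc))))"
    unfolding E by (simp add: A)
  also have "\<dots> = b \<star> ((a \<star> c) \<star> (s \<star> (t \<star> (neg abc \<star> \<phi>))))"
    unfolding comm(3,6) by (simp add: A)
  also have "\<dots> = b \<star> (c \<star> ((a \<star> s) \<star> (t \<star> (neg abc \<star> \<phi>))))"
    unfolding comm(4) by (simp add: A)
  also have "\<dots> = b \<star> (c \<star> (s \<star> (neg bc \<star> ((bc \<star> a) \<star> (t \<star> (neg abc \<star> \<phi>))))))"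
    unfolding comm(5)[symmetric] by (simp add: A star_cancel_left)
  also have "\<dots> = cocycle_right \<phi> (gauge_transform l \<rho>)"
    unfolding R comm(2)[symmetric] by (simp add: A)
  finally show ?thesis .
qed

lemma gauge_vanish:
  assumes l: "l \<in> \<O> 1" "order2 l" and \<rho>: "\<rho> \<in> max_ideal_tensor 2"
  shows "evf [{1}, {}] (gauge_transform l \<rho>) = 0"
proof -
  have o: "order2 (evf [{Suc 0}] l)" using l by (intro order2_isubf)
  have "evf [{}] l n = 0" for n
  proof (cases "n = 0")
    case False
    have "homog ({1..1} \<times> B) n (l n)" using l by (auto simp: \<O>_iff)
    then show ?thesis unfolding isubf_apply using False by (rule ev_empty) simp
  qed (use l in \<open>simp add: order2_def isubf_apply\<close>)
  then have 0: "evf [{}] l = 0" by auto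
  have 1: "evf [{Suc 0}, {}] \<rho> = 0" by (rule evf_vanish[OF \<rho>, of 2]) auto
  have "evf [{1}, {}] (gauge_transform l \<rho>) = evf [{Suc 0}] l \<star> 0 \<star> 0 \<star> neg (evf [{Suc 0}] l)"
    unfolding gauge_transform_def by (simp add: evf_star evf_evf isubf_neg 0 1 del: zero_fun_apply)
  then show ?thesis using o by (simp add: star_0 star_neg del: zero_fun_apply)
qed

text \<open>In the lowest degree \<open>n\<close> where a gauge transform of \<open>\<rho>\<close> differs from \<open>\<rho>'\<close>, the difference is a cocycle, as both
  are lifts.  It is the coboundary of some \<open>\<sigma>\<close>, and \<open>- \<sigma>\<close> is the next component of the gauge element.  In degree two
  both lifts are given by \<open>r\<close>, so that the gauge element can start in degree three, where the cohomology
  vanishes.\<close>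

theorem unique_lift:
  assumes \<phi>: "\<phi> \<in> max_ideal_tensor 3" "\<phi> \<in> invariants" and \<rho>: "lift_of_r r \<phi> \<rho>" and \<rho>': "lift_of_r r \<phi> \<rho>'"
  shows "\<exists>l\<in>max_ideal_sq 1. \<rho>' = gauge l \<rho>"
proof -
  have \<phi>o: "order2 \<phi>" "\<phi> \<in> \<O> 3" using \<phi> order2_max_ideal_tensor[OF \<phi>(1)] by (auto simp: max_ideal_tensor_iff)
  have m: "\<rho> \<in> max_ideal_tensor 2" "\<rho>' \<in> max_ideal_tensor 2" "\<rho> \<in> \<O> 2" "\<rho>' \<in> \<O> 2"
    using \<rho> \<rho>' by (auto simp: lift_of_r_def max_ideal_tensor_iff)
  have o: "order2 \<rho>" "order2 \<rho>'" using m order2_max_ideal_tensor by blast+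
  have eq: "cocycle_left \<rho> = cocycle_right \<phi> \<rho>" "cocycle_left \<rho>' = cocycle_right \<phi> \<rho>'"
    using \<rho> \<rho>' m by (auto simp: lift_of_r_def cocycle_equation_iff)
  have deg2: "f 2 = tpoly r" if "lift_of_r r \<phi> f" for f
    using that tpoly_multilinear_part[of "{1..2} \<times> B" 2 f]
    by (auto simp: lift_of_r_def max_ideal_tensor_iff \<O>_iff)
  \<comment> \<open>The condition on the order is repeated in each degree because otherwise the gauge transform in degree \<open>n\<close> would
    depend on higher components of \<open>l\<close>.\<close>
  define P where "P n l \<longleftrightarrow> (if n \<le> 2 then l n = 0
    else order2 l \<and> homog ({1..1} \<times> B) n (l n) \<and> gauge_transform l \<rho> n = \<rho>' n)" for n l
  have loc: "P n f = P n g" if "\<forall>i\<le>n. f i = g i" for n and f g :: "('g, 'k) formal"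
  proof (cases "n \<le> 2")
    case False
    then have o': "order2 f \<longleftrightarrow> order2 g" using that by (simp add: order2_def)
    have "gauge_transform f \<rho> n = gauge_transform g \<rho> n" if "order2 f"
    proof -
      have "near n f g 0" using that o' \<open>\<forall>i\<le>n. f i = g i\<close> by (simp add: near_def)
      then show ?thesis using near_gauge[OF _ o(1), of n f g 0] by (simp add: near_def)
    qed
    then show ?thesis using that o' False by (auto simp: P_def)
  qed (use that in \<open>auto simp: P_def\<close>)
  have low: "gauge_transform l \<rho> i = \<rho>' i" if l: "order2 l" "l 2 = 0" and "i \<le> 2" for l i
  proof -
    have "near 2 l 0 0"
      using l by (auto simp: near_def order2_def less_2_cases_iff)
    then have "near 2 (gauge_transform l \<rho>) (gauge_transform 0 \<rho>) 0"
      using near_gauge[OF _ o(1), of 2 l 0 0] by simp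
    moreover have "gauge_transform 0 \<rho> = \<rho>"
    proof -
      have "evf Q 0 = 0" "neg (0 :: ('g, 'k) formal) = 0" for Q by (auto simp: isubf_def neg_def fun_eq_iff)
      then show ?thesis using o by (simp add: gauge_transform_def star_0 del: zero_fun_apply)
    qed
    ultimately have "gauge_transform l \<rho> i = \<rho> i" using near_local \<open>i \<le> 2\<close> by metis
    moreover have "\<rho> i = \<rho>' i"
    proof -
      consider "i = 0" | "i = 1" | "i = 2" using \<open>i \<le> 2\<close> by linarith
      then show ?thesis using o deg2[OF \<rho>] deg2[OF \<rho>'] by cases (auto simp: order2_def)
    qed
    ultimately show ?thesis by simp
  qed
  have "\<exists>l. \<forall>n. P n l"
  proof (rule exists_sequence)
    fix n and l' :: "('g, 'k) formal" assume IH: "\<forall>m<n. P m l'"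
    show "\<exists>a. P n (l'(n := a))"
    proof (cases "n \<le> 2")
      case False
      define l where "l i = (if i < n then l' i else 0)" for i
      have l0: "l 0 = 0" "l 1 = 0" "l 2 = 0" using IH False by (auto simp: P_def l_def)
      then have lo: "order2 l" by (simp add: order2_def)
      have Pl: "P m l" if "m < n" for m
        using IH that by (subst loc[of m l l']) (auto simp: l_def)
      have "homog ({1..1} \<times> B) m (l m)" for m
      proof (cases "m < n")
        case True
        then show ?thesis using Pl[of m] by (auto simp: P_def split: if_splits)
      qed (simp add: l_def)
      then have lO: "l \<in> \<O> 1" by (simp add: \<O>_iff)
      define \<gamma> where "\<gamma> = gauge_transform l \<rho>"
      have \<gamma>O: "\<gamma> \<in> \<O> 2"
        unfolding \<gamma>_def gauge_transform_def using lO m by (intro \<O>_star evf_\<O>[of _ 1] \<O>_neg) auto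
      have \<gamma>o: "order2 \<gamma>"
        unfolding \<gamma>_def gauge_transform_def using lo o by (intro order2_star order2_isubf order2_neg)
      have \<gamma>eq: "cocycle_left \<gamma> = cocycle_right \<phi> \<gamma>"
        unfolding \<gamma>_def by (rule gauge_cocycle[OF lO lo m(3) o(1) \<phi>o(2,1) \<phi>(2) eq(1)])
      define \<chi> where "\<chi> = \<rho>' n - \<gamma> n"
      have below: "\<forall>i<n. \<rho>' i = \<gamma> i"
      proof (intro allI impI)
        fix i assume "i < n"
        then show "\<rho>' i = \<gamma> i"
          using Pl[of i] low[OF lo l0(3), of i] by (cases "i \<le> 2") (auto simp: \<gamma>_def P_def)
      qed
      then have near: "near n \<rho>' \<gamma> \<chi>" using o \<gamma>o by (simp add: near_def \<chi>_def)
      have "ev [{1}, {2}] \<chi> + ev [{1, 2}, {3}] \<chi> = ev [{2}, {3}] \<chi> + ev [{1}, {2, 3}] \<chi>"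
        using near_cocycle_left[OF near] near_cocycle_right[OF near \<phi>o(1)] eq(2) \<gamma>eq by (simp add: near_def)
      then have cocycle: "ev [{2}, {3}] \<chi> - ev [{1, 2}, {3}] \<chi> + ev [{1}, {2, 3}] \<chi> - ev [{1}, {2}] \<chi> = 0"
        by (simp add: algebra_simps)
      have "homog ({1..2} \<times> B) n \<chi>"
        unfolding \<chi>_def using m(4) \<gamma>O by (intro homog_diff) (auto simp: \<O>_iff)
      then obtain B' where B': "finite B'" "B' \<subseteq> B" "homog ({1..2} \<times> B') n \<chi>"
        by (rule homog_finite_basis)
      have "evf [{1}, {}] \<gamma> n = 0" "evf [{1}, {}] \<rho>' n = 0"
        using gauge_vanish[OF lO lo m(1)] evf_vanish[OF m(2), of 2 "[{1}, {}]"] by (auto simp: \<gamma>_def)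
      then have norm: "ev [{1}, {}] \<chi> = 0" by (simp add: \<chi>_def isubf_apply isub_hom)
      obtain \<sigma> where \<sigma>: "homog ({1..1} \<times> B') n \<sigma>" "\<chi> = ev [{1, 2}] \<sigma> - ev [{1}] \<sigma> - ev [{2}] \<sigma>"
        using cohomology_2[OF B'(3,1) _ norm cocycle] False by auto
      have nl: "near n (l(n := - \<sigma>)) l (- \<sigma>)"
        using lo False by (auto simp: near_def order2_def l_def)
      have "gauge_transform (l(n := - \<sigma>)) \<rho> n = \<gamma> n + \<chi>"
        using near_gauge[OF nl o(1)] by (simp add: near_def isub_hom \<gamma>_def \<sigma>(2))
      also have "\<dots> = \<rho>' n" by (simp add: \<chi>_def)
      finally have "gauge_transform (l(n := - \<sigma>)) \<rho> n = \<rho>' n" .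
      moreover have "homog ({1..1} \<times> B) n (- \<sigma>)"
        by (rule homog_minus, rule homog_mono[OF \<sigma>(1)]) (use B'(2) in auto)
      ultimately have "P n (l(n := - \<sigma>))" using False nl by (simp add: P_def near_def)
      moreover have "P n (l(n := - \<sigma>)) = P n (l'(n := - \<sigma>))"
        by (rule loc) (auto simp: l_def)
      ultimately show ?thesis by blast
    qed (auto simp: P_def)
  qed (rule loc)
  then obtain l where P: "\<And>n. P n l" by blast
  have l: "order2 l" "l 2 = 0" using P[of 0] P[of 1] P[of 2] by (simp_all add: P_def order2_def)
  have "homog ({1..1} \<times> B) n (l n)" for n
    using P[of n] by (auto simp: P_def split: if_splits)
  then have lO: "l \<in> \<O> 1" by (simp add: \<O>_iff)
  have "\<rho>' n = gauge_transform l \<rho> n" for n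
    using P[of n] low[OF l, of n] by (cases "n \<le> 2") (auto simp: P_def)
  then have "\<rho>' = gauge l \<rho>" unfolding gauge_eq[OF lO] by (rule ext)
  moreover have "l \<in> max_ideal_sq 1" using lO l by (simp add: max_ideal_sq_def order2_def)
  ultimately show ?thesis by blast
qed

end

theorem theorem1p3:
  fixes scale :: "'k::field_char_0 \<Rightarrow> 'g::ab_group_add \<Rightarrow> 'g"
    and br :: "'g \<Rightarrow> 'g \<Rightarrow> 'g" and B :: "'g set"
    and \<delta> :: "'g \<Rightarrow> ('g, 'k) tensor" and r Z :: "('g, 'k) tensor"
    and \<phi> :: "('g, 'k) formal"
  assumes "coboundary_lie_bialgebra scale br B \<delta> r Z"
    and "lie_algebra_basis.lift_of_Z scale br B Z \<phi>"
  shows "(\<exists>\<rho>. lie_algebra_basis.lift_of_r scale br B r \<phi> \<rho>) \<and>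
    (\<forall>\<rho> \<rho>'. lie_algebra_basis.lift_of_r scale br B r \<phi> \<rho> \<longrightarrow>
       lie_algebra_basis.lift_of_r scale br B r \<phi> \<rho>' \<longrightarrow>
       (\<exists>l\<in>lie_algebra_basis.max_ideal_sq B 1.
          \<rho>' = lie_algebra_basis.gauge scale br B l \<rho>))"
proof -
  interpret coboundary_lie_bialgebra scale br B \<delta> r Z by (rule assms)
  have \<phi>: "lift_of_Z (CYB r) \<phi>" using assms(2) by (simp add: Z_CYB)
  then have "\<phi> \<in> max_ideal_tensor 3" "\<phi> \<in> invariants" by (auto simp: lift_of_Z_def)
  then show ?thesis using exists_lift[OF r_wedge \<phi>] unique_lift by blast
qed

end
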